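(* Let $N$ be a prime, let $B=B(\Gamma,\rho)\subseteq\mathbb{Z}/N\mathbb{Z}$ be a Bohr set of codimension $d$, let $\varepsilon\in(0,1)$, and let $\phi:B\times B\times B\to\mathbb{T}$ be an $\varepsilon$-trilinear form. Then there exist a generalized polynomial $g:[0,N-1]^3\to\mathbb{T}$ which is a sum of at most $(2d\log(\rho^{-1}\varepsilon^{-1}))^{O(1)}$ terms, each of one of the forms $$\{\{\alpha x\}\beta y\}\gamma z,\quad \{\alpha xy\}\gamma z,\quad \{\alpha x\}\beta yz,\quad \alpha xyz,\quad \{\alpha x\}\{\beta y\}\gamma z,\quad \{\beta y\}\alpha xz$$ for some reals $\alpha,\beta,\gamma$ (which may differ from term to term), and a bilinear Bohr variety $W\subseteq B\times B$ and a Bohr set $B'\subseteq B$, both of codimension at most $(2d\log(\rho^{-1}\varepsilon^{-1}))^{O(1)}$ and radius at least $\exp(-(2d\log(\rho^{-1}\varepsilon^{-1}))^{O(1)})$, such that $$\|\phi(x,y,z)-g(\iota(x),\iota(y),\iota(z))\|_{\mathbb{T}}\le O(d^d\sqrt\varepsilon)$$ for all $(x,y)\in W$ and $z\in B'$.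
   Context: $\mathbb{T}=\mathbb{R}/\mathbb{Z}$, $\|\cdot\|_{\mathbb{T}}$ is distance to $0$. For real $x$, $\{x\}$ is the unique real in $(-1/2,1/2]$ with $x-\{x\}\in\mathbb{Z}$; real-valued expressions are read modulo $1$ as elements of $\mathbb{T}$. $\iota:\mathbb{Z}/N\mathbb{Z}\to[0,N-1]\subseteq\mathbb{Z}$ sends a residue to its representative. Bohr sets in a finite abelian group $G$: $\hat G$ is the group of homomorphisms $G\to\mathbb{T}$ and $B(\Gamma,\rho)=\{x\in G:\|\chi(x)\|_{\mathbb{T}}\le\rho\ \forall\chi\in\Gamma\}$ for $\Gamma\subseteq\hat G$, $\rho\in(0,1)$; $|\Gamma|$ is the codimension, $\rho$ the radius. A map $\phi:B^3\to\mathbb{T}$ is an $\varepsilon$-trilinear form if, for each choice of one coordinate and of fixed values in $B$ of the other two coordinates, the resulting map $\psi$ of the chosen coordinate satisfies $\|\psi(u+v)-\psi(u)-\psi(v)\|_{\mathbb{T}}\le\varepsilon$ whenever $u,v,u+v\in B$. Freiman-linear map: a map $L:S\to\hat G$ on a set $S\ni0$ with $L(0)=0$ and $L(a)+L(b)=L(c)+L(d)$ whenever $a,b,c,d\in S$, $a+b=c+d$. Bilinear Bohr variety in $G\times G$: a set of the form $\{(x,y)\in B(\Gamma_1;\sigma)\times B(\Gamma_2;\sigma):x\in B(L_1(y),\dots,L_r(y);\sigma)\}$, where $L_1,\dots,L_r:B(\Gamma_2;\sigma)\to\hat G$ are Freiman-linear, or the same with the roles of the two coordinates exchanged; it has codimension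 at most $D$ if $|\Gamma_1|,|\Gamma_2|,r\le D$, and radius $\sigma$. Asymptotic convention: there is an absolute constant $C>0$ such that, for $X\ge0$, "$X^{O(1)}$" in an upper bound means at most $(2+X)^C$, "$\exp(-X^{O(1)})$" in a lower bound means at least $\exp(-(2+X)^C)$, and $O(Y)$ means at most $CY$. *)

theory Defs
  imports
    "HOL-Analysis.Elementary_Metric_Spaces"
    "HOL-Number_Theory.Residues"
begin

section \<open>The circle group \<open>\<real>/\<int>\<close>\<close>

quotient_type circle = real / "\<lambda>x y::real. x - y \<in> \<int>"
proof (rule equivpI)
  show "reflp (\<lambda>x y::real. x - y \<in> \<int>)"
    by (simp add: reflp_def)
  show "symp (\<lambda>x y::real. x - y \<in> \<int>)"
    by (metis (mono_tags, lifting) Ints_minus minus_diff_eq sympI)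
  show "transp (\<lambda>x y::real. x - y \<in> \<int>)"
  proof (rule transpI)
    fix x y z :: real
    assume "x - y \<in> \<int>" "y - z \<in> \<int>"
    then have "(x - y) + (y - z) \<in> \<int>" by (rule Ints_add)
    then show "x - z \<in> \<int>" by simp
  qed
qed

lift_definition mod1 :: "real \<Rightarrow> circle" is "\<lambda>x. x" .

instantiation circle :: ab_group_add
begin

lift_definition zero_circle :: circle is "0 :: real" .

lift_definition plus_circle :: "circle \<Rightarrow> circle \<Rightarrow> circle" is "(+) :: real \<Rightarrow> real \<Rightarrow> real"
proof -
  fix x x' y y' :: real
  assume "x - x' \<in> \<int>" "y - y' \<in> \<int>"
  then have "(x - x') + (y - y') \<in> \<int>" by (rule Ints_add)
  then show "(x + y) - (x' + y') \<in> \<int>" by (simp add: algebra_simps)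
qed

lift_definition uminus_circle :: "circle \<Rightarrow> circle" is "uminus :: real \<Rightarrow> real"
proof -
  fix x x' :: real
  assume "x - x' \<in> \<int>"
  then have "- (x - x') \<in> \<int>" by (rule Ints_minus)
  then show "- x - - x' \<in> \<int>" by simp
qed

lift_definition minus_circle :: "circle \<Rightarrow> circle \<Rightarrow> circle" is "(-) :: real \<Rightarrow> real \<Rightarrow> real"
proof -
  fix x x' y y' :: real
  assume "x - x' \<in> \<int>" "y - y' \<in> \<int>"
  then have "(x - x') - (y - y') \<in> \<int>" by (rule Ints_diff)
  then show "(x - y) - (x' - y') \<in> \<int>" by (simp add: algebra_simps)
qed

instance
  by standard (transfer, simp)+

end

lift_definition circle_norm :: "circle \<Rightarrow> real" is "\<lambda>x. infdist x (\<int> :: real set)"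
proof -
  have le: "infdist x \<int> \<le> infdist y \<int>" if "x - y \<in> \<int>" for x y :: real
  proof -
    have ne: "(\<int> :: real set) \<noteq> {}" using Ints_0 by blast
    have "infdist x \<int> \<le> dist y n" if "n \<in> \<int>" for n
    proof -
      have "n + (x - y) \<in> \<int>" using that \<open>x - y \<in> \<int>\<close> by (rule Ints_add)
      then have "infdist x \<int> \<le> dist x (n + (x - y))" by (rule infdist_le)
      also have "\<dots> = dist y n" by (simp add: dist_real_def)
      finally show ?thesis .
    qed
    then show ?thesis
      using ne by (simp add: infdist_notempty cINF_greatest)
  qed
  fix x y :: real
  assume xy: "x - y \<in> \<int>"
  then have "- (x - y) \<in> \<int>" by (rule Ints_minus)
  then have "y - x \<in> \<int>" by simp
  with xy show "infdist x \<int> = infdist y \<int>"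
    by (intro antisym le)
qed

text \<open>The representative of \<open>x\<close> modulo \<open>1\<close> in \<open>(-1/2, 1/2]\<close>; in contrast to \<^const>\<open>frac\<close>,
  which takes values in \<open>[0, 1)\<close>.\<close>

definition cfrac :: "real \<Rightarrow> real" where
  "cfrac x = (THE t. - 1 / 2 < t \<and> t \<le> 1 / 2 \<and> x - t \<in> \<int>)"

lemma cfrac_unique:
  assumes "- 1 / 2 < t" "t \<le> 1 / 2" "x - t \<in> \<int>"
  shows "cfrac x = t"
  unfolding cfrac_def
proof (rule the_equality)
  show "- 1 / 2 < t \<and> t \<le> 1 / 2 \<and> x - t \<in> \<int>" using assms by simp
next
  fix s assume s: "- 1 / 2 < s \<and> s \<le> 1 / 2 \<and> x - s \<in> \<int>"
  then have "(x - s) - (x - t) \<in> \<int>" using assms(3) Ints_diff by blast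
  then have "t - s \<in> \<int>" by simp
  moreover have "\<bar>t - s\<bar> < 1" using s assms by linarith
  ultimately show "s = t" using Ints_nonzero_abs_less1 by fastforce
qed

lemma cfrac_eq: "cfrac x = x - of_int \<lceil>x - 1 / 2\<rceil>"
  by (rule cfrac_unique) (simp_all, linarith+)


section \<open>Bohr sets and multilinear structure in a finite abelian group\<close>

text \<open>An abelian group is given by the additive part of a ring record \<open>G\<close>. Characters are taken
  extensional, so that distinct functions are distinct characters and cardinalities of sets of
  characters have their usual meaning.\<close>

definition dual :: "('a, 'm) ring_scheme \<Rightarrow> ('a \<Rightarrow> circle) set" where
  "dual G = {\<chi> \<in> extensional (carrier G).
     \<forall>x\<in>carrier G. \<forall>y\<in>carrier G. \<chi> (x \<oplus>\<^bsub>G\<^esub> y) = \<chi> x + \<chi> y}"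

definition bohr :: "('a, 'm) ring_scheme \<Rightarrow> ('a \<Rightarrow> circle) set \<Rightarrow> real \<Rightarrow> 'a set" where
  "bohr G \<Gamma> \<rho> = {x \<in> carrier G. \<forall>\<chi>\<in>\<Gamma>. circle_norm (\<chi> x) \<le> \<rho>}"

text \<open>Codimension and radius belong to a presentation of the set and not to the set itself, hence
  they appear as parameters of the following predicates; \<open>D\<close> is an upper bound for the
  codimension, \<open>\<sigma>\<close> is the exact radius.\<close>

definition is_bohr_set :: "('a, 'm) ring_scheme \<Rightarrow> real \<Rightarrow> real \<Rightarrow> 'a set \<Rightarrow> bool" where
  "is_bohr_set G D \<sigma> S \<longleftrightarrow> 0 < \<sigma> \<and> \<sigma> < 1 \<and>
     (\<exists>\<Gamma>. \<Gamma> \<subseteq> dual G \<and> finite \<Gamma> \<and> real (card \<Gamma>) \<le> D \<and> S = bohr G \<Gamma> \<sigma>)"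

text \<open>Equality and addition in the dual group are pointwise on the carrier.\<close>

definition freiman_linear ::
    "('a, 'm) ring_scheme \<Rightarrow> 'a set \<Rightarrow> ('a \<Rightarrow> 'a \<Rightarrow> circle) \<Rightarrow> bool" where
  "freiman_linear G S L \<longleftrightarrow>
     S \<subseteq> carrier G \<and> \<zero>\<^bsub>G\<^esub> \<in> S \<and> (\<forall>a\<in>S. L a \<in> dual G) \<and>
     (\<forall>x\<in>carrier G. L \<zero>\<^bsub>G\<^esub> x = 0) \<and>
     (\<forall>a\<in>S. \<forall>b\<in>S. \<forall>c\<in>S. \<forall>d\<in>S. a \<oplus>\<^bsub>G\<^esub> b = c \<oplus>\<^bsub>G\<^esub> d \<longrightarrow>
        (\<forall>x\<in>carrier G. L a x + L b x = L c x + L d x))"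

definition is_bilinear_bohr_variety ::
    "('a, 'm) ring_scheme \<Rightarrow> real \<Rightarrow> real \<Rightarrow> ('a \<times> 'a) set \<Rightarrow> bool" where
  "is_bilinear_bohr_variety G D \<sigma> W \<longleftrightarrow> 0 < \<sigma> \<and> \<sigma> < 1 \<and>
     (\<exists>\<Gamma>1 \<Gamma>2 (r :: nat) L.
        \<Gamma>1 \<subseteq> dual G \<and> finite \<Gamma>1 \<and> real (card \<Gamma>1) \<le> D \<and>
        \<Gamma>2 \<subseteq> dual G \<and> finite \<Gamma>2 \<and> real (card \<Gamma>2) \<le> D \<and> real r \<le> D \<and>
        ((\<forall>i<r. freiman_linear G (bohr G \<Gamma>2 \<sigma>) (L i)) \<and>
         W = {(x, y). x \<in> bohr G \<Gamma>1 \<sigma> \<and> y \<in> bohr G \<Gamma>2 \<sigma> \<and>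
                x \<in> bohr G ((\<lambda>i. L i y) ` {..<r}) \<sigma>}
         \<or>
         (\<forall>i<r. freiman_linear G (bohr G \<Gamma>1 \<sigma>) (L i)) \<and>
         W = {(x, y). x \<in> bohr G \<Gamma>1 \<sigma> \<and> y \<in> bohr G \<Gamma>2 \<sigma> \<and>
                y \<in> bohr G ((\<lambda>i. L i x) ` {..<r}) \<sigma>}))"

definition approx_linear ::
    "('a, 'm) ring_scheme \<Rightarrow> 'a set \<Rightarrow> real \<Rightarrow> ('a \<Rightarrow> circle) \<Rightarrow> bool" where
  "approx_linear G B \<epsilon> \<psi> \<longleftrightarrow>
     (\<forall>u\<in>B. \<forall>v\<in>B. u \<oplus>\<^bsub>G\<^esub> v \<in> B \<longrightarrow>
        circle_norm (\<psi> (u \<oplus>\<^bsub>G\<^esub> v) - \<psi> u - \<psi> v) \<le> \<epsilon>)"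

definition approx_trilinear ::
    "('a, 'm) ring_scheme \<Rightarrow> 'a set \<Rightarrow> real \<Rightarrow> ('a \<Rightarrow> 'a \<Rightarrow> 'a \<Rightarrow> circle) \<Rightarrow> bool" where
  "approx_trilinear G B \<epsilon> \<phi> \<longleftrightarrow>
     (\<forall>a\<in>B. \<forall>b\<in>B.
        approx_linear G B \<epsilon> (\<lambda>u. \<phi> u a b) \<and>
        approx_linear G B \<epsilon> (\<lambda>u. \<phi> a u b) \<and>
        approx_linear G B \<epsilon> (\<lambda>u. \<phi> a b u))"


section \<open>Generalized polynomials\<close>

inductive_set gen_monomials :: "(int \<Rightarrow> int \<Rightarrow> int \<Rightarrow> circle) set" where
  "(\<lambda>x y z. mod1 (cfrac (cfrac (\<alpha> * real_of_int x) * \<beta> * real_of_int y) * \<gamma> * real_of_int z))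
     \<in> gen_monomials"
| "(\<lambda>x y z. mod1 (cfrac (\<alpha> * real_of_int x * real_of_int y) * \<gamma> * real_of_int z))
     \<in> gen_monomials"
| "(\<lambda>x y z. mod1 (cfrac (\<alpha> * real_of_int x) * \<beta> * real_of_int y * real_of_int z))
     \<in> gen_monomials"
| "(\<lambda>x y z. mod1 (\<alpha> * real_of_int x * real_of_int y * real_of_int z))
     \<in> gen_monomials"
| "(\<lambda>x y z. mod1 (cfrac (\<alpha> * real_of_int x) * cfrac (\<beta> * real_of_int y) * \<gamma> * real_of_int z))
     \<in> gen_monomials"
| "(\<lambda>x y z. mod1 (cfrac (\<beta> * real_of_int y) * \<alpha> * real_of_int x * real_of_int z))
     \<in> gen_monomials"

text \<open>On \<open>[0, N - 1]\<^sup>3\<close>, the function \<open>g\<close> is a sum of at most \<open>K\<close> generalized monomials.\<close>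

definition is_gen_polynomial ::
    "nat \<Rightarrow> real \<Rightarrow> (int \<Rightarrow> int \<Rightarrow> int \<Rightarrow> circle) \<Rightarrow> bool" where
  "is_gen_polynomial N K g \<longleftrightarrow>
     (\<exists>ts. set ts \<subseteq> gen_monomials \<and> real (length ts) \<le> K \<and>
        (\<forall>x\<in>{0..int N - 1}. \<forall>y\<in>{0..int N - 1}. \<forall>z\<in>{0..int N - 1}.
           g x y z = (\<Sum>t\<leftarrow>ts. t x y z)))"

text \<open>The carrier of \<open>residue_ring (int N)\<close> is \<open>{0..int N - 1}\<close> itself, so the map sending a residue
  to its representative is the inclusion of the carrier into \<^typ>\<open>int\<close>.\<close>

definition residue_rep :: "int \<Rightarrow> int" (\<open>\<iota>\<close>) where
  "\<iota> x = x"

end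

(* Embed the Bohr set, with the identity added to its frequencies xi_j, in a lattice: x goes to the
   vector of the v_j(x) = {xi_j x / N}. A reduced basis b_i of this lattice has coordinates c_i that
   are integer combinations of the v_j and satisfy |c_i(x)| |b_i| <= K |x| with K = exp(O(d^2)). On
   each box spanned by three of the b_i, Hyers-Ulam stability makes phi a true monomial up to
   O(eps); the stability error of the innermost variable is divided by the length of its range, so
   nothing is lost over the three variables. Hence phi is close to a real trilinear form in the v_j.
   Write it as sum_l t_l(x,y) v_l(z). As t - {t} is an integer, t v_l(z) and (t - {t}) xi_l z / N
   agree modulo 1 up to |v_l(z)|. The same rounding, applied to the coefficients gamma of t, turns
   gamma v_j(x) v_k(y) modulo 1 into a sum of four bracket expressions, each small on a bilinear
   Bohr variety, so that there {t} is the sum of all these expressions. *)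

theory Submission
  imports Defs "HOL-Library.Function_Algebras"
begin


section \<open>Distance to the nearest integer\<close>

text \<open>The identity is adjoined so that the lattice vector of x determines x modulo N. The
  bound on the c_i keeps the boxes and all partial sums of the c_i(x) b_i inside B once the radius
  is cut by K D^2, with D = d + 1; approximate additivity says nothing about sums that leave B.
  Fractional parts add up only if no carry occurs, and this is what smallness on the variety is for.
  Its bilinear conditions bound characters at y whose frequency is an integer part depending on x.
  Such an integer part has the form h {f x / N} - {h f x / N}, a difference of two functions that
  are additive on a small Bohr set, so it is Freiman-linear there. If d = 0 or \<rho> \<ge> 1/2, no
  power of 2 + X controls these parameters: X may stay near 0 while d or 1 / (\<rho>\<epsilon>) is
  large. There B is the whole group, and a single monomial \<alpha>xyz suffices.\<close>

abbreviation znorm :: "real \<Rightarrow> real" where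
  "znorm x \<equiv> circle_norm (mod1 x)"

lemma znorm_infdist: "znorm x = infdist x \<int>"
  by transfer simp

lemma mod1_surj: "\<exists>x. mod1 x = c"
  by transfer (metis Ints_0 diff_self)

lemma mod1_add: "mod1 (x + y) = mod1 x + mod1 y"
  by transfer simp

lemma mod1_diff: "mod1 (x - y) = mod1 x - mod1 y"
  by transfer simp

lemma mod1_minus: "mod1 (- x) = - mod1 x"
  by transfer simp

lemma mod1_0 [simp]: "mod1 0 = 0"
  by transfer simp

lemma mod1_sum: "mod1 (\<Sum>i\<in>A. f i) = (\<Sum>i\<in>A. mod1 (f i))"
  by (induction A rule: infinite_finite_induct) (auto simp: mod1_add)

lemma mod1_eq_iff: "mod1 x = mod1 y \<longleftrightarrow> x - y \<in> \<int>"
  by transfer simp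

lemma cfrac_diff_Ints: "x - cfrac x \<in> \<int>"
  by (simp add: cfrac_eq)

lemma cfrac_bounds: "- 1 / 2 < cfrac x" "cfrac x \<le> 1 / 2"
  unfolding cfrac_eq by linarith+

lemma mod1_cfrac [simp]: "mod1 (cfrac x) = mod1 x"
  using cfrac_diff_Ints[of x] by (metis mod1_eq_iff)

lemma znorm_le_dist_Ints:
  assumes "x - y \<in> \<int>"
  shows "znorm x \<le> \<bar>y\<bar>"
proof -
  have "infdist x \<int> \<le> dist x (x - y)" by (rule infdist_le[OF assms])
  then show ?thesis by (simp add: znorm_infdist dist_real_def)
qed

lemma znorm_le_abs: "znorm x \<le> \<bar>x\<bar>"
  by (rule znorm_le_dist_Ints) simp

lemma znorm_eq_abs_cfrac: "znorm x = \<bar>cfrac x\<bar>"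
proof (rule antisym)
  show "znorm x \<le> \<bar>cfrac x\<bar>" by (rule znorm_le_dist_Ints[OF cfrac_diff_Ints])
  have "\<bar>cfrac x\<bar> \<le> dist x n" if n: "n \<in> \<int>" for n
  proof (rule ccontr)
    assume "\<not> ?thesis"
    then have a: "\<bar>x - n\<bar> < \<bar>cfrac x\<bar>" by (simp add: dist_real_def)
    have "- 1 / 2 < x - n" "x - n \<le> 1 / 2" using a cfrac_bounds[of x] by linarith+
    then have "cfrac x = x - n" using n by (intro cfrac_unique) auto
    then show False using a by simp
  qed
  then show "\<bar>cfrac x\<bar> \<le> znorm x"
    using Ints_0 by (auto simp: znorm_infdist infdist_def intro!: cINF_greatest)
qed

lemma circle_norm_le_half: "circle_norm c \<le> 1 / 2"
proof -
  obtain x where "mod1 x = c" using mod1_surj by blast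
  then show ?thesis using znorm_eq_abs_cfrac[of x] cfrac_bounds[of x] by auto
qed

lemma circle_norm_nonneg: "0 \<le> circle_norm c"
  by transfer (rule infdist_nonneg)

lemma circle_norm_0 [simp]: "circle_norm 0 = 0"
  using znorm_le_abs[of 0] circle_norm_nonneg[of 0] by simp

lemma circle_norm_add: "circle_norm (a + b) \<le> circle_norm a + circle_norm b"
proof -
  obtain x where x: "mod1 x = a" using mod1_surj by blast
  obtain y where y: "mod1 y = b" using mod1_surj by blast
  have "znorm (cfrac x + cfrac y) \<le> \<bar>cfrac x\<bar> + \<bar>cfrac y\<bar>"
    using znorm_le_abs[of "cfrac x + cfrac y"] by linarith
  then show ?thesis by (simp add: mod1_add flip: x y znorm_eq_abs_cfrac)
qed

lemma circle_norm_minus [simp]: "circle_norm (- a) = circle_norm a"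
proof -
  have le: "circle_norm (- a) \<le> circle_norm a" for a
  proof -
    obtain x where x: "mod1 x = a" using mod1_surj by blast
    have "znorm (- cfrac x) \<le> \<bar>cfrac x\<bar>"
      using znorm_le_abs[of "- cfrac x"] by simp
    then show ?thesis by (simp add: mod1_minus flip: x znorm_eq_abs_cfrac)
  qed
  show ?thesis using le[of a] le[of "- a"] by simp
qed

lemma circle_norm_diff: "circle_norm (a - b) \<le> circle_norm a + circle_norm b"
  using circle_norm_add[of a "- b"] by simp

lemma circle_norm_triangle: "circle_norm (a - c) \<le> circle_norm (a - b) + circle_norm (b - c)"
  using circle_norm_add[of "a - b" "b - c"] by simp

lemma circle_norm_sum: "circle_norm (\<Sum>i\<in>A. f i) \<le> (\<Sum>i\<in>A. circle_norm (f i))"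
proof (induction A rule: infinite_finite_induct)
  case (insert x F)
  then show ?case using circle_norm_add[of "f x" "\<Sum>i\<in>F. f i"] by simp
qed auto

lemma znorm_add: "znorm (x + y) \<le> znorm x + znorm y"
  unfolding mod1_add by (rule circle_norm_add)

lemma znorm_mult_int: "znorm (of_int n * x) \<le> \<bar>of_int n\<bar> * znorm x"
proof -
  have "of_int n * (x - cfrac x) \<in> \<int>" using cfrac_diff_Ints[of x] by (intro Ints_mult) auto
  then have "of_int n * x - of_int n * cfrac x \<in> \<int>" by (simp add: algebra_simps)
  from znorm_le_dist_Ints[OF this] show ?thesis by (simp add: abs_mult znorm_eq_abs_cfrac)
qed

text \<open>The crude bound \<open>1 - e\<close> leaves 0 as the only integer that can be near
  \<open>x\<close>. Estimates modulo 1 are carried over to real lifts in this way: a weak real bound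
  is improved to the one that holds modulo 1.\<close>

lemma abs_le_of_znorm_le:
  assumes "znorm x \<le> e" "\<bar>x\<bar> < 1 - e"
  shows "\<bar>x\<bar> \<le> e"
proof -
  obtain k where k: "x - cfrac x = of_int k" using cfrac_diff_Ints[of x] by (auto elim: Ints_cases)
  have "\<bar>cfrac x\<bar> \<le> e" using assms by (simp add: znorm_eq_abs_cfrac)
  then have "\<bar>real_of_int k\<bar> < 1" using k assms(2) by linarith
  then have "k = 0" by linarith
  then show ?thesis using k \<open>\<bar>cfrac x\<bar> \<le> e\<close> by simp
qed

section \<open>Approximately multilinear functions on integer boxes\<close>

text \<open>Subtract the line through the origin and the last value, so that \<open>h M = 0\<close>,
  and let |h| have its maximum S at k. If 2k \<le> M, doubling k gives 2S \<le> S + e. If M/2 < k <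
  M, then h (M - k) is - h k up to e, and doubling M - k gives 2(S - e) \<le> S + e, whence the
  3.\<close>

lemma real_almost_additive:
  fixes g :: "nat \<Rightarrow> real"
  assumes M: "1 \<le> M"
    and g: "\<And>m n. 1 \<le> m \<Longrightarrow> 1 \<le> n \<Longrightarrow> m + n \<le> M \<Longrightarrow> \<bar>g (m + n) - g m - g n\<bar> \<le> e"
    and e: "0 \<le> e" and n: "1 \<le> n" "n \<le> M"
  shows "\<bar>g n - real n * (g M / real M)\<bar> \<le> 3 * e"
proof -
  define h where "h n = g n - real n * (g M / real M)" for n
  have hM: "h M = 0" using M by (simp add: h_def)
  have h: "\<bar>h (m + n) - h m - h n\<bar> \<le> e" if "1 \<le> m" "1 \<le> n" "m + n \<le> M" for m n
  proof -
    have "h (m + n) - h m - h n = g (m + n) - g m - g n" unfolding h_def by (simp add: algebra_simps add_divide_distrib)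
    then show ?thesis using g[OF that] by simp
  qed
  define S where "S = Max ((\<lambda>n. \<bar>h n\<bar>) ` {1..M})"
  have le: "\<bar>h n\<bar> \<le> S" if "1 \<le> n" "n \<le> M" for n
    unfolding S_def using that by (intro Max_ge) auto
  have "S \<in> (\<lambda>n. \<bar>h n\<bar>) ` {1..M}" unfolding S_def using M by (intro Max_in) auto
  then obtain k where k: "1 \<le> k" "k \<le> M" "\<bar>h k\<bar> = S" by auto
  consider "2 * k \<le> M" | "2 * k > M" "k < M" | "k = M" using k by linarith
  then have "S \<le> 3 * e"
  proof cases
    case 1
    have "\<bar>h (k + k) - h k - h k\<bar> \<le> e" using h[of k k] 1 k by simp
    moreover have "\<bar>h (k + k)\<bar> \<le> S" using le[of "k + k"] 1 k by simp
    ultimately show ?thesis using k e by linarith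
  next
    case 2
    have a: "\<bar>h ((M - k) + k) - h (M - k) - h k\<bar> \<le> e" using h[of "M - k" k] 2 k by simp
    have b: "\<bar>h ((M - k) + (M - k)) - h (M - k) - h (M - k)\<bar> \<le> e"
      using h[of "M - k" "M - k"] 2 k by simp
    have c: "\<bar>h ((M - k) + (M - k))\<bar> \<le> S" using le[of "(M - k) + (M - k)"] 2 k by simp
    have "(M - k) + k = M" using k by simp
    then show ?thesis using a b c hM k e by (simp add: abs_if split: if_splits)
  next
    case 3
    then show ?thesis using hM k e by simp
  qed
  then show ?thesis using le[OF n] by (simp add: h_def)
qed

text \<open>Hyers-Ulam stability with values in the circle. The fractional parts \<open>c\<close> of
  the increments add up to a real lift \<open>g\<close> of \<open>f\<close>, for which the real
  statement gives 3e on positive n. Negative n cost two more defects, those of f 0 and of n + (-n) =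
  0, hence 5e. For e \<ge> 1/10 the claim is trivial, as 5e \<ge> 1/2.\<close>

lemma circle_almost_additive_interval:
  fixes f :: "int \<Rightarrow> real"
  assumes f: "\<And>u v. \<bar>u\<bar> \<le> M \<Longrightarrow> \<bar>v\<bar> \<le> M \<Longrightarrow> \<bar>u + v\<bar> \<le> M \<Longrightarrow> znorm (f (u + v) - f u - f v) \<le> e"
  shows "\<exists>\<theta>. \<forall>n. \<bar>n\<bar> \<le> M \<longrightarrow> znorm (f n - of_int n * \<theta>) \<le> 5 * e"
proof (cases "e < 1 / 10 \<and> 0 \<le> M")
  case False
  have "1 / 10 \<le> e" if "\<bar>n\<bar> \<le> M" for n :: int using False that by linarith
  then have "circle_norm t \<le> 5 * e" if "\<bar>n\<bar> \<le> M" for n :: int and t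
    using circle_norm_le_half[of t] that by fastforce
  then show ?thesis by blast
next
  case True
  then have e: "e < 1 / 10" and M0: "0 \<le> M" by auto
  have f0: "znorm (f 0) \<le> e"
    using f[of 0 0] M0 circle_norm_minus[of "mod1 (f 0)"] by (simp flip: mod1_minus)
  have e0: "0 \<le> e" using f0 circle_norm_nonneg[of "mod1 (f 0)"] by linarith
  show ?thesis
  proof (cases "M = 0")
    case True
    then show ?thesis using f0 e0 by (intro exI[of _ 0]) auto
  next
    case False
    define m where "m = nat M"
    have m: "1 \<le> m" "int m = M" using False M0 by (auto simp: m_def)
    define c where "c i = cfrac (f (int i + 1) - f (int i) - f 1)" for i
    define g where "g n = real n * f 1 + (\<Sum>i=1..<n. c i)" for n
    have gS: "g (n + 1) = g n + g 1 + c n" if "1 \<le> n" for n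
      using that by (simp add: g_def algebra_simps)
    have cb: "\<bar>c n\<bar> \<le> e" if "1 \<le> n" "n + 1 \<le> m" for n
      using f[of "int n" 1] that m unfolding c_def by (simp flip: znorm_eq_abs_cfrac)
    have gf: "g n - f (int n) \<in> \<int>" if "1 \<le> n" for n
      using that
    proof (induction n rule: dec_induct)
      case base
      show ?case by (simp add: g_def)
    next
      case (step n)
      have "g (n + 1) - f (int n + 1) = (g n - f (int n))
          - ((f (int n + 1) - f (int n) - f 1) - c n)"
        using gS[of n] step by (simp add: g_def)
      also have "\<dots> \<in> \<int>" using step(3) cfrac_diff_Ints unfolding c_def by (rule Ints_diff)
      finally show ?case by (simp add: add.commute)
    qed
    have key: "\<bar>g (a + b) - g a - g b\<bar> \<le> e" if "1 \<le> a" "1 \<le> b" "a + b \<le> m" for a b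
      using that(2,3)
    proof (induction b rule: dec_induct)
      case base
      then show ?case using gS[of a] cb[of a] that(1) by simp
    next
      case (step b)
      have IH: "\<bar>g (a + b) - g a - g b\<bar> \<le> e" using step by simp
      let ?D = "g (a + (b + 1)) - g a - g (b + 1)"
      have "?D = (g (a + b) - g a - g b) + c (a + b) - c b"
        using gS[of "a + b"] gS[of b] step(1) that(1) by (simp add: add.assoc)
      moreover have "\<bar>c (a + b)\<bar> \<le> e" "\<bar>c b\<bar> \<le> e"
        using cb[of "a + b"] cb[of b] step that(1) by auto
      \<comment> \<open>The real defect is at most 3e by induction and at most e modulo 1, so it is
        at most e because 3e < 1 - e. Without this return to e the bound would grow with b.\<close>
      ultimately have D: "\<bar>?D\<bar> \<le> 3 * e" using IH by linarith
      have "?D - (f (int (a + (b + 1))) - f (int a) - f (int (b + 1))) =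
         (g (a + (b + 1)) - f (int (a + (b + 1)))) - (g a - f (int a)) - (g (b + 1) - f (int (b + 1)))"
        by simp
      also have "\<dots> \<in> \<int>" using that(1) by (intro Ints_diff gf) auto
      finally have "mod1 ?D = mod1 (f (int (a + (b + 1))) - f (int a) - f (int (b + 1)))"
        by (simp add: mod1_eq_iff)
      moreover have "znorm (f (int a + int (b + 1)) - f (int a) - f (int (b + 1))) \<le> e"
        using f[of "int a" "int (b + 1)"] step m by simp
      ultimately have "znorm ?D \<le> e" by (simp add: ac_simps)
      then have "\<bar>?D\<bar> \<le> e" by (rule abs_le_of_znorm_le) (use D e in linarith)
      then show ?case by simp
    qed
    define \<theta> where "\<theta> = g m / real m"
    have pos: "znorm (f (int n) - real n * \<theta>) \<le> 3 * e" if "1 \<le> n" "n \<le> m" for n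
    proof -
      have "\<bar>g n - real n * \<theta>\<bar> \<le> 3 * e"
        unfolding \<theta>_def by (rule real_almost_additive[of m]) (use key that e0 m in auto)
      moreover have "znorm (f (int n) - real n * \<theta>) \<le> \<bar>g n - real n * \<theta>\<bar>"
        by (rule znorm_le_dist_Ints) (use Ints_minus[OF gf[OF that(1)]] in simp)
      ultimately show ?thesis by linarith
    qed
    have "znorm (f n - of_int n * \<theta>) \<le> 5 * e" if n: "\<bar>n\<bar> \<le> M" for n
    proof -
      consider "n = 0" | "n > 0" | "n < 0" by linarith
      then show ?thesis
      proof cases
        case 1
        then show ?thesis using f0 e0 by simp
      next
        case 2
        then have "1 \<le> nat n" "nat n \<le> m" using n m by auto
        then show ?thesis using pos[of "nat n"] 2 e0 by simp
      next
        case 3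
        then have "1 \<le> nat (- n)" "nat (- n) \<le> m" using n m by auto
        then have a: "znorm (f (- n) + of_int n * \<theta>) \<le> 3 * e" using pos[of "nat (- n)"] 3 by simp
        have b: "znorm (f 0 - f n - f (- n)) \<le> e" using f[of n "- n"] n by simp
        have "mod1 (f n - of_int n * \<theta>) =
           mod1 (f 0) - (mod1 (f 0 - f n - f (- n)) + mod1 (f (- n) + of_int n * \<theta>))"
          by (simp flip: mod1_add mod1_diff)
        then show ?thesis
          using circle_norm_diff[of "mod1 (f 0)" "mod1 (f 0 - f n - f (- n)) + mod1 (f (- n) + of_int n * \<theta>)"]
            circle_norm_add[of "mod1 (f 0 - f n - f (- n))" "mod1 (f (- n) + of_int n * \<theta>)"] a b f0
          by simp
      qed
    qed
    then show ?thesis by blast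
  qed
qed

text \<open>Multiples of \<open>cfrac t\<close> move in steps of size at most e, so when 2e < 1 - e
  they cannot jump from the e-neighbourhood of 0 to that of another integer. They stay near 0 as
  reals up to n = M, which gains the factor 1 / M.\<close>

lemma znorm_le_of_multiples:
  assumes "\<And>n. 0 \<le> n \<Longrightarrow> n \<le> int M \<Longrightarrow> znorm (of_int n * t) \<le> e" "1 \<le> M" "e < 1 / 3"
  shows "znorm t \<le> e / M"
proof -
  have t: "znorm (real n * cfrac t) \<le> e" if "n \<le> M" for n
  proof -
    have "of_int (int n) * (t - cfrac t) \<in> \<int>"
      using cfrac_diff_Ints[of t] by (intro Ints_mult) auto
    then have "mod1 (real n * t) = mod1 (real n * cfrac t)"
      by (simp add: mod1_eq_iff algebra_simps)
    then show ?thesis using assms(1)[of "int n"] that by simp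
  qed
  have c: "\<bar>cfrac t\<bar> \<le> e" using t[of 1] assms(2) by (simp add: znorm_eq_abs_cfrac)
  have "\<bar>real n * cfrac t\<bar> \<le> e" if "n \<le> M" for n
    using that
  proof (induction n)
    case 0
    then show ?case using c by simp
  next
    case (Suc n)
    have "\<bar>real (Suc n) * cfrac t\<bar> \<le> \<bar>real n * cfrac t\<bar> + \<bar>cfrac t\<bar>"
      by (simp add: algebra_simps)
    also have "\<dots> \<le> 2 * e" using Suc c by simp
    finally show ?case using assms(3) t[OF Suc.prems]
      by (intro abs_le_of_znorm_le) auto
  qed
  from this[of M] have "real M * \<bar>cfrac t\<bar> \<le> e" by (simp add: abs_mult)
  then show ?thesis using assms(2) by (simp add: znorm_eq_abs_cfrac field_simps)
qed

text \<open>Slopes are chosen for the whole family so that additive relations between its members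
  pass to them. A relation valid up to e along the interval makes n (\<theta> k - \<theta> i -
  \<theta> j) small up to e + 3 * 5e = 16e, and smallness of all multiples divides this by M. The
  bound 1/48 ensures 16e < 1/3.\<close>

lemma circle_almost_additive_family:
  fixes f :: "'i \<Rightarrow> int \<Rightarrow> real"
  assumes f: "\<And>i u v. i \<in> I \<Longrightarrow> \<bar>u\<bar> \<le> int M \<Longrightarrow> \<bar>v\<bar> \<le> int M \<Longrightarrow> \<bar>u + v\<bar> \<le> int M \<Longrightarrow>
      znorm (f i (u + v) - f i u - f i v) \<le> e"
    and M: "1 \<le> M" and e: "e < 1 / 48"
  shows "\<exists>\<theta>. (\<forall>i\<in>I. \<forall>n. \<bar>n\<bar> \<le> int M \<longrightarrow> znorm (f i n - of_int n * \<theta> i) \<le> 5 * e) \<and>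
    (\<forall>i\<in>I. \<forall>j\<in>I. \<forall>k\<in>I. (\<forall>n. \<bar>n\<bar> \<le> int M \<longrightarrow> znorm (f k n - f i n - f j n) \<le> e) \<longrightarrow>
       znorm (\<theta> k - \<theta> i - \<theta> j) \<le> 16 * e / M)"
proof -
  have "\<forall>i\<in>I. \<exists>\<theta>. \<forall>n. \<bar>n\<bar> \<le> int M \<longrightarrow> znorm (f i n - of_int n * \<theta>) \<le> 5 * e"
    using circle_almost_additive_interval f by blast
  then obtain \<theta> where \<theta>: "\<And>i n. i \<in> I \<Longrightarrow> \<bar>n\<bar> \<le> int M \<Longrightarrow> znorm (f i n - of_int n * \<theta> i) \<le> 5 * e"
    by metis
  have "znorm (\<theta> k - \<theta> i - \<theta> j) \<le> 16 * e / M"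
    if ijk: "i \<in> I" "j \<in> I" "k \<in> I" and n: "\<forall>n. \<bar>n\<bar> \<le> int M \<longrightarrow> znorm (f k n - f i n - f j n) \<le> e"
    for i j k
  proof (rule znorm_le_of_multiples)
    fix n assume "0 \<le> n" "n \<le> int M"
    then have nM: "\<bar>n\<bar> \<le> int M" by simp
    let ?a = "\<lambda>i. f i n - of_int n * \<theta> i"
    have "mod1 (of_int n * (\<theta> k - \<theta> i - \<theta> j)) =
        mod1 (f k n - f i n - f j n) + mod1 (?a i) + mod1 (?a j) - mod1 (?a k)"
      unfolding mod1_add[symmetric] mod1_diff[symmetric] by (simp add: algebra_simps)
    then show "znorm (of_int n * (\<theta> k - \<theta> i - \<theta> j)) \<le> 16 * e"
      using n nM \<theta>[OF ijk(1) nM] \<theta>[OF ijk(2) nM] \<theta>[OF ijk(3) nM]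
        circle_norm_diff[of "mod1 (f k n - f i n - f j n) + mod1 (?a i) + mod1 (?a j)" "mod1 (?a k)"]
        circle_norm_add[of "mod1 (f k n - f i n - f j n) + mod1 (?a i)" "mod1 (?a j)"]
        circle_norm_add[of "mod1 (f k n - f i n - f j n)" "mod1 (?a i)"]
      by fastforce
  qed (use M e in auto)
  then show ?thesis using \<theta> by blast
qed

text \<open>The variables are made linear from the last to the first; the slopes are approximately
  bilinear, then approximately additive. The errors are 5e, then P * 5 * (16e / P) = 80e, then P M *
  5 * (256e / (P M)) = 1280e: each multiplication by a range undoes an earlier division. They add up
  to 1365e, which is trivial from e = 1/2730 on.\<close>

lemma circle_almost_trilinear_box:
  fixes F :: "int \<Rightarrow> int \<Rightarrow> int \<Rightarrow> real"
  assumes F1: "\<And>u v b c. \<bar>u\<bar> \<le> int L \<Longrightarrow> \<bar>v\<bar> \<le> int L \<Longrightarrow> \<bar>u + v\<bar> \<le> int L \<Longrightarrow> \<bar>b\<bar> \<le> int M \<Longrightarrow> \<bar>c\<bar> \<le> int P \<Longrightarrow>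
      znorm (F (u + v) b c - F u b c - F v b c) \<le> e"
    and F2: "\<And>a u v c. \<bar>u\<bar> \<le> int M \<Longrightarrow> \<bar>v\<bar> \<le> int M \<Longrightarrow> \<bar>u + v\<bar> \<le> int M \<Longrightarrow> \<bar>a\<bar> \<le> int L \<Longrightarrow> \<bar>c\<bar> \<le> int P \<Longrightarrow>
      znorm (F a (u + v) c - F a u c - F a v c) \<le> e"
    and F3: "\<And>a b u v. \<bar>u\<bar> \<le> int P \<Longrightarrow> \<bar>v\<bar> \<le> int P \<Longrightarrow> \<bar>u + v\<bar> \<le> int P \<Longrightarrow> \<bar>a\<bar> \<le> int L \<Longrightarrow> \<bar>b\<bar> \<le> int M \<Longrightarrow>
      znorm (F a b (u + v) - F a b u - F a b v) \<le> e"
  shows "\<exists>\<theta>. \<forall>a b c. \<bar>a\<bar> \<le> int L \<longrightarrow> \<bar>b\<bar> \<le> int M \<longrightarrow> \<bar>c\<bar> \<le> int P \<longrightarrow>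
    znorm (F a b c - of_int a * of_int b * of_int c * \<theta>) \<le> 1365 * e"
proof -
  have "znorm (F 0 0 0) \<le> e"
    using F1[of 0 0 0 0] circle_norm_minus[of "mod1 (F 0 0 0)"] by (simp flip: mod1_minus)
  then have e0: "0 \<le> e" using circle_norm_nonneg[of "mod1 (F 0 0 0)"] by linarith
  have zero: "znorm (F a b c) \<le> e" if "a = 0 \<or> b = 0 \<or> c = 0"
    "\<bar>a\<bar> \<le> int L" "\<bar>b\<bar> \<le> int M" "\<bar>c\<bar> \<le> int P" for a b c
  proof -
    have "znorm (F a b c - F a b c - F a b c) \<le> e"
      using that F1[of 0 0 b c] F2[of 0 0 a c] F3[of 0 0 a b] by auto
    then show ?thesis using circle_norm_minus[of "mod1 (F a b c)"] by (simp flip: mod1_minus)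
  qed
  consider "e \<ge> 1 / 2730" | "L = 0 \<or> M = 0 \<or> P = 0" | "e < 1 / 2730" "1 \<le> L" "1 \<le> M" "1 \<le> P"
    by linarith
  then show ?thesis
  proof cases
    case 1
    have "circle_norm t \<le> 1365 * e" for t using circle_norm_le_half[of t] 1 by linarith
    then show ?thesis by blast
  next
    case 2
    \<comment> \<open>If one range is {0}, there is nothing to divide by; but then some coordinate
      is 0, \<open>F\<close> is within e of 0 on the whole box, and slope 0 will do.\<close>
    have "znorm (F a b c - of_int a * of_int b * of_int c * 0) \<le> 1365 * e"
      if "\<bar>a\<bar> \<le> int L" "\<bar>b\<bar> \<le> int M" "\<bar>c\<bar> \<le> int P" for a b c
    proof -
      have "a = 0 \<or> b = 0 \<or> c = 0" using that 2 by auto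
      then show ?thesis using zero[OF _ that] e0 by fastforce
    qed
    then show ?thesis by blast
  next
    case 3
    define A where "A = {a. \<bar>a\<bar> \<le> int L}"
    define B where "B = {b. \<bar>b\<bar> \<le> int M}"
    have "\<exists>\<theta>. (\<forall>i\<in>A \<times> B. \<forall>n. \<bar>n\<bar> \<le> int P \<longrightarrow> znorm (F (fst i) (snd i) n - of_int n * \<theta> i) \<le> 5 * e) \<and>
    (\<forall>i\<in>A \<times> B. \<forall>j\<in>A \<times> B. \<forall>k\<in>A \<times> B.
       (\<forall>n. \<bar>n\<bar> \<le> int P \<longrightarrow> znorm (F (fst k) (snd k) n - F (fst i) (snd i) n - F (fst j) (snd j) n) \<le> e) \<longrightarrow>
       znorm (\<theta> k - \<theta> i - \<theta> j) \<le> 16 * e / P)"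
      by (rule circle_almost_additive_family) (use 3 F3 in \<open>auto simp: A_def B_def\<close>)
    then obtain \<theta> where
      \<theta>1: "\<And>a b c. a \<in> A \<Longrightarrow> b \<in> B \<Longrightarrow> \<bar>c\<bar> \<le> int P \<Longrightarrow> znorm (F a b c - of_int c * \<theta> (a, b)) \<le> 5 * e"
      and \<theta>2: "\<And>a b a' b' a'' b''. a \<in> A \<Longrightarrow> b \<in> B \<Longrightarrow> a' \<in> A \<Longrightarrow> b' \<in> B \<Longrightarrow> a'' \<in> A \<Longrightarrow> b'' \<in> B \<Longrightarrow>
         (\<And>n. \<bar>n\<bar> \<le> int P \<Longrightarrow> znorm (F a'' b'' n - F a b n - F a' b' n) \<le> e) \<Longrightarrow>
         znorm (\<theta> (a'', b'') - \<theta> (a, b) - \<theta> (a', b')) \<le> 16 * e / P"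
      unfolding Ball_def mem_Times_iff by (metis fst_conv snd_conv)
    define e' where "e' = 16 * e / P"
    have e': "e' \<le> 16 * e" using 3 e0 by (simp add: e'_def field_simps mult_left_mono)
    have e'0: "0 \<le> e'" using e0 by (simp add: e'_def)
    have "\<exists>\<eta>. (\<forall>i\<in>A. \<forall>n. \<bar>n\<bar> \<le> int M \<longrightarrow> znorm (\<theta> (i, n) - of_int n * \<eta> i) \<le> 5 * e') \<and>
    (\<forall>i\<in>A. \<forall>j\<in>A. \<forall>k\<in>A.
       (\<forall>n. \<bar>n\<bar> \<le> int M \<longrightarrow> znorm (\<theta> (k, n) - \<theta> (i, n) - \<theta> (j, n)) \<le> e') \<longrightarrow>
       znorm (\<eta> k - \<eta> i - \<eta> j) \<le> 16 * e' / M)"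
      by (rule circle_almost_additive_family)
        (use 3 e' \<theta>2 F2 in \<open>auto simp: A_def B_def e'_def\<close>)
    then obtain \<eta> where
      \<eta>1: "\<And>a b. a \<in> A \<Longrightarrow> \<bar>b\<bar> \<le> int M \<Longrightarrow> znorm (\<theta> (a, b) - of_int b * \<eta> a) \<le> 5 * e'"
      and \<eta>2: "\<And>i j k. i \<in> A \<Longrightarrow> j \<in> A \<Longrightarrow> k \<in> A \<Longrightarrow>
         (\<And>n. \<bar>n\<bar> \<le> int M \<Longrightarrow> znorm (\<theta> (k, n) - \<theta> (i, n) - \<theta> (j, n)) \<le> e') \<Longrightarrow>
         znorm (\<eta> k - \<eta> i - \<eta> j) \<le> 16 * e' / M"
      by blast
    define e'' where "e'' = 16 * e' / M"
    have "\<exists>\<kappa>. \<forall>n. \<bar>n\<bar> \<le> int L \<longrightarrow> znorm (\<eta> n - of_int n * \<kappa>) \<le> 5 * e''"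
    proof (rule circle_almost_additive_interval)
      fix u v :: int
      assume uv: "\<bar>u\<bar> \<le> int L" "\<bar>v\<bar> \<le> int L" "\<bar>u + v\<bar> \<le> int L"
      show "znorm (\<eta> (u + v) - \<eta> u - \<eta> v) \<le> e''"
        unfolding e''_def
      proof (rule \<eta>2)
        fix n :: int assume n: "\<bar>n\<bar> \<le> int M"
        show "znorm (\<theta> (u + v, n) - \<theta> (u, n) - \<theta> (v, n)) \<le> e'"
          unfolding e'_def using uv n by (intro \<theta>2 F1) (auto simp: A_def B_def)
      qed (use uv in \<open>auto simp: A_def\<close>)
    qed
    then obtain \<kappa> where \<kappa>: "\<And>n. \<bar>n\<bar> \<le> int L \<Longrightarrow> znorm (\<eta> n - of_int n * \<kappa>) \<le> 5 * e''" by blast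
    have "znorm (F a b c - of_int a * of_int b * of_int c * \<kappa>) \<le> 1365 * e"
      if a: "\<bar>a\<bar> \<le> int L" and b: "\<bar>b\<bar> \<le> int M" and c: "\<bar>c\<bar> \<le> int P" for a b c
    proof -
      have 1: "znorm (F a b c - of_int c * \<theta> (a, b)) \<le> 5 * e"
        using \<theta>1 a b c by (auto simp: A_def B_def)
      have "znorm (of_int c * (\<theta> (a, b) - of_int b * \<eta> a)) \<le> \<bar>of_int c\<bar> * znorm (\<theta> (a, b) - of_int b * \<eta> a)"
        by (rule znorm_mult_int)
      also have "\<dots> \<le> real P * (5 * e')"
        using c a b e'0 \<eta>1[of a b] by (intro mult_mono) (auto simp: A_def circle_norm_nonneg)
      also have "\<dots> = 80 * e" using 3 by (simp add: e'_def)
      finally have 2: "znorm (of_int c * (\<theta> (a, b) - of_int b * \<eta> a)) \<le> 80 * e" .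
      have "znorm (of_int (c * b) * (\<eta> a - of_int a * \<kappa>)) \<le> \<bar>of_int (c * b)\<bar> * znorm (\<eta> a - of_int a * \<kappa>)"
        by (rule znorm_mult_int)
      also have "\<dots> \<le> (real P * real M) * (5 * e'')"
      proof (rule mult_mono)
        show "\<bar>real_of_int (c * b)\<bar> \<le> real P * real M"
          unfolding of_int_mult abs_mult using b c by (intro mult_mono) auto
      qed (use a \<kappa> circle_norm_nonneg in auto)
      also have "\<dots> = 1280 * e" using 3 by (simp add: e'_def e''_def)
      finally have 3: "znorm (of_int (c * b) * (\<eta> a - of_int a * \<kappa>)) \<le> 1280 * e" .
      have "F a b c - of_int a * of_int b * of_int c * \<kappa> = (F a b c - of_int c * \<theta> (a, b)) +
         (of_int c * (\<theta> (a, b) - of_int b * \<eta> a) + of_int (c * b) * (\<eta> a - of_int a * \<kappa>))"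
        by (simp add: algebra_simps)
      show ?thesis unfolding \<open>F a b c - of_int a * of_int b * of_int c * \<kappa> = _\<close>
        using 1 2 3 znorm_add[of "F a b c - of_int c * \<theta> (a, b)" "of_int c * (\<theta> (a, b) - of_int b * \<eta> a) + of_int (c * b) * (\<eta> a - of_int a * \<kappa>)"]
          znorm_add[of "of_int c * (\<theta> (a, b) - of_int b * \<eta> a)" "of_int (c * b) * (\<eta> a - of_int a * \<kappa>)"]
        by linarith
    qed
    then show ?thesis by blast
  qed
qed


section \<open>Well-conditioned bases of lattices\<close>

text \<open>A lattice is modelled as a ring modulo the null space of \<open>p\<close>, the ring
  supplying the integer scalars as \<open>of_int n\<close>. Null vectors are permitted so that the
  quotient by a basis vector is again a seminorm on the same type.\<close>

locale int_seminorm =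
  fixes p :: "'a::comm_ring_1 \<Rightarrow> real"
  assumes triangle: "p (x + y) \<le> p x + p y"
    and scale: "p (of_int n * x) = \<bar>of_int n\<bar> * p x"
begin

lemma zero [simp]: "p 0 = 0"
  using scale[of 0 0] by simp

lemma minus [simp]: "p (- x) = p x"
  using scale[of "-1" x] by simp

lemma nonneg: "0 \<le> p x"
  using triangle[of x "- x"] by simp

lemma diff: "p (x - y) \<le> p x + p y"
  using triangle[of x "- y"] by simp

lemma sum: "p (\<Sum>i\<in>A. f i) \<le> (\<Sum>i\<in>A. p (f i))"
proof (induction A rule: infinite_finite_induct)
  case (insert x F)
  then show ?case using triangle[of "f x" "\<Sum>i\<in>F. f i"] by simp
qed auto

lemma add_null: "p y = 0 \<Longrightarrow> p (x + y) = p x"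
  using triangle[of x y] diff[of "x + y" y] by simp

text \<open>\<open>quot b\<close> is the quotient seminorm modulo the rational multiples \<open>(m / n) b\<close>.\<close>

definition quot_vals :: "'a \<Rightarrow> 'a \<Rightarrow> real set" where
  "quot_vals b x = {p (of_int n * x - of_int m * b) / of_int n |n m. 1 \<le> n}"

definition quot :: "'a \<Rightarrow> 'a \<Rightarrow> real" where
  "quot b x = Inf (quot_vals b x)"

lemma quot_vals_nonneg: "t \<in> quot_vals b x \<Longrightarrow> 0 \<le> t"
  by (auto simp: quot_vals_def nonneg)

lemma quot_le: "1 \<le> n \<Longrightarrow> quot b x \<le> p (of_int n * x - of_int m * b) / of_int n"
  unfolding quot_def
proof (rule cInf_lower)
  assume "1 \<le> n"
  then show "p (of_int n * x - of_int m * b) / of_int n \<in> quot_vals b x"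
    unfolding quot_vals_def by blast
  show "bdd_below (quot_vals b x)" using quot_vals_nonneg by (auto simp: bdd_below_def)
qed

lemma le_quot:
  assumes "\<And>n m. 1 \<le> n \<Longrightarrow> t \<le> p (of_int n * x - of_int m * b) / of_int n"
  shows "t \<le> quot b x"
  unfolding quot_def
proof (rule cInf_greatest)
  have "p (of_int 1 * x - of_int 0 * b) / of_int 1 \<in> quot_vals b x"
    unfolding quot_vals_def by blast
  then show "quot_vals b x \<noteq> {}" by blast
qed (use assms in \<open>auto simp: quot_vals_def\<close>)

lemma quot_le_self: "quot b x \<le> p x"
  using quot_le[of 1 b x 0] by simp

text \<open>Multiples m / n for x and m' / n' for y combine to (n' m + n m') / (n n') for x + y. For
  homogeneity the denominator becomes n |k|, and the sign of k moves into m because denominators are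
  positive.\<close>

lemma quot_seminorm: "int_seminorm (quot b)"
proof
  fix x y
  have 1: "quot b (x + y) \<le> p (of_int n * x - of_int m * b) / of_int n
      + p (of_int n' * y - of_int m' * b) / of_int n'" if n: "1 \<le> n" "1 \<le> n'" for n n' m m'
  proof -
    have "1 \<le> n * n'" using n mult_mono[of 1 n 1 n'] by simp
    then have "quot b (x + y) \<le> p (of_int (n * n') * (x + y) - of_int (n' * m + n * m') * b) / of_int (n * n')"
      by (rule quot_le)
    also have "of_int (n * n') * (x + y) - of_int (n' * m + n * m') * b =
        of_int n' * (of_int n * x - of_int m * b) + of_int n * (of_int n' * y - of_int m' * b)"
      by (simp add: algebra_simps)
    also have "p \<dots> \<le> of_int n' * p (of_int n * x - of_int m * b) + of_int n * p (of_int n' * y - of_int m' * b)"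
      using triangle[of "of_int n' * (of_int n * x - of_int m * b)"] n by (simp only: scale) (smt (verit) of_int_nonneg triangle scale)
    finally show ?thesis using n by (simp add: divide_right_mono field_simps)
  qed
  have "quot b (x + y) - p (of_int n * x - of_int m * b) / of_int n \<le> quot b y" if "1 \<le> n" for n m
    by (rule le_quot) (use 1[OF that] in \<open>simp add: algebra_simps\<close>)
  then have "quot b (x + y) - quot b y \<le> quot b x"
    by (intro le_quot) (simp add: algebra_simps)
  then show "quot b (x + y) \<le> quot b x + quot b y" by simp
next
  fix k x
  have q0: "0 \<le> quot b x" for x by (rule le_quot) (simp add: nonneg)
  show "quot b (of_int k * x) = \<bar>of_int k\<bar> * quot b x"
  proof (cases "k = 0")
    case True
    then show ?thesis using q0[of 0] quot_le_self[of b 0] by simp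
  next
    case False
    show ?thesis
    proof (rule antisym)
      have "quot b (of_int k * x) / \<bar>of_int k\<bar> \<le> quot b x"
      proof (rule le_quot)
        fix n m :: int assume n: "1 \<le> n"
        have "quot b (of_int k * x) \<le> p (of_int n * (of_int k * x) - of_int (k * m) * b) / of_int n"
          by (rule quot_le[OF n])
        also have "of_int n * (of_int k * x) - of_int (k * m) * b = of_int k * (of_int n * x - of_int m * b)"
          by (simp add: algebra_simps)
        finally have "quot b (of_int k * x) \<le> \<bar>of_int k\<bar> * p (of_int n * x - of_int m * b) / of_int n"
          by (simp only: scale)
        then show "quot b (of_int k * x) / \<bar>of_int k\<bar> \<le> p (of_int n * x - of_int m * b) / of_int n"
          using False n by (simp add: pos_divide_le_eq algebra_simps)
      qed
      then show "quot b (of_int k * x) \<le> \<bar>of_int k\<bar> * quot b x" using False by (simp add: field_simps)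
      show "\<bar>of_int k\<bar> * quot b x \<le> quot b (of_int k * x)"
      proof (rule le_quot)
        fix n m :: int assume n: "1 \<le> n"
        have "1 \<le> n * \<bar>k\<bar>" using n False mult_mono[of 1 n 1 "\<bar>k\<bar>"] by simp
        then have "quot b x \<le> p (of_int (n * \<bar>k\<bar>) * x - of_int (sgn k * m) * b) / of_int (n * \<bar>k\<bar>)"
          by (rule quot_le)
        also have "of_int (n * \<bar>k\<bar>) * x - of_int (sgn k * m) * b
            = of_int (sgn k) * (of_int n * (of_int k * x) - of_int m * b)"
          by (cases "k > 0") (use False in \<open>auto simp: algebra_simps sgn_if\<close>)
        also have "p \<dots> = p (of_int n * (of_int k * x) - of_int m * b)"
          using False unfolding scale by (simp add: sgn_if)
        finally show "\<bar>of_int k\<bar> * quot b x \<le> p (of_int n * (of_int k * x) - of_int m * b) / of_int n"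
          using n False by (simp add: field_simps)
      qed
    qed
  qed
qed

text \<open>Rounding a rational multiple m / n of \<open>b\<close> to the nearest integer one costs
  at most \<open>p b / 2\<close>; \<eta> is there because the infimum in \<open>quot\<close> need
  not be attained.\<close>

lemma exists_short_translate:
  assumes "p b > 0" "\<eta> > 0"
  shows "\<exists>m. p (x - of_int m * b) \<le> quot b x + p b / 2 + \<eta>"
proof (rule ccontr)
  assume H: "\<not> ?thesis"
  have "quot b x + \<eta> \<le> quot b x"
  proof (rule le_quot)
    fix n m :: int assume n: "1 \<le> n"
    define k where "k = round (of_int m / of_int n :: real)"
    have "\<bar>of_int k - of_int m / of_int n :: real\<bar> \<le> 1 / 2"
      unfolding k_def by (rule of_int_round_abs_le)
    then have "\<bar>of_int (n * k - m)\<bar> \<le> (of_int n / 2 :: real)" using n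
      by (simp add: abs_if field_simps split: if_splits)
    then have k: "\<bar>of_int (n * k - m)\<bar> * p b \<le> of_int n / 2 * p b"
      using assms by (intro mult_right_mono) auto
    have "quot b x + p b / 2 + \<eta> < p (x - of_int k * b)" using H by (simp add: not_le)
    then have "of_int n * (quot b x + p b / 2 + \<eta>) \<le> of_int n * p (x - of_int k * b)" using n by simp
    also have "\<dots> = p (of_int n * (x - of_int k * b))" using n by (simp add: scale)
    also have "of_int n * (x - of_int k * b) = (of_int n * x - of_int m * b) - of_int (n * k - m) * b"
      by (simp add: algebra_simps)
    also have "p \<dots> \<le> p (of_int n * x - of_int m * b) + \<bar>of_int (n * k - m)\<bar> * p b"
      using diff[of "of_int n * x - of_int m * b" "of_int (n * k - m) * b"] by (simp only: scale)
    also note k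
    finally show "quot b x + \<eta> \<le> p (of_int n * x - of_int m * b) / of_int n" using n
      by (simp add: field_simps)
  qed
  then show False using assms by simp
qed

end

text \<open>Hermite-type reduction: a nearly shortest vector is split off and the rest is handled in
  the quotient seminorm, whose nonzero values stay bounded below by a quarter of the length of
  that vector. The rank is measured by integer relations modulo the null space.\<close>

theorem reduced_basis:
  fixes p :: "'a::comm_ring_1 \<Rightarrow> real"
  assumes "int_seminorm p"
    and gap: "\<delta> > 0" "\<And>x. p x = 0 \<or> \<delta> \<le> p x"
    and rank: "\<And>f :: nat \<Rightarrow> 'a. \<exists>n. (\<exists>i\<le>r. n i \<noteq> 0) \<and> p (\<Sum>i\<le>r. of_int (n i) * f i) = 0"
  shows "\<exists>b c. (\<forall>i<r. \<forall>x y. c i (x + y) = c i x + (c i y :: int)) \<and>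
    (\<forall>i<r. \<forall>x. p x = 0 \<longrightarrow> c i x = 0) \<and>
    (\<forall>x. p (x - (\<Sum>i<r. of_int (c i x) * b i)) = 0) \<and>
    (\<forall>i<r. \<forall>x. \<bar>of_int (c i x)\<bar> * p (b i) \<le> 4 ^ r * fact r * p x)"
  using assms
proof (induction r arbitrary: p \<delta>)
  case 0
  interpret int_seminorm p by (rule 0)
  have "p x = 0" for x
  proof -
    obtain n where "n 0 \<noteq> 0" "p (of_int (n 0) * x) = 0" using 0(4)[of "\<lambda>_. x"] by auto
    then show ?thesis by (simp add: scale)
  qed
  then show ?case by simp
next
  case (Suc r)
  interpret int_seminorm p by (rule Suc)
  show ?case
  proof (cases "\<forall>x. p x = 0")
    case True
    then show ?thesis by (intro exI[of _ "\<lambda>_ _. 0"] exI[of _ "\<lambda>_. 0"]) simp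
  next
    case False
    define P where "P = {p x |x. p x > 0}"
    have ne: "P \<noteq> {}" using False nonneg unfolding P_def by (smt (verit) Collect_empty_eq)
    have lb: "\<delta> \<le> t" if "t \<in> P" for t using that Suc.prems(3) by (force simp: P_def)
    have "\<delta> \<le> Inf P" using ne lb by (intro cInf_greatest)
    then have I: "0 < Inf P" using Suc.prems(2) by simp
    \<comment> \<open>With 4/3, every nonzero value of \<open>p\<close> exceeds 3/4 of
      \<open>p b\<close>, still more than the half lost in rounding.\<close>
    then have "Inf P < 4 / 3 * Inf P" by simp
    then obtain t where t: "t \<in> P" "t < 4 / 3 * Inf P" using ne by (meson cInf_lessD)
    then obtain b where b: "p b > 0" "p b < 4 / 3 * Inf P" by (auto simp: P_def)
    have "bdd_below P" using lb by (auto simp: bdd_below_def)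
    then have near: "3 / 4 * p b < p x" if "p x \<noteq> 0" for x
      using cInf_lower[of "p x" P] that nonneg[of x] b by (force simp: P_def)
    let ?q = "quot b"
    interpret q: int_seminorm ?q by (rule quot_seminorm)
    have short: "\<exists>m. p (x - of_int m * b) \<le> ?q x + p b / 2 + \<eta> * p b" if "\<eta> > 0" for x \<eta>
      using exists_short_translate[of b "\<eta> * p b" x] b that by simp
    \<comment> \<open>The quarter is 3/4 - 1/2: if \<open>?q x < p b / 4\<close>, some translate has
      length at most 3/4 of \<open>p b\<close>, hence is null by \<open>near\<close>.\<close>
    have null_cases: "(\<exists>m. p (x - of_int m * b) = 0) \<or> p b / 4 \<le> ?q x" for x
    proof (rule ccontr)
      assume "\<not> ?thesis"
      then have a: "\<And>m. p (x - of_int m * b) \<noteq> 0" "?q x < p b / 4" by auto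
      define \<eta> where "\<eta> = (p b / 4 - ?q x) / p b"
      have e: "\<eta> > 0" "\<eta> * p b = p b / 4 - ?q x" using a b by (auto simp: \<eta>_def)
      then obtain m where "p (x - of_int m * b) \<le> ?q x + p b / 2 + \<eta> * p b"
        using short[OF e(1), of x] by blast
      then show False using near[OF a(1)[of m]] e(2) by linarith
    qed
    have qnull: "\<exists>m. p (x - of_int m * b) = 0" if "?q x = 0" for x
      using null_cases[of x] that b by auto
    have qnullD: "?q x = 0" if "p (x - of_int m * b) = 0" for x m
      using quot_le[of 1 b x m] that q.nonneg[of x] by simp
    have gap': "?q x = 0 \<or> p b / 4 \<le> ?q x" for x
      using null_cases[of x] qnullD by blast
    \<comment> \<open>Prepending \<open>b\<close> to \<open>f\<close> gives a relation that holds
      for \<open>f\<close> modulo \<open>b\<close>. It does not degenerate, since a relation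
      involving \<open>b\<close> alone contradicts \<open>p b > 0\<close>.\<close>
    have rank': "\<exists>n. (\<exists>i\<le>r. n i \<noteq> 0) \<and> ?q (\<Sum>i\<le>r. of_int (n i) * f i) = 0" for f :: "nat \<Rightarrow> 'a"
    proof -
      let ?g = "\<lambda>i. case i of 0 \<Rightarrow> b | Suc i \<Rightarrow> f i"
      obtain n where n: "\<exists>i\<le>Suc r. n i \<noteq> 0" "p (\<Sum>i\<le>Suc r. of_int (n i) * ?g i) = 0"
        using Suc.prems(4)[of ?g] by blast
      have eq: "(\<Sum>i\<le>Suc r. of_int (n i) * ?g i) = (\<Sum>i\<le>r. of_int (n (Suc i)) * f i) - of_int (- n 0) * b"
        by (subst sum.atMost_Suc_shift) simp
      have "\<exists>i\<le>r. n (Suc i) \<noteq> 0"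
      proof (rule ccontr)
        assume "\<not> ?thesis"
        then have z: "\<And>i. i \<le> r \<Longrightarrow> n (Suc i) = 0" by auto
        then have "n 0 \<noteq> 0" using n(1) by (metis Suc_le_mono old.nat.exhaust)
        moreover have "p (of_int (n 0) * b) = 0" using n(2) z unfolding eq by simp
        ultimately show False using b by (simp add: scale)
      qed
      moreover have "?q (\<Sum>i\<le>r. of_int (n (Suc i)) * f i) = 0" using n(2) unfolding eq by (rule qnullD)
      ultimately show ?thesis by (intro exI[of _ "\<lambda>i. n (Suc i)"]) auto
    qed
    have "0 < p b / 4" using b by simp
    from Suc.IH[OF quot_seminorm this gap' rank'] obtain b0 c0 where
      bc: "(\<forall>i<r. \<forall>x y. c0 i (x + y) = c0 i x + (c0 i y :: int)) \<and>
        (\<forall>i<r. \<forall>x. ?q x = 0 \<longrightarrow> c0 i x = 0) \<and>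
        (\<forall>x. ?q (x - (\<Sum>i<r. of_int (c0 i x) * b0 i)) = 0) \<and>
        (\<forall>i<r. \<forall>x. \<bar>of_int (c0 i x)\<bar> * ?q (b0 i) \<le> 4 ^ r * fact r * ?q x)"
      by (elim exE)
    have add: "\<And>i x y. i < r \<Longrightarrow> c0 i (x + y) = c0 i x + c0 i y"
      and null: "\<And>i x. i < r \<Longrightarrow> ?q x = 0 \<Longrightarrow> c0 i x = 0"
      and dec: "\<And>x. ?q (x - (\<Sum>i<r. of_int (c0 i x) * b0 i)) = 0"
      and bd: "\<And>i x. i < r \<Longrightarrow> \<bar>of_int (c0 i x)\<bar> * ?q (b0 i) \<le> 4 ^ r * fact r * ?q x"
      using bc by blast+
    \<comment> \<open>Lifts with \<open>q b = 0\<close> are replaced by \<open>0\<close>, the others by short translates.\<close>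
    have "\<exists>y m. p (b0 i - of_int m * b - y) = 0 \<and> p y \<le> 4 * ?q (b0 i)" for i
    proof (cases "?q (b0 i) = 0")
      case True
      then show ?thesis using qnull[OF True] by (metis diff_zero zero mult_zero_right order_refl)
    next
      case False
      then have g: "p b / 4 \<le> ?q (b0 i)" using gap' by blast
      \<comment> \<open>As \<open>p b \<le> 4 * ?q (b0 i)\<close>, the excess of 3/4 of
        \<open>p b\<close> is at most \<open>3 * ?q (b0 i)\<close>. This is the factor 4 lost at
        each level.\<close>
      obtain m where "p (b0 i - of_int m * b) \<le> ?q (b0 i) + p b / 2 + 1 / 4 * p b"
        using short[of "1 / 4" "b0 i"] by auto
      then have "p (b0 i - of_int m * b) \<le> 4 * ?q (b0 i)" using g by linarith
      then show ?thesis by (intro exI[of _ "b0 i - of_int m * b"] exI[of _ m]) simp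
    qed
    then obtain b1 m1 where b1: "\<And>i. p (b0 i - of_int (m1 i) * b - b1 i) = 0" "\<And>i. p (b1 i) \<le> 4 * ?q (b0 i)"
      by metis
    have "\<exists>m. p (x - (\<Sum>i<r. of_int (c0 i x) * b1 i) - of_int m * b) = 0" for x
    proof (rule qnull)
      have eq: "x - (\<Sum>i<r. of_int (c0 i x) * b1 i) = (x - (\<Sum>i<r. of_int (c0 i x) * b0 i))
         + (\<Sum>i<r. of_int (c0 i x) * (b0 i - b1 i))"
        by (simp add: sum_subtractf algebra_simps)
      have "?q (b0 i - b1 i) = 0" for i
        by (rule qnullD[of _ "m1 i"]) (use b1(1)[of i] in \<open>simp add: algebra_simps\<close>)
      then have "?q (\<Sum>i<r. of_int (c0 i x) * (b0 i - b1 i)) = 0"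
        using q.sum[of "\<lambda>i. of_int (c0 i x) * (b0 i - b1 i)" "{..<r}"] q.nonneg[of "\<Sum>i<r. of_int (c0 i x) * (b0 i - b1 i)"]
        by (simp add: q.scale)
      then show "?q (x - (\<Sum>i<r. of_int (c0 i x) * b1 i)) = 0"
        unfolding eq using dec[of x] by (simp only: q.add_null)
    qed
    then obtain c1 where c1: "\<And>x. p (x - (\<Sum>i<r. of_int (c0 i x) * b1 i) - of_int (c1 x) * b) = 0"
      by metis
    \<comment> \<open>The coefficient of \<open>b\<close> is unique modulo null vectors; this makes
      the chosen function \<open>c1\<close> additive and zero on null vectors.\<close>
    have uniq: "m = m'" if "p (y - of_int m * b) = 0" "p (y' - of_int m' * b) = 0" "p (y - y') = 0" for m m' y y'
    proof -
      have "of_int (m' - m) * b = ((y - of_int m * b) - (y' - of_int m' * b)) - (y - y')"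
        by (simp add: algebra_simps)
      then have "p (of_int (m' - m) * b) \<le> 0"
        using diff[of "(y - of_int m * b) - (y' - of_int m' * b)" "y - y'"]
          diff[of "y - of_int m * b" "y' - of_int m' * b"] that by (simp only:)
      then have "\<bar>of_int (m' - m)\<bar> * p b \<le> 0" unfolding scale .
      then show ?thesis using b by (simp add: mult_le_0_iff)
    qed
    let ?s = "\<lambda>x. \<Sum>i<r. of_int (c0 i x) * b1 i"
    have c1_add: "c1 (x + y) = c1 x + c1 y" for x y
    proof (rule uniq[OF c1[of "x + y"]])
      have eq: "x + y - ?s (x + y) - of_int (c1 x + c1 y) * b =
          (x - ?s x - of_int (c1 x) * b) + (y - ?s y - of_int (c1 y) * b)"
        by (simp add: add sum.distrib algebra_simps)
      show "p (x + y - ?s (x + y) - of_int (c1 x + c1 y) * b) = 0"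
        unfolding eq add_null[OF c1[of y]] by (rule c1)
    qed simp
    have pq: "?q x = 0" if "p x = 0" for x using quot_le_self[of b x] q.nonneg[of x] that by simp
    have c1_null: "c1 x = 0" if "p x = 0" for x
      by (rule uniq[OF c1[of x], of x]) (use that null[OF _ pq] in auto)
    define c where "c = (\<lambda>i x. case i of 0 \<Rightarrow> c1 x | Suc i \<Rightarrow> c0 i x)"
    define b' where "b' = (\<lambda>i. case i of 0 \<Rightarrow> b | Suc i \<Rightarrow> b1 i)"
    have bd1: "\<bar>of_int (c0 i x)\<bar> * p (b1 i) \<le> 4 * (4 ^ r * fact r * p x)" if "i < r" for i x
    proof -
      have "\<bar>of_int (c0 i x)\<bar> * p (b1 i) \<le> \<bar>of_int (c0 i x)\<bar> * (4 * ?q (b0 i))"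
        by (intro mult_left_mono b1) simp
      also have "\<dots> \<le> 4 * (4 ^ r * fact r * ?q x)" using bd[OF that, of x] by simp
      also have "\<dots> \<le> 4 * (4 ^ r * fact r * p x)" using quot_le_self[of b x] by simp
      finally show ?thesis .
    qed
    have K1: "1 \<le> (4 ^ r * fact r :: real)"
      using mult_mono[of 1 "4 ^ r" 1 "fact r :: real"] by (simp add: fact_ge_1)
    \<comment> \<open>Here the factorial arises: up to a null vector, \<open>c1 x\<close> times
      \<open>b\<close> is \<open>x\<close> minus r lifted terms, each of length at most 4 * 4^r r!
      \<open>p x\<close>, and \<open>p x\<close> itself is no larger. So r + 1 such contributions
      are added.\<close>
    have bd2: "\<bar>of_int (c1 x)\<bar> * p b \<le> 4 ^ Suc r * fact (Suc r) * p x" for x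
    proof -
      have "\<bar>of_int (c1 x)\<bar> * p b = p (of_int (c1 x) * b)" by (simp only: scale)
      also have "of_int (c1 x) * b = (x - ?s x) - (x - ?s x - of_int (c1 x) * b)" by simp
      also have "p \<dots> \<le> p (x - ?s x) + 0" using diff[of "x - ?s x" "x - ?s x - of_int (c1 x) * b"] c1[of x] by simp
      also have "\<dots> \<le> p x + p (?s x)" using diff by simp
      also have "p (?s x) \<le> (\<Sum>i<r. \<bar>of_int (c0 i x)\<bar> * p (b1 i))" using sum[of "\<lambda>i. of_int (c0 i x) * b1 i" "{..<r}"] by (simp only: scale)
      also have "\<dots> \<le> (\<Sum>i<r. 4 * (4 ^ r * fact r * p x))" by (intro sum_mono bd1) simp
      finally have "\<bar>of_int (c1 x)\<bar> * p b \<le> p x + real r * (4 * (4 ^ r * fact r * p x))" by simp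
      moreover have "p x \<le> 4 * (4 ^ r * fact r * p x)"
        using mult_right_mono[OF K1 nonneg[of x]] nonneg[of x] by simp
      ultimately show ?thesis by (simp add: algebra_simps)
    qed
    have mono: "4 * (4 ^ r * fact r * p x) \<le> 4 ^ Suc r * fact (Suc r) * p x" for x
    proof -
      have "(fact r :: real) \<le> fact (Suc r)" by (rule fact_mono) simp
      then have "4 ^ Suc r * fact r * p x \<le> 4 ^ Suc r * fact (Suc r) * p x"
        using nonneg[of x] by (intro mult_right_mono mult_left_mono) auto
      then show ?thesis by (simp add: algebra_simps)
    qed
    show ?thesis
    proof (intro exI[of _ b'] exI[of _ c] conjI allI impI)
      fix i x y assume "i < Suc r"
      then show "c i (x + y) = c i x + c i y" using add c1_add by (cases i) (auto simp: c_def)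
    next
      fix i x assume "i < Suc r" "p x = 0"
      then show "c i x = 0" using null[OF _ pq] c1_null by (cases i) (auto simp: c_def)
    next
      fix x
      have eq: "x - (\<Sum>i<Suc r. of_int (c i x) * b' i) = x - ?s x - of_int (c1 x) * b"
        unfolding sum.lessThan_Suc_shift by (simp add: c_def b'_def)
      show "p (x - (\<Sum>i<Suc r. of_int (c i x) * b' i)) = 0" unfolding eq by (rule c1)
    next
      fix i x assume "i < Suc r"
      then show "\<bar>of_int (c i x)\<bar> * p (b' i) \<le> 4 ^ Suc r * fact (Suc r) * p x"
        using bd2[of x] order_trans[OF bd1 mono] by (cases i) (auto simp: c_def b'_def)
    qed
  qed
qed

text \<open>Gaussian elimination without division. A pivot \<open>V s k\<close> clears the k-th
  equation from the others and \<open>s\<close> leaves the unknowns; at the end the remaining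
  coefficients are scaled by the pivot and that of \<open>s\<close> is read off from the k-th
  equation.\<close>

lemma integer_relation:
  fixes V :: "'i \<Rightarrow> 'j \<Rightarrow> int"
  assumes "finite J" "finite I" "card J < card I"
  shows "\<exists>n. (\<exists>i\<in>I. n i \<noteq> 0) \<and> (\<forall>j\<in>J. (\<Sum>i\<in>I. n i * V i j) = 0)"
  using assms
proof (induction J arbitrary: I V rule: finite_induct)
  case empty
  then have "I \<noteq> {}" by auto
  then show ?case by (intro exI[of _ "\<lambda>_. 1"]) auto
next
  case (insert k J)
  show ?case
  proof (cases "\<forall>i\<in>I. V i k = 0")
    case True
    obtain n where "(\<exists>i\<in>I. n i \<noteq> 0) \<and> (\<forall>j\<in>J. (\<Sum>i\<in>I. n i * V i j) = 0)"
      using insert.IH[of I V] insert.prems insert.hyps by auto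
    then show ?thesis using True by (intro exI[of _ n]) auto
  next
    case False
    then obtain s where s: "s \<in> I" "V s k \<noteq> 0" by blast
    let ?V = "\<lambda>i j. V s k * V i j - V i k * V s j"
    have "card J < card (I - {s})" using insert s by simp
    then obtain n where n: "\<exists>i\<in>I - {s}. n i \<noteq> 0" "\<And>j. j \<in> J \<Longrightarrow> (\<Sum>i\<in>I - {s}. n i * ?V i j) = 0"
      using insert.IH[of "I - {s}" ?V] insert.prems by auto
    define n' where "n' i = (if i = s then - (\<Sum>i\<in>I - {s}. n i * V i k) else V s k * n i)" for i
    have "(\<Sum>i\<in>I. n' i * V i j) = (\<Sum>i\<in>I - {s}. n i * ?V i j)" for j
    proof -
      have "(\<Sum>i\<in>I. n' i * V i j) = n' s * V s j + (\<Sum>i\<in>I - {s}. n' i * V i j)"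
        using insert.prems s by (simp add: sum.remove)
      also have "(\<Sum>i\<in>I - {s}. n' i * V i j) = (\<Sum>i\<in>I - {s}. V s k * n i * V i j)"
        by (rule sum.cong) (auto simp: n'_def)
      also have "n' s * V s j + \<dots> = (\<Sum>i\<in>I - {s}. n i * ?V i j)"
        by (simp add: n'_def sum_distrib_right sum_subtractf right_diff_distrib mult.assoc mult.left_commute)
      finally show ?thesis .
    qed
    moreover have "(\<Sum>i\<in>I - {s}. n i * ?V i k) = 0" by (simp add: algebra_simps)
    moreover have "\<exists>i\<in>I. n' i \<noteq> 0" using n(1) s by (auto simp: n'_def)
    ultimately show ?thesis using n(2) by (intro exI[of _ n']) auto
  qed
qed


section \<open>Bohr sets in cyclic groups\<close>

text \<open>The real lift of the character with frequency \<open>h\<close>. It is defined on all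
  integers so that sums can be evaluated before reduction modulo N.\<close>

definition br :: "nat \<Rightarrow> int \<Rightarrow> int \<Rightarrow> real" where
  "br N h x = cfrac (of_int h / of_nat N * of_int x)"

text \<open>Restricted to the carrier because the elements of \<open>dual\<close> are
  extensional.\<close>

definition chr :: "nat \<Rightarrow> int \<Rightarrow> int \<Rightarrow> circle" where
  "chr N h = (\<lambda>x\<in>{0..int N - 1}. mod1 (of_int h / of_nat N * of_int x))"

lemma carrier_residue_ring: "carrier (residue_ring m) = {0..m - 1}"
  by (simp add: residue_ring_def)

lemma add_residue_ring: "x \<oplus>\<^bsub>residue_ring m\<^esub> y = (x + y) mod m"
  by (simp add: residue_ring_def)

lemma zero_residue_ring: "\<zero>\<^bsub>residue_ring m\<^esub> = 0"
  by (simp add: residue_ring_def)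

lemma abs_br: "\<bar>br N h x\<bar> = znorm (of_int h / of_nat N * of_int x)"
  by (simp add: br_def znorm_eq_abs_cfrac)

lemma mod1_br: "mod1 (br N h x) = mod1 (of_int h / of_nat N * of_int x)"
  by (simp add: br_def)

lemma mod1_cong_mod:
  assumes "0 < N"
  shows "mod1 (of_int h / of_nat N * of_int (x mod int N)) = mod1 (of_int h / of_nat N * of_int x)"
proof -
  have "real_of_int x = of_int (int N * (x div int N) + x mod int N)" by simp
  also have "\<dots> = real N * of_int (x div int N) + of_int (x mod int N)"
    unfolding of_int_add of_int_mult by simp
  finally have "of_int h / of_nat N * of_int (x mod int N) - of_int h / of_nat N * real_of_int x = of_int (- h * (x div int N))"
    using assms by (simp add: field_simps)
  then show ?thesis unfolding mod1_eq_iff by (metis Ints_of_int)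
qed

lemma abs_br_mod: "0 < N \<Longrightarrow> \<bar>br N h (x mod int N)\<bar> = \<bar>br N h x\<bar>"
  by (simp only: abs_br mod1_cong_mod)

lemma abs_br_add: "\<bar>br N h (x + y)\<bar> \<le> \<bar>br N h x\<bar> + \<bar>br N h y\<bar>"
  unfolding abs_br using znorm_add by (simp add: distrib_left)

lemma abs_br_sum: "\<bar>br N h (\<Sum>i\<in>A. f i)\<bar> \<le> (\<Sum>i\<in>A. \<bar>br N h (f i)\<bar>)"
proof (induction A rule: infinite_finite_induct)
  case (insert x F)
  then show ?case using abs_br_add[of N h "f x" "\<Sum>i\<in>F. f i"] by simp
qed (auto simp: abs_br)

lemma br_0 [simp]: "br N h 0 = 0"
  using abs_br[of N h 0] by simp

lemma chr_dual:
  assumes "0 < N"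
  shows "chr N h \<in> dual (residue_ring (int N))"
proof -
  have "chr N h ((x + y) mod int N) = chr N h x + chr N h y"
    if "x \<in> {0..int N - 1}" "y \<in> {0..int N - 1}" for x y
  proof -
    have "(x + y) mod int N \<in> {0..int N - 1}" using assms pos_mod_bound[of "int N" "x + y"] by simp
    then have "chr N h ((x + y) mod int N) = mod1 (of_int h / of_nat N * of_int (x + y))"
      using mod1_cong_mod[OF assms, of h "x + y"] by (simp only: chr_def restrict_apply if_True)
    then show ?thesis using that by (simp add: chr_def distrib_left mod1_add add_divide_distrib)
  qed
  then show ?thesis by (simp add: dual_def carrier_residue_ring add_residue_ring chr_def)
qed

text \<open>The value t of the character at 1 determines it, and going once around the cycle forces
  N t to be an integer. The bound N \<ge> 2 puts 1 into the carrier.\<close>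

lemma dual_imp_chr:
  assumes "2 \<le> N" "\<chi> \<in> dual (residue_ring (int N))"
  shows "\<exists>h. \<chi> = chr N h"
proof -
  have ext: "\<chi> \<in> extensional {0..int N - 1}"
    and add: "\<And>x y. x \<in> {0..int N - 1} \<Longrightarrow> y \<in> {0..int N - 1} \<Longrightarrow> \<chi> ((x + y) mod int N) = \<chi> x + \<chi> y"
    using assms(2) by (auto simp: dual_def carrier_residue_ring add_residue_ring)
  obtain t where t: "mod1 t = \<chi> 1" using mod1_surj by blast
  have \<chi>0: "\<chi> 0 = 0" using add[of 0 0] assms(1) by simp
  have \<chi>n: "\<chi> (int n) = mod1 (real n * t)" if "n < N" for n
    using that
  proof (induction n)
    case 0
    then show ?case using \<chi>0 by simp
  next
    case (Suc n)
    then have "\<chi> (int (Suc n)) = \<chi> (int n) + \<chi> 1" using add[of "int n" 1] by (simp add: add.commute)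
    then show ?case using Suc by (simp add: distrib_right mod1_add t)
  qed
  have "mod1 (real N * t) = mod1 (real (N - 1) * t + t)" using assms(1) by (simp add: of_nat_diff algebra_simps)
  also have "\<dots> = \<chi> (int (N - 1)) + \<chi> 1" using \<chi>n[of "N - 1"] assms(1) by (simp add: mod1_add t)
  also have "\<dots> = \<chi> 0" using add[of "int (N - 1)" 1] assms(1) by (simp add: of_nat_diff)
  finally have "real N * t \<in> \<int>" using mod1_eq_iff[of "real N * t" 0] \<chi>0 by simp
  then obtain h where h: "real N * t = of_int h" by (auto elim: Ints_cases)
  have "\<chi> = chr N h"
  proof (rule extensionalityI[OF ext])
    show "chr N h \<in> extensional {0..int N - 1}" by (simp add: chr_def)
    fix x assume x: "x \<in> {0..int N - 1}"
    have "t = of_int h / of_nat N" using h assms(1) by (simp add: field_simps)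
    moreover have "nat x < N" using x assms(1) by auto
    ultimately show "\<chi> x = chr N h x" using \<chi>n[of "nat x"] x by (simp add: chr_def mult.commute)
  qed
  then show ?thesis by blast
qed

lemma bohr_chr:
  "bohr (residue_ring (int N)) (chr N ` H) \<rho> = {x \<in> {0..int N - 1}. \<forall>h\<in>H. \<bar>br N h x\<bar> \<le> \<rho>}"
  by (auto simp: bohr_def carrier_residue_ring chr_def abs_br)

text \<open>Reduction is applied to the lattice generated by the integer vectors and the vector of
  the \<xi> j / N, under the sum norm: \<open>a i\<close> is the residue of the i-th basis vector,
  \<open>w i\<close> its length. The gap is 1 / N because N times a lattice vector is integral, and
  the rank is at most D. The last bound holds since n times a basis vector has entries representing
  the characters at \<open>n * a i\<close>.\<close>

theorem bohr_coordinates: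
  fixes \<xi> :: "nat \<Rightarrow> int"
  assumes N: "0 < N" and D: "0 < D" and \<xi>0: "\<xi> 0 = 1"
  shows "\<exists>(a :: nat \<Rightarrow> int) w (c :: nat \<Rightarrow> int \<Rightarrow> int) (\<beta> :: nat \<Rightarrow> nat \<Rightarrow> int).
    (\<forall>i<D. \<forall>x. of_int (c i x) = (\<Sum>j<D. of_int (\<beta> i j) * br N (\<xi> j) x)) \<and>
    (\<forall>x. [x = (\<Sum>i<D. c i x * a i)] (mod int N)) \<and>
    (\<forall>i<D. \<forall>x. \<bar>of_int (c i x)\<bar> * w i \<le> 4 ^ D * fact D * (\<Sum>j<D. \<bar>br N (\<xi> j) x\<bar>)) \<and>
    (\<forall>i<D. \<forall>j<D. \<forall>n. \<bar>br N (\<xi> j) (n * a i)\<bar> \<le> \<bar>of_int n\<bar> * w i)"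
proof -
  \<comment> \<open>\<open>u\<close> stands for the lattice vector with entries \<open>\<xi> j * u 0 / N + u (Suc j)\<close>, and \<open>V u\<close> for
    \<open>N\<close> times it; the residue is \<open>u 0\<close>.\<close>
  define V where "V u j = \<xi> j * u 0 + int N * u (Suc j)" for u :: "nat \<Rightarrow> int" and j
  define p where "p u = real_of_int (\<Sum>j<D. \<bar>V u j\<bar>) / real N" for u
  have of_int_fun [simp]: "(of_int n :: nat \<Rightarrow> int) k = n" for n k
    by (cases n rule: int_cases2) (auto simp: fun_eq_iff)
  have V_add: "V (u + v) j = V u j + V v j" for u v j by (simp add: V_def algebra_simps)
  have V_scale: "V (of_int n * u) j = n * V u j" for n u j
    by (simp add: V_def algebra_simps)
  interpret int_seminorm p
  proof
    fix u v n
    have "(\<Sum>j<D. \<bar>V (u + v) j\<bar>) \<le> (\<Sum>j<D. \<bar>V u j\<bar>) + (\<Sum>j<D. \<bar>V v j\<bar>)"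
      unfolding sum.distrib[symmetric] V_add by (intro sum_mono abs_triangle_ineq)
    then have "real_of_int (\<Sum>j<D. \<bar>V (u + v) j\<bar>) \<le> of_int ((\<Sum>j<D. \<bar>V u j\<bar>) + (\<Sum>j<D. \<bar>V v j\<bar>))"
      by (simp only: of_int_le_iff)
    then show "p (u + v) \<le> p u + p v"
      unfolding p_def add_divide_distrib[symmetric] of_int_add[symmetric] by (rule divide_right_mono) simp
    show "p (of_int n * u) = \<bar>of_int n\<bar> * p u"
      by (simp add: p_def V_scale abs_mult sum_distrib_left)
  qed
  have gap: "p u = 0 \<or> 1 / real N \<le> p u" for u
  proof (cases "(\<Sum>j<D. \<bar>V u j\<bar>) = 0")
    case False
    moreover have "0 \<le> (\<Sum>j<D. \<bar>V u j\<bar>)" by (simp add: sum_nonneg)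
    ultimately have "1 \<le> (\<Sum>j<D. \<bar>V u j\<bar>)" by linarith
    then show ?thesis unfolding p_def by (metis divide_right_mono of_int_1_le_iff of_nat_0_le_iff)
  qed (simp add: p_def)
  have rank: "\<exists>n. (\<exists>i\<le>D. n i \<noteq> 0) \<and> p (\<Sum>i\<le>D. of_int (n i) * f i) = 0" for f
  proof -
    obtain n where n: "\<exists>i\<in>{..D}. n i \<noteq> 0" "\<And>j. j < D \<Longrightarrow> (\<Sum>i\<le>D. n i * V (f i) j) = 0"
      using integer_relation[of "{..<D}" "{..D}" "\<lambda>i j. V (f i) j"] by auto
    have "V (\<Sum>i\<in>A. g i) j = (\<Sum>i\<in>A. V (g i) j)" if "finite A" for A and g :: "nat \<Rightarrow> _" and j
      using that
    proof induction
      case empty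
      show ?case by (simp add: V_def)
    next
      case (insert x F)
      then show ?case by (simp only: sum.insert[OF insert(1,2)] V_add)
    qed
    then have "p (\<Sum>i\<le>D. of_int (n i) * f i) = 0" using n(2) by (simp add: p_def V_scale)
    then show ?thesis using n(1) by auto
  qed
  have "int_seminorm p" by unfold_locales
  have "0 < 1 / real N" using N by simp
  from reduced_basis[of p "1 / real N" D, OF \<open>int_seminorm p\<close> this gap rank] obtain b c where
    bc: "(\<forall>i<D. \<forall>x y. c i (x + y) = c i x + (c i y :: int)) \<and>
      (\<forall>i<D. \<forall>x. p x = 0 \<longrightarrow> c i x = 0) \<and>
      (\<forall>x. p (x - (\<Sum>i<D. of_int (c i x) * b i)) = 0) \<and>
      (\<forall>i<D. \<forall>x. \<bar>of_int (c i x)\<bar> * p (b i) \<le> 4 ^ D * fact D * p x)"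
    by (elim exE)
  have add: "\<And>i x y. i < D \<Longrightarrow> c i (x + y) = c i x + c i y"
    and null: "\<And>i x. i < D \<Longrightarrow> p x = 0 \<Longrightarrow> c i x = 0"
    and dec: "\<And>x. p (x - (\<Sum>i<D. of_int (c i x) * b i)) = 0"
    and bd: "\<And>i x. i < D \<Longrightarrow> \<bar>of_int (c i x)\<bar> * p (b i) \<le> 4 ^ D * fact D * p x"
    using bc by blast+
  have pN: "p u = 0 \<longleftrightarrow> (\<forall>j<D. V u j = 0)" for u
    using N by (auto simp: p_def sum_nonneg_eq_0_iff simp flip: of_int_sum of_int_abs)
  have p_real: "p u = (\<Sum>j<D. \<bar>of_int (V u j) / real N\<bar>)" for u
    by (simp add: p_def sum_divide_distrib)
  define m where "m x j = \<lceil>of_int (\<xi> j) / of_nat N * of_int x - 1 / 2 :: real\<rceil>" for x j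
  \<comment> \<open>The shortest representation of \<open>x\<close>: subtracting nearest integers
    leaves exactly the entries \<open>br N (\<xi> j) x\<close>. Entries past \<open>D\<close> do not
    enter \<open>V\<close>; as they are 0, finitely many unit vectors \<open>e k\<close> suffice to
    expand \<open>u x\<close>.\<close>
  define u where "u x k = (case k of 0 \<Rightarrow> x | Suc j \<Rightarrow> if j < D then - m x j else 0)" for x :: int and k
  have uV: "of_int (V (u x) j) / real N = br N (\<xi> j) x" if "j < D" for x j
    using N that by (simp add: V_def u_def br_def cfrac_eq m_def add_divide_distrib field_simps)
  define e where "e k = (\<lambda>k'. if k' = k then 1 else 0 :: int)" for k :: nat
  have c_scale_nat: "c i (of_nat n * v) = int n * c i v" if "i < D" for i n v
  proof (induction n)
    case 0
    have "c i 0 = 0" using null[OF that] by simp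
    then show ?case by (simp only: of_nat_0 mult_zero_left)
  next
    case (Suc n)
    have "of_nat (Suc n) * v = v + of_nat n * v" by (simp only: of_nat_Suc distrib_right mult_1)
    then have "c i (of_nat (Suc n) * v) = c i v + int n * c i v"
      by (simp only: add[OF that] Suc)
    also have "\<dots> = int (Suc n) * c i v" by (simp add: algebra_simps)
    finally show ?case .
  qed
  have c_neg: "c i (- v) = - c i v" if "i < D" for i v
  proof -
    have "c i (v + - v) = 0" using null[OF that] by (simp only: right_minus zero)
    then show ?thesis unfolding add[OF that] by simp
  qed
  have c_scale: "c i (of_int n * v) = n * c i v" if "i < D" for i n v
  proof (cases n rule: int_cases2)
    case (nonneg k)
    then show ?thesis using c_scale_nat[OF that] by (simp only: of_int_of_nat_eq)
  next
    case (nonpos k)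
    then show ?thesis using c_scale_nat[OF that] c_neg[OF that]
      by (simp only: of_int_of_nat_eq of_int_minus mult_minus_left)
  qed
  have c_sum: "c i (\<Sum>k\<in>A. g k) = (\<Sum>k\<in>A. c i (g k))" if "i < D" "finite A" for i A and g :: "nat \<Rightarrow> _"
    using that(2)
  proof induction
    case empty
    show ?case using null[OF that(1)] by (simp only: sum.empty zero)
  next
    case (insert x F)
    then show ?case by (simp only: sum.insert[OF insert(1,2)] add[OF that(1)])
  qed
  have sum_apply: "(\<Sum>j\<in>A. g j) k = (\<Sum>j\<in>A. g j k)"
    if "finite A" for A k and g :: "nat \<Rightarrow> nat \<Rightarrow> int"
    using that by induction auto
  have supp: "v = of_int (v 0) * e 0 + (\<Sum>j<D. of_int (v (Suc j)) * e (Suc j))"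
    if "\<And>j. D \<le> j \<Longrightarrow> v (Suc j) = 0" for v
  proof
    fix k
    show "v k = (of_int (v 0) * e 0 + (\<Sum>j<D. of_int (v (Suc j)) * e (Suc j))) k"
    proof (cases k)
      case 0
      then show ?thesis by (simp add: sum_apply e_def)
    next
      case (Suc j)
      have "(\<Sum>j'<D. v (Suc j') * (if j = j' then 1 else 0)) = v (Suc j)"
        using that[of j] by (auto simp: not_less if_distrib[of "\<lambda>t. _ * t"] cong: if_cong)
      then show ?thesis using Suc by (simp add: sum_apply e_def)
    qed
  qed
  have c_coord: "c i v = v 0 * c i (e 0) + (\<Sum>j<D. v (Suc j) * c i (e (Suc j)))"
    if "i < D" "\<And>j. D \<le> j \<Longrightarrow> v (Suc j) = 0" for i v
  proof -
    have "c i v = c i (of_int (v 0) * e 0 + (\<Sum>j<D. of_int (v (Suc j)) * e (Suc j)))"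
      by (rule arg_cong[OF supp[of v, OF that(2)]])
    also have "\<dots> = v 0 * c i (e 0) + (\<Sum>j<D. v (Suc j) * c i (e (Suc j)))"
      by (simp only: add[OF that(1)] c_sum[OF that(1) finite_lessThan] c_scale[OF that(1)])
    finally show ?thesis .
  qed
  define \<beta> where "\<beta> i j = c i (e (Suc j))" for i j
  \<comment> \<open>The vector (N, -\<xi> 0, -\<xi> 1, ...) represents 0, so \<open>c i\<close>
    vanishes on it. Eliminating \<open>c i (e 0)\<close> by this relation turns \<open>c i\<close>
    into an integer combination of the entries of the lattice vector.\<close>
  have c_null: "int N * c i (e 0) = (\<Sum>j<D. \<xi> j * \<beta> i j)" if "i < D" for i
  proof -
    define v where "v k = (case k of 0 \<Rightarrow> int N | Suc j \<Rightarrow> if j < D then - \<xi> j else 0)" for k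
    have "p v = 0" unfolding pN by (simp add: V_def v_def)
    then have "c i v = 0" using null that by blast
    moreover have "c i v = int N * c i (e 0) + (\<Sum>j<D. - \<xi> j * \<beta> i j)"
      by (subst c_coord[OF that]) (auto simp: v_def \<beta>_def)
    ultimately show ?thesis by (simp add: sum_negf)
  qed
  have 1: "of_int (c i (u x)) = (\<Sum>j<D. of_int (\<beta> i j) * br N (\<xi> j) x)" if "i < D" for i x
  proof -
    have "int N * c i (u x) = int N * (u x 0 * c i (e 0) + (\<Sum>j<D. u x (Suc j) * \<beta> i j))"
      unfolding \<beta>_def by (subst c_coord[OF that]) (auto simp: u_def)
    also have "\<dots> = u x 0 * (\<Sum>j<D. \<xi> j * \<beta> i j) + int N * (\<Sum>j<D. u x (Suc j) * \<beta> i j)"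
      using c_null[OF that] by (simp add: algebra_simps)
    also have "\<dots> = (\<Sum>j<D. \<beta> i j * V (u x) j)"
      by (simp add: V_def sum_distrib_left sum.distrib algebra_simps)
    finally have "real_of_int (int N * c i (u x)) = of_int (\<Sum>j<D. \<beta> i j * V (u x) j)" by (simp only:)
    then have "real_of_int (c i (u x)) = (\<Sum>j<D. of_int (\<beta> i j) * (of_int (V (u x) j) / real N))"
      using N by (simp add: field_simps flip: sum_divide_distrib)
    then show ?thesis by (simp add: uV)
  qed
  have 2: "[x = (\<Sum>i<D. c i (u x) * b i 0)] (mod int N)" for x
  proof -
    define w where "w = u x - (\<Sum>i<D. of_int (c i (u x)) * b i)"
    \<comment> \<open>Because \<open>\<xi> 0 = 1\<close>, entry 0 of a null vector says that its
      residue is divisible by N.\<close>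
    have "V w 0 = 0" using dec[of "u x"] D unfolding pN w_def by blast
    then have "w 0 = int N * (- w (Suc 0))" by (simp add: V_def \<xi>0)
    moreover have "w 0 = x - (\<Sum>i<D. c i (u x) * b i 0)" by (simp add: w_def sum_apply u_def)
    ultimately have "int N dvd x - (\<Sum>i<D. c i (u x) * b i 0)" by (metis dvd_triv_left)
    then show ?thesis by (simp add: cong_iff_dvd_diff)
  qed
  have 3: "\<bar>of_int (c i (u x))\<bar> * p (b i) \<le> 4 ^ D * fact D * (\<Sum>j<D. \<bar>br N (\<xi> j) x\<bar>)" if "i < D" for i x
    using bd[OF that, of "u x"] by (simp add: p_real uV)
  have 4: "\<bar>br N (\<xi> j) (n * b i 0)\<bar> \<le> \<bar>of_int n\<bar> * p (b i)" if "j < D" for i j n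
  proof -
    have "of_int (\<xi> j) / of_nat N * of_int (n * b i 0) - of_int n * (of_int (V (b i) j) / real N) = of_int (- n * b i (Suc j))"
      using N by (simp add: V_def field_simps)
    then have "\<bar>br N (\<xi> j) (n * b i 0)\<bar> \<le> \<bar>of_int n * (of_int (V (b i) j) / real N)\<bar>"
      unfolding abs_br by (intro znorm_le_dist_Ints) (metis Ints_of_int)
    also have "\<dots> = \<bar>of_int n\<bar> * \<bar>of_int (V (b i) j) / real N\<bar>" by (simp add: abs_mult)
    also have "\<dots> \<le> \<bar>of_int n\<bar> * p (b i)"
      unfolding p_real using that by (intro mult_left_mono member_le_sum) auto
    finally show ?thesis .
  qed
  show ?thesis
    by (rule exI[of _ "\<lambda>i. b i 0"], rule exI[of _ "\<lambda>i. p (b i)"], rule exI[of _ "\<lambda>i x. c i (u x)"], rule exI[of _ \<beta>])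
      (use 1 2 3 4 in blast)
qed


section \<open>Expansion along the reduced basis and comparison with a real trilinear form\<close>

text \<open>Each of the r additions costs \<epsilon>, and the empty sum costs one more, since \<psi>
  0 is only within \<epsilon> of 0. All partial sums have to lie in B for the additions to be
  permitted.\<close>

lemma approx_linear_sum:
  fixes x :: "nat \<Rightarrow> int"
  assumes \<psi>: "approx_linear (residue_ring (int N)) B \<epsilon> \<psi>"
    and x: "\<And>i. i < r \<Longrightarrow> x i mod int N \<in> B"
    and s: "\<And>k. k \<le> r \<Longrightarrow> (\<Sum>i<k. x i) mod int N \<in> B"
  shows "circle_norm (\<psi> ((\<Sum>i<r. x i) mod int N) - (\<Sum>i<r. \<psi> (x i mod int N))) \<le> (real r + 1) * \<epsilon>"
  using x s
proof (induction r)
  case 0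
  have "0 \<in> B" using 0(2)[of 0] by simp
  then have "circle_norm (\<psi> 0 - \<psi> 0 - \<psi> 0) \<le> \<epsilon>"
    using \<psi> unfolding approx_linear_def add_residue_ring by (metis add_0 mod_0)
  then show ?case by simp
next
  case (Suc r)
  let ?S = "(\<Sum>i<r. x i) mod int N"
  have eq: "(\<Sum>i<Suc r. x i) mod int N = (?S + x r mod int N) mod int N"
    by (simp add: mod_add_eq)
  have "?S \<in> B" "x r mod int N \<in> B" "(?S + x r mod int N) mod int N \<in> B"
    using Suc.prems(2)[of r] Suc.prems(1)[of r] Suc.prems(2)[of "Suc r"] unfolding eq by auto
  then have "circle_norm (\<psi> ((?S + x r mod int N) mod int N) - \<psi> ?S - \<psi> (x r mod int N)) \<le> \<epsilon>"
    using \<psi> unfolding approx_linear_def add_residue_ring by blast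
  moreover have "circle_norm (\<psi> ?S - (\<Sum>i<r. \<psi> (x i mod int N))) \<le> (real r + 1) * \<epsilon>"
    using Suc by simp
  moreover have "\<psi> ((\<Sum>i<Suc r. x i) mod int N) - (\<Sum>i<Suc r. \<psi> (x i mod int N)) =
      (\<psi> ((?S + x r mod int N) mod int N) - \<psi> ?S - \<psi> (x r mod int N)) + (\<psi> ?S - (\<Sum>i<r. \<psi> (x i mod int N)))"
    unfolding eq by simp
  ultimately show ?case
    using circle_norm_add[of "\<psi> ((?S + x r mod int N) mod int N) - \<psi> ?S - \<psi> (x r mod int N)"
        "\<psi> ?S - (\<Sum>i<r. \<psi> (x i mod int N))"]
    by (simp add: algebra_simps)
qed

lemma circle_norm_diff_sum:
  "circle_norm ((\<Sum>i\<in>A. f i) - (\<Sum>i\<in>A. g i)) \<le> (\<Sum>i\<in>A. circle_norm (f i - g i))"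
  unfolding sum_subtractf[symmetric] by (rule circle_norm_sum)

text \<open>The variables are expanded one after the other, which takes 1, r and r^2 one-variable
  expansions of cost (r + 1) \<epsilon> each.\<close>

lemma approx_trilinear_sum:
  fixes x y z :: "nat \<Rightarrow> int"
  assumes \<phi>: "approx_trilinear (residue_ring (int N)) B \<epsilon> \<phi>"
    and x: "\<And>i. i < r \<Longrightarrow> x i mod int N \<in> B" "\<And>k. k \<le> r \<Longrightarrow> (\<Sum>i<k. x i) mod int N \<in> B"
    and y: "\<And>i. i < r \<Longrightarrow> y i mod int N \<in> B" "\<And>k. k \<le> r \<Longrightarrow> (\<Sum>i<k. y i) mod int N \<in> B"
    and z: "\<And>i. i < r \<Longrightarrow> z i mod int N \<in> B" "\<And>k. k \<le> r \<Longrightarrow> (\<Sum>i<k. z i) mod int N \<in> B"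
  shows "circle_norm (\<phi> ((\<Sum>i<r. x i) mod int N) ((\<Sum>i<r. y i) mod int N) ((\<Sum>i<r. z i) mod int N)
      - (\<Sum>i<r. \<Sum>j<r. \<Sum>k<r. \<phi> (x i mod int N) (y j mod int N) (z k mod int N)))
    \<le> (real r + 1) * (1 + real r + real r ^ 2) * \<epsilon>"
proof -
  let ?X = "(\<Sum>i<r. x i) mod int N" and ?Y = "(\<Sum>i<r. y i) mod int N" and ?Z = "(\<Sum>i<r. z i) mod int N"
  let ?x = "\<lambda>i. x i mod int N" and ?y = "\<lambda>i. y i mod int N" and ?z = "\<lambda>i. z i mod int N"
  have lin: "approx_linear (residue_ring (int N)) B \<epsilon> (\<lambda>u. \<phi> u a b)"
    "approx_linear (residue_ring (int N)) B \<epsilon> (\<lambda>u. \<phi> a u b)"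
    "approx_linear (residue_ring (int N)) B \<epsilon> (\<lambda>u. \<phi> a b u)" if "a \<in> B" "b \<in> B" for a b
    using \<phi> that unfolding approx_trilinear_def by blast+
  let ?e = "(real r + 1) * \<epsilon>"
  have 1: "circle_norm (\<phi> ?X ?Y ?Z - (\<Sum>i<r. \<phi> (?x i) ?Y ?Z)) \<le> ?e"
    by (rule approx_linear_sum[OF lin(1)]) (use x y z in auto)
  have "circle_norm ((\<Sum>i<r. \<phi> (?x i) ?Y ?Z) - (\<Sum>i<r. \<Sum>j<r. \<phi> (?x i) (?y j) ?Z))
      \<le> (\<Sum>i<r. circle_norm (\<phi> (?x i) ?Y ?Z - (\<Sum>j<r. \<phi> (?x i) (?y j) ?Z)))"
    by (rule circle_norm_diff_sum)
  also have "\<dots> \<le> (\<Sum>i<r. ?e)"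
    by (intro sum_mono approx_linear_sum[OF lin(2)]) (use x y z in auto)
  finally have 2: "circle_norm ((\<Sum>i<r. \<phi> (?x i) ?Y ?Z) - (\<Sum>i<r. \<Sum>j<r. \<phi> (?x i) (?y j) ?Z)) \<le> r * ?e"
    by simp
  have "circle_norm ((\<Sum>i<r. \<Sum>j<r. \<phi> (?x i) (?y j) ?Z) - (\<Sum>i<r. \<Sum>j<r. \<Sum>k<r. \<phi> (?x i) (?y j) (?z k)))
      \<le> (\<Sum>i<r. \<Sum>j<r. circle_norm (\<phi> (?x i) (?y j) ?Z - (\<Sum>k<r. \<phi> (?x i) (?y j) (?z k))))"
    by (rule order_trans[OF circle_norm_diff_sum sum_mono[OF circle_norm_diff_sum]])
  also have "\<dots> \<le> (\<Sum>i<r. \<Sum>j<r. ?e)"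
    by (intro sum_mono approx_linear_sum[OF lin(3)]) (use x y z in auto)
  finally have 3: "circle_norm ((\<Sum>i<r. \<Sum>j<r. \<phi> (?x i) (?y j) ?Z) - (\<Sum>i<r. \<Sum>j<r. \<Sum>k<r. \<phi> (?x i) (?y j) (?z k)))
      \<le> r * (r * ?e)"
    by simp
  have "circle_norm (\<phi> ?X ?Y ?Z - (\<Sum>i<r. \<Sum>j<r. \<Sum>k<r. \<phi> (?x i) (?y j) (?z k))) \<le> ?e + (r * ?e + r * (r * ?e))"
    using 1 2 3
      circle_norm_triangle[of "\<phi> ?X ?Y ?Z" "\<Sum>i<r. \<Sum>j<r. \<Sum>k<r. \<phi> (?x i) (?y j) (?z k)" "\<Sum>i<r. \<phi> (?x i) ?Y ?Z"]
      circle_norm_triangle[of "\<Sum>i<r. \<phi> (?x i) ?Y ?Z" "\<Sum>i<r. \<Sum>j<r. \<Sum>k<r. \<phi> (?x i) (?y j) (?z k)" "\<Sum>i<r. \<Sum>j<r. \<phi> (?x i) (?y j) ?Z"]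
    by linarith
  also have "\<dots> = (real r + 1) * (1 + real r + real r ^ 2) * \<epsilon>"
    by (simp add: algebra_simps power2_eq_square power3_eq_cube)
  finally show ?thesis .
qed

lemma sum_linear_change:
  fixes v T :: "_ \<Rightarrow> 'a::comm_semiring_0"
  shows "(\<Sum>j\<in>J. v j * (\<Sum>p\<in>P. \<beta> p j * T p)) = (\<Sum>p\<in>P. (\<Sum>j\<in>J. \<beta> p j * v j) * T p)"
  by (simp add: sum_distrib_left sum_distrib_right ac_simps) (rule sum.swap)

lemma sum_pull:
  fixes z b :: "_ \<Rightarrow> 'a::comm_semiring_0"
  shows "(\<Sum>l\<in>L. z l * (\<Sum>p\<in>P. b p * H p l)) = (\<Sum>p\<in>P. b p * (\<Sum>l\<in>L. z l * H p l))"
  by (simp add: sum_distrib_left ac_simps) (rule sum.swap)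

text \<open>Linear change of variables in a trilinear form. Nesting the sums reduces it to
  one-variable identities.\<close>

lemma sum_trilinear_change:
  fixes v w z :: "_ \<Rightarrow> 'a::comm_semiring_0"
  shows "(\<Sum>j\<in>J. v j * (\<Sum>k\<in>J. w k * (\<Sum>l\<in>J. z l *
      (\<Sum>p\<in>P. \<beta> p j * (\<Sum>q\<in>P. \<beta> q k * (\<Sum>r\<in>P. \<beta> r l * \<theta> p q r)))))) =
    (\<Sum>p\<in>P. (\<Sum>j\<in>J. \<beta> p j * v j) * (\<Sum>q\<in>P. (\<Sum>k\<in>J. \<beta> q k * w k) * (\<Sum>r\<in>P. (\<Sum>l\<in>J. \<beta> r l * z l) * \<theta> p q r)))"
proof -
  define G2 where "G2 p q l = (\<Sum>r\<in>P. \<beta> r l * \<theta> p q r)" for p q l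
  define G1 where "G1 p k l = (\<Sum>q\<in>P. \<beta> q k * G2 p q l)" for p k l
  have a: "(\<Sum>l\<in>J. z l * (\<Sum>p\<in>P. \<beta> p j * G1 p k l)) = (\<Sum>p\<in>P. \<beta> p j * (\<Sum>l\<in>J. z l * G1 p k l))" for j k
    by (rule sum_pull)
  have b: "(\<Sum>k\<in>J. w k * (\<Sum>p\<in>P. \<beta> p j * (\<Sum>l\<in>J. z l * G1 p k l)))
     = (\<Sum>p\<in>P. \<beta> p j * (\<Sum>k\<in>J. w k * (\<Sum>l\<in>J. z l * G1 p k l)))" for j
    by (rule sum_pull)
  have c: "(\<Sum>l\<in>J. z l * G1 p k l) = (\<Sum>q\<in>P. \<beta> q k * (\<Sum>l\<in>J. z l * G2 p q l))" for p k
    unfolding G1_def by (rule sum_pull)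
  have d: "(\<Sum>k\<in>J. w k * (\<Sum>l\<in>J. z l * G1 p k l)) = (\<Sum>q\<in>P. (\<Sum>k\<in>J. \<beta> q k * w k) * (\<Sum>l\<in>J. z l * G2 p q l))" for p
    unfolding c by (rule sum_linear_change)
  have e: "(\<Sum>l\<in>J. z l * G2 p q l) = (\<Sum>r\<in>P. (\<Sum>l\<in>J. \<beta> r l * z l) * \<theta> p q r)" for p q
    unfolding G2_def by (rule sum_linear_change)
  have "(\<Sum>j\<in>J. v j * (\<Sum>k\<in>J. w k * (\<Sum>l\<in>J. z l * (\<Sum>p\<in>P. \<beta> p j * G1 p k l)))) =
    (\<Sum>p\<in>P. (\<Sum>j\<in>J. \<beta> p j * v j) * (\<Sum>k\<in>J. w k * (\<Sum>l\<in>J. z l * G1 p k l)))"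
    unfolding a b by (rule sum_linear_change)
  then show ?thesis unfolding d e unfolding G1_def G2_def .
qed

text \<open>The first part of the error comes from expanding \<phi> in the basis, the second is 1365
  \<epsilon> for each of the D^3 boxes. In the radius one factor D comes from the sum norm over D
  frequencies and the other from adding up to D basis multiples.\<close>

theorem approx_trilinear_eq_real_trilinear:
  fixes \<xi> :: "nat \<Rightarrow> int" and \<phi> :: "int \<Rightarrow> int \<Rightarrow> int \<Rightarrow> circle"
  assumes N: "0 < N" and D: "0 < D" and \<xi>0: "\<xi> 0 = 1" and \<sigma>: "0 < \<sigma>" "4 ^ D * fact D * real D ^ 2 * \<sigma> \<le> \<rho>"
    and \<phi>: "approx_trilinear (residue_ring (int N)) {x \<in> {0..int N - 1}. \<forall>j<D. \<bar>br N (\<xi> j) x\<bar> \<le> \<rho>} \<epsilon> \<phi>"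
      (is "approx_trilinear _ ?B _ _")
  shows "\<exists>\<gamma> :: nat \<Rightarrow> nat \<Rightarrow> nat \<Rightarrow> real.
    \<forall>x \<in> {x \<in> {0..int N - 1}. \<forall>j<D. \<bar>br N (\<xi> j) x\<bar> \<le> \<sigma>}.
    \<forall>y \<in> {x \<in> {0..int N - 1}. \<forall>j<D. \<bar>br N (\<xi> j) x\<bar> \<le> \<sigma>}.
    \<forall>z \<in> {x \<in> {0..int N - 1}. \<forall>j<D. \<bar>br N (\<xi> j) x\<bar> \<le> \<sigma>}.
      circle_norm (\<phi> x y z - mod1 (\<Sum>j<D. br N (\<xi> j) x * (\<Sum>k<D. br N (\<xi> k) y * (\<Sum>l<D. br N (\<xi> l) z * \<gamma> j k l))))
      \<le> ((real D + 1) * (1 + real D + real D ^ 2) + 1365 * real D ^ 3) * \<epsilon>"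
    (is "\<exists>\<gamma>. \<forall>x\<in>?X. \<forall>y\<in>?X. \<forall>z\<in>?X. _ \<gamma> x y z")
proof -
  let ?G = "residue_ring (int N)"
  obtain a w c \<beta> where
    abc: "(\<forall>i<D. \<forall>x. of_int (c i x) = (\<Sum>j<D. of_int (\<beta> i j) * br N (\<xi> j) x)) \<and>
    (\<forall>x. [x = (\<Sum>i<D. c i x * a i)] (mod int N)) \<and>
    (\<forall>i<D. \<forall>x. \<bar>of_int (c i x)\<bar> * w i \<le> 4 ^ D * fact D * (\<Sum>j<D. \<bar>br N (\<xi> j) x\<bar>)) \<and>
    (\<forall>i<D. \<forall>j<D. \<forall>n. \<bar>br N (\<xi> j) (n * a i)\<bar> \<le> \<bar>of_int n\<bar> * w i)"
    using bohr_coordinates[of N D \<xi>, OF N D \<xi>0] by (elim exE)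
  have c\<beta>: "of_int (c i x) = (\<Sum>j<D. of_int (\<beta> i j) * br N (\<xi> j) x)" if "i < D" for i x
    using abc that by blast
  have dec: "[x = (\<Sum>i<D. c i x * a i)] (mod int N)" for x using abc by blast
  have cw: "\<bar>of_int (c i x)\<bar> * w i \<le> 4 ^ D * fact D * (\<Sum>j<D. \<bar>br N (\<xi> j) x\<bar>)" if "i < D" for i x
    using abc that by blast
  have bra: "\<bar>br N (\<xi> j) (n * a i)\<bar> \<le> \<bar>of_int n\<bar> * w i" if "i < D" "j < D" for i j n
    using abc that by blast
  have w0: "0 \<le> w i" if "i < D" for i using bra[OF that D, of 1] by linarith
  define R where "R = 4 ^ D * fact D * (real D * \<sigma>)"
  have R: "real D * R \<le> \<rho>" using \<sigma>(2) by (simp add: R_def power2_eq_square algebra_simps)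
  have R0: "0 \<le> R" using \<sigma>(1) by (simp add: R_def)
  have R\<rho>: "R \<le> \<rho>"
  proof -
    have "1 * R \<le> real D * R" using D R0 by (intro mult_right_mono) auto
    then show ?thesis using R by simp
  qed
  have cR: "\<bar>of_int (c i x)\<bar> * w i \<le> R" if "i < D" "x \<in> ?X" for i x
  proof -
    have "(\<Sum>j<D. \<bar>br N (\<xi> j) x\<bar>) \<le> real (card {..<D}) * \<sigma>" using that by (intro sum_bounded_above) auto
    then have "4 ^ D * fact D * (\<Sum>j<D. \<bar>br N (\<xi> j) x\<bar>) \<le> R" unfolding R_def by (intro mult_left_mono) auto
    then show ?thesis using cw[OF that(1), of x] by linarith
  qed
  have finX: "finite ?X" by (rule finite_subset[of _ "{0..int N - 1}"]) auto
  have "0 \<in> ?X" using N \<sigma>(1) by simp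
  then have neX: "?X \<noteq> {}" by blast
  \<comment> \<open>The range is the largest coordinate that occurs, not \<open>R / w i\<close>,
    since \<open>w i\<close> may be 0. As the maximum is attained, \<open>L i * w i \<le> R\<close>
    still holds.\<close>
  define L where "L i = Max ((\<lambda>x. nat \<bar>c i x\<bar>) ` ?X)" for i
  have cL: "\<bar>c i x\<bar> \<le> int (L i)" if "x \<in> ?X" for i x
  proof -
    have "nat \<bar>c i x\<bar> \<le> L i" unfolding L_def using that finX by (intro Max_ge) auto
    then show ?thesis by linarith
  qed
  have LR: "real (L i) * w i \<le> R" if "i < D" for i
  proof -
    have "L i \<in> (\<lambda>x. nat \<bar>c i x\<bar>) ` ?X" unfolding L_def using finX neX by (intro Max_in) auto
    then obtain x where "x \<in> ?X" "L i = nat \<bar>c i x\<bar>" by blast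
    then show ?thesis using cR[OF that] by auto
  qed
  have B_I: "x mod int N \<in> ?B" if "\<And>j. j < D \<Longrightarrow> \<bar>br N (\<xi> j) x\<bar> \<le> \<rho>" for x
    using that N pos_mod_bound[of "int N" x] by (auto simp: abs_br_mod)
  define pt where "pt i n = (n * a i) mod int N" for i n
  have ptB: "pt i n \<in> ?B" if "i < D" "\<bar>n\<bar> \<le> int (L i)" for i n
    unfolding pt_def
  proof (rule B_I)
    fix j assume j: "j < D"
    have "\<bar>br N (\<xi> j) (n * a i)\<bar> \<le> \<bar>of_int n\<bar> * w i" by (rule bra) (use that j in auto)
    also have "\<dots> \<le> real (L i) * w i" using that(2) w0[OF that(1)] by (intro mult_right_mono) linarith+
    finally show "\<bar>br N (\<xi> j) (n * a i)\<bar> \<le> \<rho>" using LR[OF that(1)] R\<rho> by linarith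
  qed
  have sumB: "(\<Sum>i<k. c i x * a i) mod int N \<in> ?B" if "k \<le> D" "x \<in> ?X" for k x
  proof (rule B_I)
    fix j assume j: "j < D"
    have "\<bar>br N (\<xi> j) (\<Sum>i<k. c i x * a i)\<bar> \<le> (\<Sum>i<k. \<bar>br N (\<xi> j) (c i x * a i)\<bar>)" by (rule abs_br_sum)
    also have "\<dots> \<le> (\<Sum>i<k. \<bar>of_int (c i x)\<bar> * w i)" using that j by (intro sum_mono bra) auto
    also have "\<dots> \<le> real (card {..<k}) * R" using that cR by (intro sum_bounded_above) auto
    also have "\<dots> \<le> real D * R" using that R0 by (intro mult_right_mono) auto
    finally show "\<bar>br N (\<xi> j) (\<Sum>i<k. c i x * a i)\<bar> \<le> \<rho>" using R by linarith
  qed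
  have pt_add: "pt i (u + v) = pt i u \<oplus>\<^bsub>?G\<^esub> pt i v" for i u v
    by (simp add: pt_def add_residue_ring mod_add_eq distrib_right)
  obtain rep where rep: "\<And>t. mod1 (rep t) = t" using mod1_surj by metis
  define F where "F p q r l m n = rep (\<phi> (pt p l) (pt q m) (pt r n))" for p q r l m n
  have modF: "mod1 (F p q r l m n) = \<phi> (pt p l) (pt q m) (pt r n)" for p q r l m n
    by (simp add: F_def rep)
  have \<phi>_lin: "circle_norm (\<phi> (u \<oplus>\<^bsub>?G\<^esub> v) s t - \<phi> u s t - \<phi> v s t) \<le> \<epsilon>"
    "circle_norm (\<phi> s u' t - \<phi> s u t - \<phi> s v t) \<le> \<epsilon>"
    "circle_norm (\<phi> s t u' - \<phi> s t u - \<phi> s t v) \<le> \<epsilon>"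
    if "u \<in> ?B" "v \<in> ?B" "u' \<in> ?B" "u' = u \<oplus>\<^bsub>?G\<^esub> v" "s \<in> ?B" "t \<in> ?B" for u v u' s t
    using \<phi> that unfolding approx_trilinear_def approx_linear_def by blast+
  have "\<exists>\<theta>. \<forall>l m n. \<bar>l\<bar> \<le> int (L p) \<longrightarrow> \<bar>m\<bar> \<le> int (L q) \<longrightarrow> \<bar>n\<bar> \<le> int (L r) \<longrightarrow>
     znorm (F p q r l m n - of_int l * of_int m * of_int n * \<theta>) \<le> 1365 * \<epsilon>"
    if "p < D" "q < D" "r < D" for p q r
    by (rule circle_almost_trilinear_box; unfold mod1_diff modF pt_add; rule \<phi>_lin)
      (use that ptB in \<open>auto simp flip: pt_add\<close>)
  then obtain \<theta> where \<theta>: "\<And>p q r l m n. p < D \<Longrightarrow> q < D \<Longrightarrow> r < D \<Longrightarrow>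
     \<bar>l\<bar> \<le> int (L p) \<Longrightarrow> \<bar>m\<bar> \<le> int (L q) \<Longrightarrow> \<bar>n\<bar> \<le> int (L r) \<Longrightarrow>
     znorm (F p q r l m n - of_int l * of_int m * of_int n * \<theta> p q r) \<le> 1365 * \<epsilon>"
    by metis
  \<comment> \<open>The box slopes pulled back along the integer matrix \<beta>, which passes from
    the values of the characters to the basis coordinates.\<close>
  define \<gamma> where "\<gamma> j k l = (\<Sum>p<D. of_int (\<beta> p j) * (\<Sum>q<D. of_int (\<beta> q k) * (\<Sum>r<D. of_int (\<beta> r l) * \<theta> p q r)))" for j k l
  have "circle_norm (\<phi> x y z - mod1 (\<Sum>j<D. br N (\<xi> j) x * (\<Sum>k<D. br N (\<xi> k) y * (\<Sum>l<D. br N (\<xi> l) z * \<gamma> j k l))))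
      \<le> ((real D + 1) * (1 + real D + real D ^ 2) + 1365 * real D ^ 3) * \<epsilon>"
    if x: "x \<in> ?X" and y: "y \<in> ?X" and z: "z \<in> ?X" for x y z
  proof -
    have X: "u = (\<Sum>i<D. c i u * a i) mod int N" if "u \<in> ?X" for u
      using dec[of u] that by (auto simp: cong_def)
    let ?s = "\<Sum>i<D. \<Sum>j<D. \<Sum>k<D. \<phi> (pt i (c i x)) (pt j (c j y)) (pt k (c k z))"
    have "circle_norm (\<phi> ((\<Sum>i<D. c i x * a i) mod int N) ((\<Sum>i<D. c i y * a i) mod int N) ((\<Sum>i<D. c i z * a i) mod int N) - ?s)
      \<le> (real D + 1) * (1 + real D + real D ^ 2) * \<epsilon>"
      unfolding pt_def
      by (rule approx_trilinear_sum[OF \<phi>]) (use x y z ptB cL sumB in \<open>simp_all add: pt_def\<close>)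
    then have 1: "circle_norm (\<phi> x y z - ?s) \<le> (real D + 1) * (1 + real D + real D ^ 2) * \<epsilon>"
      using X[OF x] X[OF y] X[OF z] by simp
    let ?t = "\<lambda>i j k. of_int (c i x) * of_int (c j y) * of_int (c k z) * \<theta> i j k"
    have "circle_norm (?s - (\<Sum>i<D. \<Sum>j<D. \<Sum>k<D. mod1 (?t i j k)))
      \<le> (\<Sum>i<D. \<Sum>j<D. \<Sum>k<D. circle_norm (\<phi> (pt i (c i x)) (pt j (c j y)) (pt k (c k z)) - mod1 (?t i j k)))"
      by (intro order_trans[OF circle_norm_diff_sum] sum_mono order_refl)
    also have "\<dots> \<le> (\<Sum>i<D. \<Sum>j<D. \<Sum>k<D. 1365 * \<epsilon>)"
    proof (intro sum_mono)
      fix i j k assume "i \<in> {..<D}" "j \<in> {..<D}" "k \<in> {..<D}"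
      then show "circle_norm (\<phi> (pt i (c i x)) (pt j (c j y)) (pt k (c k z)) - mod1 (?t i j k)) \<le> 1365 * \<epsilon>"
        using \<theta>[of i j k "c i x" "c j y" "c k z"] cL[OF x] cL[OF y] cL[OF z] by (simp add: mod1_diff modF)
    qed
    also have "\<dots> = 1365 * real D ^ 3 * \<epsilon>" by (simp add: power3_eq_cube)
    finally have 2: "circle_norm (?s - (\<Sum>i<D. \<Sum>j<D. \<Sum>k<D. mod1 (?t i j k))) \<le> 1365 * real D ^ 3 * \<epsilon>" .
    have "(\<Sum>j<D. br N (\<xi> j) x * (\<Sum>k<D. br N (\<xi> k) y * (\<Sum>l<D. br N (\<xi> l) z * \<gamma> j k l))) =
      (\<Sum>i<D. of_int (c i x) * (\<Sum>j<D. of_int (c j y) * (\<Sum>k<D. of_int (c k z) * \<theta> i j k)))"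
      unfolding \<gamma>_def sum_trilinear_change by (simp add: c\<beta>)
    also have "\<dots> = (\<Sum>i<D. \<Sum>j<D. \<Sum>k<D. ?t i j k)"
      by (simp add: sum_distrib_left mult.assoc)
    finally have 3: "mod1 (\<Sum>j<D. br N (\<xi> j) x * (\<Sum>k<D. br N (\<xi> k) y * (\<Sum>l<D. br N (\<xi> l) z * \<gamma> j k l)))
       = (\<Sum>i<D. \<Sum>j<D. \<Sum>k<D. mod1 (?t i j k))" by (simp add: mod1_sum)
    show ?thesis unfolding 3
      using 1 2 circle_norm_triangle[of "\<phi> x y z" "\<Sum>i<D. \<Sum>j<D. \<Sum>k<D. mod1 (?t i j k)" ?s]
      by (simp add: distrib_right)
  qed
  then show ?thesis by blast
qed


section \<open>Bracket polynomials on bilinear Bohr varieties\<close>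

lemma cfrac_eqI:
  assumes "mod1 s = mod1 t" "\<bar>t\<bar> < 1 / 2"
  shows "cfrac s = t"
  using assms by (intro cfrac_unique) (auto simp: mod1_eq_iff)

definition int_part :: "real \<Rightarrow> int" where
  "int_part t = \<lceil>t - 1 / 2\<rceil>"

lemma of_int_int_part: "of_int (int_part t) = t - cfrac t"
  by (simp add: int_part_def cfrac_eq)

text \<open>An integer depending on \<open>x\<close> that later serves as a frequency in
  \<open>y\<close>. Its expression through \<open>br N f\<close> and \<open>br N (h * f)\<close>
  makes it additive in \<open>x\<close> where both are small.\<close>

definition brk :: "nat \<Rightarrow> int \<Rightarrow> int \<Rightarrow> int \<Rightarrow> int" where
  "brk N h f x = int_part (of_int h * br N f x)"

lemma br_mult: "br N (h * f) x = cfrac (of_int h * br N f x)"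
proof -
  have "of_int h * (of_int f / real N * of_int x) - of_int h * br N f x = of_int h * (of_int f / real N * of_int x - br N f x)"
    by (simp add: algebra_simps)
  also have "\<dots> \<in> \<int>" unfolding br_def by (intro Ints_mult cfrac_diff_Ints) auto
  finally have "mod1 (of_int (h * f) / real N * of_int x) = mod1 (of_int h * br N f x)"
    by (simp add: mod1_eq_iff mult.assoc)
  then have "mod1 (of_int (h * f) / real N * of_int x) = mod1 (cfrac (of_int h * br N f x))" by simp
  then have "of_int (h * f) / real N * of_int x - cfrac (of_int h * br N f x) \<in> \<int>"
    by (simp only: mod1_eq_iff)
  then show ?thesis unfolding br_def[of N "h * f"] using cfrac_bounds by (intro cfrac_unique) auto
qed

lemma of_int_brk: "of_int (brk N h f x) = of_int h * br N f x - br N (h * f) x"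
  by (simp add: brk_def of_int_int_part br_mult)

text \<open>The bracket around \<open>x\<close> may be removed only under an integer factor; this is
  why real coefficients are rounded before the bracket is opened.\<close>

lemma mod1_int_mult_br:
  "mod1 (of_int n * br N f x) = mod1 (of_int n * (of_int f / of_nat N * of_int x))"
proof -
  have "of_int n * (br N f x - of_int f / of_nat N * of_int x) \<in> \<int>"
    unfolding br_def
    by (intro Ints_mult) (use cfrac_diff_Ints[of "of_int f / of_nat N * of_int x"] Ints_minus in fastforce)+
  then show ?thesis by (simp add: mod1_eq_iff algebra_simps)
qed

text \<open>With \<open>g = int_part \<gamma>\<close>, write \<open>\<gamma> v w\<close> as \<open>cfrac \<gamma> v w + g v w\<close> and \<open>g v = n + br (g f)\<close> for the integer
  \<open>n = brk g f\<close>; then \<open>n w\<close> equals \<open>n h y / N\<close> modulo \<open>1\<close>, and expanding \<open>n\<close> again gives the last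
  two terms.\<close>

definition bracket_product_frac :: "nat \<Rightarrow> real \<Rightarrow> int \<Rightarrow> int \<Rightarrow> int \<Rightarrow> int \<Rightarrow> real" where
  "bracket_product_frac N \<gamma> f h x y =
     cfrac \<gamma> * br N f x * br N h y + br N (int_part \<gamma> * f) x * br N h y
     + cfrac (br N f x * (of_int (int_part \<gamma> * h) / of_nat N) * of_int y)
     - cfrac (br N (int_part \<gamma> * f) x * (of_int h / of_nat N) * of_int y)"

lemma mod1_bracket_product_frac:
  "mod1 (bracket_product_frac N \<gamma> f h x y) = mod1 (\<gamma> * br N f x * br N h y)"
proof -
  let ?g = "int_part \<gamma>" and ?n = "brk N (int_part \<gamma>) f x"
  have "\<gamma> * br N f x * br N h y = cfrac \<gamma> * br N f x * br N h y + (of_int ?g * br N f x) * br N h y"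
    by (simp add: of_int_int_part algebra_simps)
  also have "of_int ?g * br N f x = of_int ?n + br N (?g * f) x" by (simp add: of_int_brk)
  finally have "\<gamma> * br N f x * br N h y = cfrac \<gamma> * br N f x * br N h y + br N (?g * f) x * br N h y + of_int ?n * br N h y"
    by (simp add: algebra_simps)
  then have "mod1 (\<gamma> * br N f x * br N h y) = mod1 (cfrac \<gamma> * br N f x * br N h y + br N (?g * f) x * br N h y)
     + mod1 (of_int ?n * (of_int h / of_nat N * of_int y))"
    by (simp add: mod1_add mod1_int_mult_br)
  also have "of_int ?n * (of_int h / of_nat N * of_int y) = br N f x * (of_int (?g * h) / of_nat N) * of_int y
     - br N (?g * f) x * (of_int h / of_nat N) * of_int y"
    by (simp add: of_int_brk algebra_simps)
  finally show ?thesis unfolding bracket_product_frac_def mod1_diff mod1_add mod1_cfrac by (simp add: add_diff_eq)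
qed

text \<open>Since \<open>0 \<le> y / N < 1\<close>, it suffices to split \<open>h * br N f x\<close> into integer and fractional part.\<close>

lemma cfrac_br_mult_le:
  assumes y: "y \<in> {0..int N - 1}"
  shows "\<bar>cfrac (br N f x * (of_int h / of_nat N) * of_int y)\<bar> \<le> \<bar>br N (brk N h f x) y\<bar> + \<bar>br N (h * f) x\<bar>"
proof -
  have y1: "\<bar>real_of_int y / real N\<bar> \<le> 1" using y by auto
  have "br N f x * (of_int h / of_nat N) * of_int y
    = of_int (brk N h f x) / of_nat N * of_int y + br N (h * f) x * (of_int y / of_nat N)"
    by (simp add: of_int_brk diff_divide_distrib algebra_simps)
  then have "\<bar>cfrac (br N f x * (of_int h / of_nat N) * of_int y)\<bar>
    \<le> \<bar>br N (brk N h f x) y\<bar> + znorm (br N (h * f) x * (of_int y / of_nat N))"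
    unfolding znorm_eq_abs_cfrac[symmetric] abs_br[symmetric] using znorm_add by (simp add: abs_br)
  also have "znorm (br N (h * f) x * (of_int y / of_nat N)) \<le> \<bar>br N (h * f) x\<bar> * \<bar>of_int y / of_nat N\<bar>"
    using znorm_le_abs by (metis abs_mult)
  also have "\<dots> \<le> \<bar>br N (h * f) x\<bar> * 1" using y1 by (intro mult_left_mono) auto
  finally show ?thesis by simp
qed

text \<open>The four terms contribute \<sigma>, \<sigma>, 2\<sigma> and 2\<sigma>. Both brackets
  lead to the same product of frequencies in \<open>x\<close>, so one condition there serves both,
  whereas each needs its own condition on \<open>y\<close>.\<close>

lemma bracket_product_frac_le:
  assumes "y \<in> {0..int N - 1}" "\<bar>br N h y\<bar> \<le> \<sigma>"
    and "\<bar>br N (h * (int_part \<gamma> * f)) x\<bar> \<le> \<sigma>"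
    and "\<bar>br N (brk N (int_part \<gamma> * h) f x) y\<bar> \<le> \<sigma>" "\<bar>br N (brk N h (int_part \<gamma> * f) x) y\<bar> \<le> \<sigma>"
  shows "\<bar>bracket_product_frac N \<gamma> f h x y\<bar> \<le> 6 * \<sigma>"
proof -
  have \<sigma>: "0 \<le> \<sigma>" using assms(2) by linarith
  have b: "\<bar>cfrac t\<bar> \<le> 1" for t using cfrac_bounds[of t] by linarith
  have b': "\<bar>br N k u\<bar> \<le> 1" for k u unfolding br_def by (rule b)
  have "\<bar>cfrac \<gamma> * br N f x * br N h y\<bar> \<le> 1 * 1 * \<sigma>"
    unfolding abs_mult using assms(2) b b' \<sigma> by (intro mult_mono) auto
  moreover have "\<bar>br N (int_part \<gamma> * f) x * br N h y\<bar> \<le> 1 * \<sigma>"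
    unfolding abs_mult using assms(2) b' \<sigma> by (intro mult_mono) auto
  moreover have "\<bar>cfrac (br N f x * (of_int (int_part \<gamma> * h) / of_nat N) * of_int y)\<bar> \<le> 2 * \<sigma>"
    using cfrac_br_mult_le[OF assms(1), of f x "int_part \<gamma> * h"] assms(3,4) by (simp add: ac_simps)
  moreover have "\<bar>cfrac (br N (int_part \<gamma> * f) x * (of_int h / of_nat N) * of_int y)\<bar> \<le> 2 * \<sigma>"
    using cfrac_br_mult_le[OF assms(1), of "int_part \<gamma> * f" x h] assms(3,5) by simp
  ultimately show ?thesis unfolding bracket_product_frac_def by linarith
qed

section \<open>Sums of generalized monomials\<close>

lemma is_gen_polynomial_monomial: "t \<in> gen_monomials \<Longrightarrow> is_gen_polynomial N 1 t"
  unfolding is_gen_polynomial_def by (rule exI[of _ "[t]"]) auto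

lemma is_gen_polynomial_mono: "is_gen_polynomial N K g \<Longrightarrow> K \<le> K' \<Longrightarrow> is_gen_polynomial N K' g"
  unfolding is_gen_polynomial_def by fastforce

lemma is_gen_polynomial_zero: "0 \<le> K \<Longrightarrow> is_gen_polynomial N K (\<lambda>x y z. 0)"
  unfolding is_gen_polynomial_def by (rule exI[of _ "[]"]) auto

lemma is_gen_polynomial_add:
  assumes "is_gen_polynomial N K g" "is_gen_polynomial N K' g'"
  shows "is_gen_polynomial N (K + K') (\<lambda>x y z. g x y z + g' x y z)"
proof -
  obtain ts where ts: "set ts \<subseteq> gen_monomials" "real (length ts) \<le> K"
    "\<forall>x\<in>{0..int N - 1}. \<forall>y\<in>{0..int N - 1}. \<forall>z\<in>{0..int N - 1}. g x y z = (\<Sum>t\<leftarrow>ts. t x y z)"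
    using assms(1) unfolding is_gen_polynomial_def by (elim exE conjE)
  obtain ts' where ts': "set ts' \<subseteq> gen_monomials" "real (length ts') \<le> K'"
    "\<forall>x\<in>{0..int N - 1}. \<forall>y\<in>{0..int N - 1}. \<forall>z\<in>{0..int N - 1}. g' x y z = (\<Sum>t\<leftarrow>ts'. t x y z)"
    using assms(2) unfolding is_gen_polynomial_def by (elim exE conjE)
  show ?thesis unfolding is_gen_polynomial_def
    by (rule exI[of _ "ts @ ts'"]) (use ts ts' in simp)
qed

lemma is_gen_polynomial_sum:
  assumes "\<And>i. i < n \<Longrightarrow> is_gen_polynomial N K (g i)"
  shows "is_gen_polynomial N (real n * K) (\<lambda>x y z. \<Sum>i<n. g i x y z)"
  using assms
proof (induction n)
  case (Suc n)
  then have "is_gen_polynomial N (real n * K + K) (\<lambda>x y z. (\<Sum>i<n. g i x y z) + g n x y z)"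
    by (intro is_gen_polynomial_add) auto
  then show ?case by (simp add: algebra_simps)
qed (simp add: is_gen_polynomial_zero)

text \<open>The term with \<open>cfrac \<gamma>\<close> merges with the leading one into the
  coefficient \<open>\<gamma> - cfrac \<gamma>\<close>. This leaves four monomials, two with
  separate brackets in \<open>x\<close> and \<open>y\<close> and two with nested brackets; 5 is a
  rounded count.\<close>

lemma is_gen_polynomial_bracket_term:
  "is_gen_polynomial N 5 (\<lambda>x y z. mod1 ((\<gamma> * br N f x * br N h y - bracket_product_frac N \<gamma> f h x y)
     * (of_int l / of_nat N) * of_int z))"
proof -
  let ?F = "\<lambda>h. real_of_int h / of_nat N"
  define a1 where "a1 = (\<lambda>x y z. mod1 (cfrac (?F f * real_of_int x) * cfrac (?F h * real_of_int y) * ((\<gamma> - cfrac \<gamma>) * ?F l) * real_of_int z))"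
  define a2 where "a2 = (\<lambda>x y z. mod1 (cfrac (?F (int_part \<gamma> * f) * real_of_int x) * cfrac (?F h * real_of_int y) * (- ?F l) * real_of_int z))"
  define a3 where "a3 = (\<lambda>x y z. mod1 (cfrac (cfrac (?F f * real_of_int x) * ?F (int_part \<gamma> * h) * real_of_int y) * (- ?F l) * real_of_int z))"
  define a4 where "a4 = (\<lambda>x y z. mod1 (cfrac (cfrac (?F (int_part \<gamma> * f) * real_of_int x) * ?F h * real_of_int y) * ?F l * real_of_int z))"
  have "is_gen_polynomial N (1 + (1 + (1 + 1))) (\<lambda>x y z. a1 x y z + (a2 x y z + (a3 x y z + a4 x y z)))"
    unfolding a1_def a2_def a3_def a4_def
    by (intro is_gen_polynomial_add is_gen_polynomial_monomial gen_monomials.intros)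
  moreover have "mod1 ((\<gamma> * br N f x * br N h y - bracket_product_frac N \<gamma> f h x y) * (of_int l / of_nat N) * of_int z)
     = a1 x y z + (a2 x y z + (a3 x y z + a4 x y z))" for x y z
    unfolding a1_def a2_def a3_def a4_def mod1_add[symmetric] bracket_product_frac_def br_def
    by (rule arg_cong[of _ _ mod1]) (simp add: algebra_simps add_divide_distrib diff_divide_distrib)
  ultimately show ?thesis by (simp add: is_gen_polynomial_mono)
qed

section \<open>Freiman-linearity of integer parts and the bilinear Bohr variety\<close>

text \<open>The two sums agree modulo 1, and four values below 1/4 leave no room for a nonzero
  integer difference.\<close>

lemma br_add_eq:
  assumes N: "0 < N" and S: "\<And>u. u \<in> {a, b, c, d} \<Longrightarrow> \<bar>br N f u\<bar> \<le> \<sigma>" and \<sigma>: "\<sigma> < 1 / 4"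
    and eq: "(a + b) mod int N = (c + d) mod int N"
  shows "br N f a + br N f b = br N f c + br N f d"
proof -
  have "mod1 (br N f u + br N f v) = mod1 (of_int f / of_nat N * of_int ((u + v) mod int N))" for u v
    by (simp only: mod1_cong_mod[OF N] mod1_add mod1_br of_int_add distrib_left)
  then have "mod1 (br N f a + br N f b) = mod1 (br N f c + br N f d)" using eq by simp
  then have "br N f a + br N f b - (br N f c + br N f d) \<in> \<int>" by (simp only: mod1_eq_iff)
  moreover have "\<bar>br N f a + br N f b - (br N f c + br N f d)\<bar> < 1"
    using S[of a] S[of b] S[of c] S[of d] \<sigma> by simp
  ultimately show ?thesis using Ints_nonzero_abs_less1 by fastforce
qed

text \<open>Both \<open>br N f\<close> and \<open>br N (h * f)\<close> are additive as real
  functions on \<open>S\<close>, hence so is \<open>brk N h f\<close>, an integer combination of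
  them. The frequencies then add exactly, and so do the characters.\<close>

lemma freiman_linear_brk:
  assumes N: "0 < N" and S: "S \<subseteq> {0..int N - 1}" "0 \<in> S" and \<sigma>: "\<sigma> < 1 / 4"
    and f: "\<And>a. a \<in> S \<Longrightarrow> \<bar>br N f a\<bar> \<le> \<sigma>" "\<And>a. a \<in> S \<Longrightarrow> \<bar>br N (h * f) a\<bar> \<le> \<sigma>"
  shows "freiman_linear (residue_ring (int N)) S (\<lambda>a. chr N (brk N h f a))"
proof -
  have chr_add: "chr N u x + chr N v x = mod1 (of_int (u + v) / of_nat N * of_int x)"
    if "x \<in> {0..int N - 1}" for u v x
    using that by (simp add: chr_def distrib_right add_divide_distrib flip: mod1_add)
  have zero: "chr N (brk N h f 0) x = 0" if "x \<in> {0..int N - 1}" for x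
    using that of_int_brk[of N h f 0] by (simp add: chr_def)
  have add: "chr N (brk N h f a) x + chr N (brk N h f b) x = chr N (brk N h f c) x + chr N (brk N h f d) x"
    if S: "a \<in> S" "b \<in> S" "c \<in> S" "d \<in> S" and eq: "(a + b) mod int N = (c + d) mod int N"
      and x: "x \<in> {0..int N - 1}" for a b c d x
  proof -
    have "br N f a + br N f b = br N f c + br N f d"
      by (rule br_add_eq[OF N _ \<sigma> eq]) (use S f in auto)
    moreover have "br N (h * f) a + br N (h * f) b = br N (h * f) c + br N (h * f) d"
      by (rule br_add_eq[OF N _ \<sigma> eq]) (use S f in auto)
    ultimately have "real_of_int (brk N h f a + brk N h f b) = of_int (brk N h f c + brk N h f d)"
      unfolding of_int_add of_int_brk by (smt (verit) distrib_left)
    then show ?thesis by (simp only: chr_add[OF x])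
  qed
  show ?thesis
    unfolding freiman_linear_def carrier_residue_ring zero_residue_ring add_residue_ring
    by (intro conjI ballI impI S zero add chr_dual[OF N])
qed

text \<open>Only the rounding in \<open>z\<close> produces an error, at most \<sigma> for each of
  the D frequencies; the rewriting of the fractional parts is exact on \<open>W\<close>. The
  condition on \<sigma> says that D^2 terms of size 6\<sigma> stay below 1/2.\<close>

theorem real_trilinear_eq_gen_polynomial:
  fixes \<xi> :: "nat \<Rightarrow> int" and \<gamma> :: "nat \<Rightarrow> nat \<Rightarrow> nat \<Rightarrow> real"
  assumes N: "0 < N" and D: "0 < D" and \<sigma>: "0 < \<sigma>" "12 * real D ^ 2 * \<sigma> < 1"
  defines "X \<equiv> {x \<in> {0..int N - 1}. \<forall>j<D. \<bar>br N (\<xi> j) x\<bar> \<le> \<sigma>}"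
  shows "\<exists>g W. is_gen_polynomial N (5 * real D ^ 3) g \<and>
    is_bilinear_bohr_variety (residue_ring (int N)) (3 * real D ^ 3) \<sigma> W \<and> W \<subseteq> X \<times> X \<and>
    (\<forall>(x, y)\<in>W. \<forall>z\<in>X. circle_norm
      (mod1 (\<Sum>j<D. br N (\<xi> j) x * (\<Sum>k<D. br N (\<xi> k) y * (\<Sum>l<D. br N (\<xi> l) z * \<gamma> j k l))) - g x y z) \<le> real D * \<sigma>)"
proof -
  let ?G = "residue_ring (int N)"
  have D1: "1 \<le> real D ^ 2" using D by simp
  then have "12 * 1 * \<sigma> \<le> 12 * real D ^ 2 * \<sigma>" using \<sigma>(1) by (intro mult_right_mono mult_left_mono) auto
  then have \<sigma>12: "\<sigma> < 1 / 12" using \<sigma>(2) by simp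
  define p where "p j k l = int_part (\<gamma> j k l)" for j k l
  define I where "I = {..<D} \<times> {..<D} \<times> {..<D}"
  \<comment> \<open>The frequencies in \<open>x\<close> on which Freiman-linearity of both kinds of
    integer part depends: each kind needs its inner frequency and the full product to be small. The
    first set also keeps \<open>x\<close> in \<open>X\<close>.\<close>
  define H where "H = \<xi> ` {..<D} \<union> (\<lambda>(j, k, l). p j k l * \<xi> j) ` I \<union> (\<lambda>(j, k, l). \<xi> k * (p j k l * \<xi> j)) ` I"
  \<comment> \<open>The Boolean tells apart the two brackets of \<open>bracket_product_frac\<close>,
    so each triple gives two bilinear conditions.\<close>
  define h where "h = (\<lambda>((j, k, l), b) x. if b then brk N (p j k l * \<xi> k) (\<xi> j) x else brk N (\<xi> k) (p j k l * \<xi> j) x)"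
  define J where "J = I \<times> (UNIV :: bool set)"
  have cI: "finite I" "card I = D ^ 3" by (auto simp: I_def power3_eq_cube)
  have cJ: "finite J" "card J = 2 * D ^ 3" using cI by (auto simp: J_def)
  obtain e where e: "bij_betw e {..<2 * D ^ 3} J"
    using ex_bij_betw_nat_finite[OF cJ(1)] cJ(2) by (metis atLeast0LessThan)
  then have eJ: "e ` {..<2 * D ^ 3} = J" by (simp add: bij_betw_def)
  have D3: "real D \<le> real D ^ 3" using D self_le_power[of "real D" 3] by simp
  have cH: "finite H" "real (card H) \<le> 3 * real D ^ 3"
  proof -
    show "finite H" using cI by (simp add: H_def)
    have "card H \<le> card (\<xi> ` {..<D}) + card ((\<lambda>(j, k, l). p j k l * \<xi> j) ` I) + card ((\<lambda>(j, k, l). \<xi> k * (p j k l * \<xi> j)) ` I)"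
      unfolding H_def by (meson card_Un_le add_le_mono order_refl order_trans)
    also have "\<dots> \<le> D + D ^ 3 + D ^ 3"
      using card_image_le[OF cI(1), of "\<lambda>(j, k, l). p j k l * \<xi> j"]
        card_image_le[OF cI(1), of "\<lambda>(j, k, l). \<xi> k * (p j k l * \<xi> j)"]
        card_image_le[of "{..<D}" \<xi>] unfolding cI(2) by (intro add_mono) simp_all
    finally have "real (card H) \<le> real (D + D ^ 3 + D ^ 3)" by (simp only: of_nat_le_iff)
    moreover have "real (D + D ^ 3 + D ^ 3) = real D + 2 * real D ^ 3" by simp
    ultimately show "real (card H) \<le> 3 * real D ^ 3" using D3 by linarith
  qed
  let ?\<Gamma>1 = "chr N ` H" and ?\<Gamma>2 = "chr N ` \<xi> ` {..<D}"
  \<comment> \<open>The variety is of the kind with exchanged roles: the characters depend on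
    \<open>x\<close> and constrain \<open>y\<close>.\<close>
  define W where "W = {(x, y). x \<in> bohr ?G ?\<Gamma>1 \<sigma> \<and> y \<in> bohr ?G ?\<Gamma>2 \<sigma> \<and>
     y \<in> bohr ?G ((\<lambda>i. chr N (h (e i) x)) ` {..<2 * D ^ 3}) \<sigma>}"
  have B1: "bohr ?G ?\<Gamma>1 \<sigma> = {x \<in> {0..int N - 1}. \<forall>f\<in>H. \<bar>br N f x\<bar> \<le> \<sigma>}" by (rule bohr_chr)
  have B2: "bohr ?G ?\<Gamma>2 \<sigma> = X" unfolding bohr_chr X_def by auto
  have B3: "bohr ?G ((\<lambda>i. chr N (h (e i) x)) ` {..<2 * D ^ 3}) \<sigma>
     = {y \<in> {0..int N - 1}. \<forall>i\<in>J. \<bar>br N (h i x) y\<bar> \<le> \<sigma>}" for x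
  proof -
    have "(\<lambda>i. chr N (h (e i) x)) ` {..<2 * D ^ 3} = chr N ` (\<lambda>i. h i x) ` J"
      unfolding eJ[symmetric] by (simp add: image_image)
    then show ?thesis by (simp add: bohr_chr)
  qed
  have fr: "freiman_linear ?G (bohr ?G ?\<Gamma>1 \<sigma>) (\<lambda>x. chr N (h i x))" if "i \<in> J" for i
  proof -
    obtain j k l b where i: "i = ((j, k, l), b)" by (metis surj_pair)
    then have jkl: "(j, k, l) \<in> I" using that by (simp add: J_def)
    have jH: "\<xi> j \<in> H" "p j k l * \<xi> j \<in> H" "\<xi> k * (p j k l * \<xi> j) \<in> H"
      using jkl unfolding H_def by (force simp: I_def)+
    have "0 \<in> bohr ?G ?\<Gamma>1 \<sigma>" using N \<sigma> by (simp add: B1)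
    moreover have "bohr ?G ?\<Gamma>1 \<sigma> \<subseteq> {0..int N - 1}" unfolding B1 by blast
    moreover have "\<sigma> < 1 / 4" using \<sigma>12 by simp
    moreover have "\<bar>br N f x\<bar> \<le> \<sigma>" if "f \<in> H" "x \<in> bohr ?G ?\<Gamma>1 \<sigma>" for f x using that unfolding B1 by blast
    moreover have "p j k l * \<xi> k * \<xi> j \<in> H" using jH(3) by (simp add: ac_simps)
    ultimately show ?thesis unfolding i h_def using jH N
      by (cases b) (auto intro!: freiman_linear_brk[where \<sigma> = \<sigma>])
  qed
  have var: "is_bilinear_bohr_variety ?G (3 * real D ^ 3) \<sigma> W"
    unfolding is_bilinear_bohr_variety_def
  proof (rule conjI[rotated], rule conjI[rotated], rule exI[of _ ?\<Gamma>1], rule exI[of _ ?\<Gamma>2],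
      rule exI[of _ "2 * D ^ 3"], rule exI[of _ "\<lambda>i x. chr N (h (e i) x)"], intro conjI disjI2)
    show "?\<Gamma>1 \<subseteq> dual ?G" "?\<Gamma>2 \<subseteq> dual ?G" using chr_dual[OF N] by blast+
    show "finite ?\<Gamma>1" "finite ?\<Gamma>2" using cH by auto
    show "real (card ?\<Gamma>1) \<le> 3 * real D ^ 3"
      using card_image_le[OF cH(1), of "chr N"] cH(2) by linarith
    have "card ?\<Gamma>2 \<le> D" unfolding image_image using card_image_le[of "{..<D}" "\<lambda>x. chr N (\<xi> x)"] by simp
    then have "real (card ?\<Gamma>2) \<le> real D" by simp
    then show "real (card ?\<Gamma>2) \<le> 3 * real D ^ 3" using D3 by linarith
    show "real (2 * D ^ 3) \<le> 3 * real D ^ 3" by simp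
    show "\<forall>i<2 * D ^ 3. freiman_linear ?G (bohr ?G ?\<Gamma>1 \<sigma>) (\<lambda>x. chr N (h (e i) x))"
      using fr eJ by blast
    show "W = {(x, y). x \<in> bohr ?G ?\<Gamma>1 \<sigma> \<and> y \<in> bohr ?G ?\<Gamma>2 \<sigma> \<and>
       y \<in> bohr ?G ((\<lambda>i. chr N (h (e i) x)) ` {..<2 * D ^ 3}) \<sigma>}" by (rule W_def)
  qed (use \<sigma> \<sigma>12 in auto)
  have sub: "W \<subseteq> X \<times> X"
    unfolding W_def B1 B2 by (auto simp: X_def H_def)
  define E where "E j k l x y = bracket_product_frac N (\<gamma> j k l) (\<xi> j) (\<xi> k) x y" for j k l x y
  define g where "g x y z = (\<Sum>l<D. \<Sum>j<D. \<Sum>k<D.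
    mod1 ((\<gamma> j k l * br N (\<xi> j) x * br N (\<xi> k) y - E j k l x y) * (of_int (\<xi> l) / of_nat N) * of_int z))" for x y z
  have poly: "is_gen_polynomial N (5 * real D ^ 3) g"
  proof -
    have "is_gen_polynomial N (real D * (real D * (real D * 5))) g"
      unfolding g_def E_def by (intro is_gen_polynomial_sum is_gen_polynomial_bracket_term)
    then show ?thesis by (simp add: power3_eq_cube ac_simps)
  qed
  have "circle_norm (mod1 (\<Sum>j<D. br N (\<xi> j) x * (\<Sum>k<D. br N (\<xi> k) y * (\<Sum>l<D. br N (\<xi> l) z * \<gamma> j k l))) - g x y z)
      \<le> real D * \<sigma>" if xy: "(x, y) \<in> W" and z: "z \<in> X" for x y z
  proof -
    define t where "t l = (\<Sum>j<D. \<Sum>k<D. \<gamma> j k l * br N (\<xi> j) x * br N (\<xi> k) y)" for l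
    have x: "\<And>f. f \<in> H \<Longrightarrow> \<bar>br N f x\<bar> \<le> \<sigma>" and y: "y \<in> X" and y0: "y \<in> {0..int N - 1}"
      and hy: "\<And>i. i \<in> J \<Longrightarrow> \<bar>br N (h i x) y\<bar> \<le> \<sigma>"
      using xy unfolding W_def B1 B2 B3 by blast+
    have E: "\<bar>E j k l x y\<bar> \<le> 6 * \<sigma>" if "j < D" "k < D" "l < D" for j k l
      unfolding E_def
    proof (rule bracket_product_frac_le[OF y0])
      have jkl: "(j, k, l) \<in> I" using that by (simp add: I_def)
      show "\<bar>br N (\<xi> k) y\<bar> \<le> \<sigma>" using y that by (simp add: X_def)
      show "\<bar>br N (\<xi> k * (int_part (\<gamma> j k l) * \<xi> j)) x\<bar> \<le> \<sigma>"
        by (rule x) (use jkl in \<open>force simp: H_def p_def\<close>)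
      show "\<bar>br N (brk N (int_part (\<gamma> j k l) * \<xi> k) (\<xi> j) x) y\<bar> \<le> \<sigma>"
        using hy[of "((j, k, l), True)"] jkl by (simp add: J_def h_def p_def)
      show "\<bar>br N (brk N (\<xi> k) (int_part (\<gamma> j k l) * \<xi> j) x) y\<bar> \<le> \<sigma>"
        using hy[of "((j, k, l), False)"] jkl by (simp add: J_def h_def p_def)
    qed
    \<comment> \<open>No carry: the sum is congruent to \<open>t l\<close> modulo 1 and smaller than
      1/2, so it is the fractional part itself.\<close>
    have ct: "cfrac (t l) = (\<Sum>j<D. \<Sum>k<D. E j k l x y)" if "l < D" for l
    proof (rule cfrac_eqI)
      show "mod1 (t l) = mod1 (\<Sum>j<D. \<Sum>k<D. E j k l x y)"
        by (simp add: t_def mod1_sum E_def mod1_bracket_product_frac)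
      have "\<bar>\<Sum>j<D. \<Sum>k<D. E j k l x y\<bar> \<le> (\<Sum>j<D. \<Sum>k<D. \<bar>E j k l x y\<bar>)"
        by (intro order_trans[OF sum_abs] sum_mono order_refl)
      also have "\<dots> \<le> (\<Sum>j<D. \<Sum>k<D. 6 * \<sigma>)" using E that by (intro sum_mono) auto
      also have "\<dots> = 6 * real D ^ 2 * \<sigma>" by (simp add: power2_eq_square)
      finally show "\<bar>\<Sum>j<D. \<Sum>k<D. E j k l x y\<bar> < 1 / 2" using \<sigma>(2) by linarith
    qed
    have T: "(\<Sum>j<D. br N (\<xi> j) x * (\<Sum>k<D. br N (\<xi> k) y * (\<Sum>l<D. br N (\<xi> l) z * \<gamma> j k l))) = (\<Sum>l<D. t l * br N (\<xi> l) z)"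
    proof -
      have "(\<Sum>l<D. t l * br N (\<xi> l) z) = (\<Sum>l<D. \<Sum>j<D. \<Sum>k<D. br N (\<xi> j) x * (br N (\<xi> k) y * (br N (\<xi> l) z * \<gamma> j k l)))"
        unfolding t_def sum_distrib_right by (simp add: ac_simps)
      also have "\<dots> = (\<Sum>j<D. \<Sum>l<D. \<Sum>k<D. br N (\<xi> j) x * (br N (\<xi> k) y * (br N (\<xi> l) z * \<gamma> j k l)))"
        by (rule sum.swap)
      also have "\<dots> = (\<Sum>j<D. \<Sum>k<D. \<Sum>l<D. br N (\<xi> j) x * (br N (\<xi> k) y * (br N (\<xi> l) z * \<gamma> j k l)))"
        by (intro sum.cong refl sum.swap)
      finally show ?thesis by (simp add: sum_distrib_left)
    qed
    have g: "g x y z = (\<Sum>l<D. mod1 ((t l - cfrac (t l)) * (of_int (\<xi> l) / of_nat N * of_int z)))"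
      unfolding g_def
    proof (intro sum.cong refl)
      fix l assume l: "l \<in> {..<D}"
      have "t l - cfrac (t l) = (\<Sum>j<D. \<Sum>k<D. \<gamma> j k l * br N (\<xi> j) x * br N (\<xi> k) y - E j k l x y)"
        using ct l by (simp add: t_def sum_subtractf)
      then show "(\<Sum>j<D. \<Sum>k<D. mod1 ((\<gamma> j k l * br N (\<xi> j) x * br N (\<xi> k) y - E j k l x y) * (of_int (\<xi> l) / of_nat N) * of_int z))
        = mod1 ((t l - cfrac (t l)) * (of_int (\<xi> l) / of_nat N * of_int z))"
        by (simp only: mod1_sum sum_distrib_right mult.assoc)
    qed
    have l: "circle_norm (mod1 (t l * br N (\<xi> l) z) - mod1 ((t l - cfrac (t l)) * (of_int (\<xi> l) / of_nat N * of_int z))) \<le> \<sigma>"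
      if "l < D" for l
    proof -
      have "mod1 (t l * br N (\<xi> l) z) = mod1 (of_int (int_part (t l)) * br N (\<xi> l) z) + mod1 (cfrac (t l) * br N (\<xi> l) z)"
        unfolding mod1_add[symmetric] of_int_int_part by (simp add: algebra_simps)
      then have "mod1 (t l * br N (\<xi> l) z) - mod1 ((t l - cfrac (t l)) * (of_int (\<xi> l) / of_nat N * of_int z)) = mod1 (cfrac (t l) * br N (\<xi> l) z)"
        unfolding mod1_int_mult_br by (simp add: of_int_int_part)
      moreover have "\<bar>cfrac (t l) * br N (\<xi> l) z\<bar> \<le> 1 * \<sigma>"
        unfolding abs_mult using cfrac_bounds[of "t l"] z that \<sigma> by (intro mult_mono) (auto simp: X_def)
      ultimately show ?thesis using znorm_le_abs[of "cfrac (t l) * br N (\<xi> l) z"] by simp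
    qed
    have "circle_norm ((\<Sum>l<D. mod1 (t l * br N (\<xi> l) z)) - g x y z) \<le> (\<Sum>l<D. \<sigma>)"
      unfolding g using l by (intro order_trans[OF circle_norm_diff_sum] sum_mono) auto
    then show ?thesis unfolding T by (simp add: mod1_sum)
  qed
  then show ?thesis using poly var sub by blast
qed


section \<open>Choice of the parameters\<close>

lemma approx_trilinear_subset:
  "approx_trilinear G B \<epsilon> \<phi> \<Longrightarrow> B' \<subseteq> B \<Longrightarrow> approx_trilinear G B' \<epsilon> \<phi>"
  unfolding approx_trilinear_def approx_linear_def by blast

text \<open>Extended periodically to the integers, \<phi> is defined on a box containing all
  representatives, and one application of the box estimate yields a single monomial.\<close>

lemma approx_trilinear_full_group:
  assumes N: "0 < N" and \<phi>: "approx_trilinear (residue_ring (int N)) {0..int N - 1} \<epsilon> \<phi>"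
  shows "\<exists>g. is_gen_polynomial N 1 g \<and>
    (\<forall>x\<in>{0..int N - 1}. \<forall>y\<in>{0..int N - 1}. \<forall>z\<in>{0..int N - 1}. circle_norm (\<phi> x y z - g x y z) \<le> 1365 * \<epsilon>)"
proof -
  let ?G = "residue_ring (int N)"
  let ?m = "\<lambda>x. x mod int N"
  obtain rep where rep: "\<And>t. mod1 (rep t) = t" using mod1_surj by metis
  define F where "F a b c = rep (\<phi> (?m a) (?m b) (?m c))" for a b c
  have modF: "mod1 (F a b c) = \<phi> (?m a) (?m b) (?m c)" for a b c by (simp add: F_def rep)
  have mB: "?m a \<in> {0..int N - 1}" for a using N pos_mod_bound[of "int N" a] by simp
  have lin: "approx_linear ?G {0..int N - 1} \<epsilon> (\<lambda>u. \<phi> u a b)"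
    "approx_linear ?G {0..int N - 1} \<epsilon> (\<lambda>u. \<phi> a u b)"
    "approx_linear ?G {0..int N - 1} \<epsilon> (\<lambda>u. \<phi> a b u)"
    if "a \<in> {0..int N - 1}" "b \<in> {0..int N - 1}" for a b
    using \<phi> that unfolding approx_trilinear_def by blast+
  have add: "circle_norm (\<psi> (?m (u + v)) - \<psi> (?m u) - \<psi> (?m v)) \<le> \<epsilon>"
    if "approx_linear ?G {0..int N - 1} \<epsilon> \<psi>" for \<psi> u v
  proof -
    have "?m (u + v) = ?m u \<oplus>\<^bsub>?G\<^esub> ?m v" by (simp add: add_residue_ring mod_add_eq)
    then show ?thesis using that mB[of u] mB[of v] mB[of "u + v"] unfolding approx_linear_def by metis
  qed
  have "\<exists>\<theta>. \<forall>a b c. \<bar>a\<bar> \<le> int N \<longrightarrow> \<bar>b\<bar> \<le> int N \<longrightarrow> \<bar>c\<bar> \<le> int N \<longrightarrow>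
      znorm (F a b c - of_int a * of_int b * of_int c * \<theta>) \<le> 1365 * \<epsilon>"
  proof (rule circle_almost_trilinear_box; unfold mod1_diff modF)
    fix a b c u v :: int
    show "circle_norm (\<phi> (?m (u + v)) (?m b) (?m c) - \<phi> (?m u) (?m b) (?m c) - \<phi> (?m v) (?m b) (?m c)) \<le> \<epsilon>"
      by (rule add[OF lin(1)[OF mB mB]])
    show "circle_norm (\<phi> (?m a) (?m (u + v)) (?m c) - \<phi> (?m a) (?m u) (?m c) - \<phi> (?m a) (?m v) (?m c)) \<le> \<epsilon>"
      by (rule add[OF lin(2)[OF mB mB]])
    show "circle_norm (\<phi> (?m a) (?m b) (?m (u + v)) - \<phi> (?m a) (?m b) (?m u) - \<phi> (?m a) (?m b) (?m v)) \<le> \<epsilon>"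
      by (rule add[OF lin(3)[OF mB mB]])
  qed
  then obtain \<theta> where \<theta>: "\<And>a b c. \<bar>a\<bar> \<le> int N \<Longrightarrow> \<bar>b\<bar> \<le> int N \<Longrightarrow> \<bar>c\<bar> \<le> int N \<Longrightarrow>
      znorm (F a b c - of_int a * of_int b * of_int c * \<theta>) \<le> 1365 * \<epsilon>"
    by blast
  define g where "g = (\<lambda>x y z. mod1 (\<theta> * real_of_int x * real_of_int y * real_of_int z))"
  have "is_gen_polynomial N 1 g"
    unfolding g_def by (intro is_gen_polynomial_monomial gen_monomials.intros)
  moreover have "circle_norm (\<phi> x y z - g x y z) \<le> 1365 * \<epsilon>"
    if "x \<in> {0..int N - 1}" "y \<in> {0..int N - 1}" "z \<in> {0..int N - 1}" for x y z
  proof -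
    have m: "?m x = x" "?m y = y" "?m z = z" using that by auto
    have "\<bar>x\<bar> \<le> int N" "\<bar>y\<bar> \<le> int N" "\<bar>z\<bar> \<le> int N" using that by auto
    then have "znorm (F x y z - of_int x * of_int y * of_int z * \<theta>) \<le> 1365 * \<epsilon>" by (rule \<theta>)
    moreover have "mod1 (of_int x * of_int y * of_int z * \<theta>) = g x y z"
      unfolding g_def by (rule arg_cong[of _ _ mod1]) simp
    ultimately show ?thesis by (simp only: mod1_diff modF m)
  qed
  ultimately show ?thesis by blast
qed

text \<open>Index 0 is reserved for the identity frequency, hence d + 1 indices.\<close>

lemma enumerate_characters:
  assumes N: "2 \<le> N" and \<Gamma>: "\<Gamma> \<subseteq> dual (residue_ring (int N))" "finite \<Gamma>" "card \<Gamma> = d"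
  shows "\<exists>\<xi> :: nat \<Rightarrow> int. \<xi> 0 = 1 \<and> \<Gamma> \<subseteq> chr N ` \<xi> ` {..<d + 1}"
proof -
  obtain e where e: "bij_betw e {..<d} \<Gamma>"
    using ex_bij_betw_nat_finite[OF \<Gamma>(2)] \<Gamma>(3) by (metis atLeast0LessThan)
  then have e\<Gamma>: "e ` {..<d} = \<Gamma>" by (simp add: bij_betw_def)
  have "\<forall>i<d. \<exists>h. e i = chr N h" using e\<Gamma> \<Gamma>(1) dual_imp_chr[OF N] by blast
  then obtain h where h: "\<And>i. i < d \<Longrightarrow> e i = chr N (h i)" by metis
  define \<xi> where "\<xi> i = (case i of 0 \<Rightarrow> 1 | Suc i \<Rightarrow> h i)" for i
  have "\<Gamma> \<subseteq> chr N ` \<xi> ` {..<d + 1}"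
  proof
    fix \<chi> assume "\<chi> \<in> \<Gamma>"
    then obtain i where i: "i < d" "\<chi> = e i" using e\<Gamma> by blast
    then have "\<chi> = chr N (\<xi> (Suc i))" by (simp add: \<xi>_def h)
    moreover have "Suc i \<in> {..<d + 1}" using i by simp
    ultimately show "\<chi> \<in> chr N ` \<xi> ` {..<d + 1}" by (simp only: imageI)
  qed
  moreover have "\<xi> 0 = 1" by (simp add: \<xi>_def)
  ultimately show ?thesis by blast
qed

text \<open>With K = 4^D D!, this \<sigma> satisfies three demands at once: K D^2 \<sigma> \<le>
  \<rho> for the boxes, 12 D^2 \<sigma> < 1 against carries, and D \<sigma> \<le> \<epsilon>, by
  which the bracket error is absorbed into the error of the trilinear approximation.\<close>

theorem approx_trilinear_bohr:
  assumes N: "2 \<le> N" and \<Gamma>: "\<Gamma> \<subseteq> dual (residue_ring (int N))" "finite \<Gamma>" "card \<Gamma> = d"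
    and \<rho>: "0 < \<rho>" "\<rho> < 1" and \<epsilon>: "0 < \<epsilon>" "\<epsilon> < 1"
    and \<phi>: "approx_trilinear (residue_ring (int N)) (bohr (residue_ring (int N)) \<Gamma> \<rho>) \<epsilon> \<phi>"
  defines "D \<equiv> d + 1"
  defines "\<sigma> \<equiv> \<rho> * \<epsilon> / (24 * real D ^ 2 * (4 ^ D * fact D))"
  shows "\<exists>g W B'. is_gen_polynomial N (5 * real D ^ 3) g \<and>
    is_bilinear_bohr_variety (residue_ring (int N)) (3 * real D ^ 3) \<sigma> W \<and>
    W \<subseteq> bohr (residue_ring (int N)) \<Gamma> \<rho> \<times> bohr (residue_ring (int N)) \<Gamma> \<rho> \<and>
    is_bohr_set (residue_ring (int N)) (real D) \<sigma> B' \<and> B' \<subseteq> bohr (residue_ring (int N)) \<Gamma> \<rho> \<and>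
    (\<forall>(x, y)\<in>W. \<forall>z\<in>B'. circle_norm (\<phi> x y z - g x y z) \<le> 1372 * real D ^ 3 * \<epsilon>)"
proof -
  let ?G = "residue_ring (int N)"
  obtain \<xi> where \<xi>: "\<xi> 0 = 1" "\<Gamma> \<subseteq> chr N ` \<xi> ` {..<D}"
    using enumerate_characters[OF N \<Gamma>] unfolding D_def by blast
  define K where "K = (4 ^ D * fact D :: real)"
  have K: "1 \<le> K" unfolding K_def using mult_mono[of 1 "4 ^ D" 1 "fact D :: real"] by (simp add: fact_ge_1)
  have D: "0 < D" "1 \<le> real D" by (auto simp: D_def)
  have D2: "1 \<le> real D ^ 2" using D by simp
  have \<sigma>K: "24 * (real D ^ 2 * K * \<sigma>) = \<rho> * \<epsilon>" using K D by (simp add: \<sigma>_def flip: K_def)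
  have \<sigma>0: "0 < \<sigma>" unfolding \<sigma>_def K_def[symmetric] using \<rho> \<epsilon> K D by simp
  have "\<rho> * \<epsilon> < \<rho> * 1" "\<rho> * \<epsilon> < 1 * \<epsilon>" using \<rho> \<epsilon> by (auto intro: mult_strict_left_mono mult_strict_right_mono)
  then have \<rho>\<epsilon>: "\<rho> * \<epsilon> < \<rho>" "\<rho> * \<epsilon> < \<epsilon>" by auto
  define s where "s = real D ^ 2 * \<sigma>"
  have s: "real D * \<sigma> \<le> s" "\<sigma> \<le> real D * \<sigma>" "1 * s \<le> K * s" "24 * (K * s) = \<rho> * \<epsilon>"
  proof -
    have "real D * 1 * \<sigma> \<le> real D * real D * \<sigma>"
      using D \<sigma>0 by (intro mult_right_mono mult_left_mono) auto
    then show "real D * \<sigma> \<le> s" by (simp only: s_def power2_eq_square mult_1_right)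
    have "1 * \<sigma> \<le> real D * \<sigma>" using D \<sigma>0 by (intro mult_right_mono) auto
    then show "\<sigma> \<le> real D * \<sigma>" by simp
    show "1 * s \<le> K * s" using K \<sigma>0 by (intro mult_right_mono) (auto simp: s_def)
    show "24 * (K * s) = \<rho> * \<epsilon>" using \<sigma>K by (simp add: s_def ac_simps)
  qed
  then have "K * s \<le> \<rho>" "12 * s < 1" and \<sigma>\<rho>: "\<sigma> \<le> \<rho>" "real D * \<sigma> \<le> \<epsilon>"
    using \<rho>\<epsilon> \<sigma>0 \<rho> \<epsilon> by linarith+
  then have K\<sigma>: "4 ^ D * fact D * real D ^ 2 * \<sigma> \<le> \<rho>" and \<sigma>12: "12 * real D ^ 2 * \<sigma> < 1"
    by (simp_all add: s_def K_def mult.assoc)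
  let ?B1 = "{x \<in> {0..int N - 1}. \<forall>j<D. \<bar>br N (\<xi> j) x\<bar> \<le> \<rho>}"
  let ?X = "{x \<in> {0..int N - 1}. \<forall>j<D. \<bar>br N (\<xi> j) x\<bar> \<le> \<sigma>}"
  have B1: "bohr ?G (chr N ` \<xi> ` {..<D}) t = {x \<in> {0..int N - 1}. \<forall>j<D. \<bar>br N (\<xi> j) x\<bar> \<le> t}" for t
    unfolding bohr_chr by auto
  have "bohr ?G (chr N ` \<xi> ` {..<D}) \<rho> \<subseteq> bohr ?G \<Gamma> \<rho>" using \<xi>(2) unfolding bohr_def by blast
  then have B1B: "?B1 \<subseteq> bohr ?G \<Gamma> \<rho>" unfolding B1 .
  have XB: "?X \<subseteq> bohr ?G \<Gamma> \<rho>" using B1B \<sigma>\<rho>(1) by fastforce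
  define A where "A = (real D + 1) * (1 + real D + real D ^ 2) + 1365 * real D ^ 3"
  have "0 < N" using N by simp
  from approx_trilinear_eq_real_trilinear[OF this D(1) \<xi>(1) \<sigma>0 K\<sigma> approx_trilinear_subset[OF \<phi> B1B]]
  obtain \<gamma> where \<gamma>: "\<forall>x\<in>?X. \<forall>y\<in>?X. \<forall>z\<in>?X.
      circle_norm (\<phi> x y z - mod1 (\<Sum>j<D. br N (\<xi> j) x * (\<Sum>k<D. br N (\<xi> k) y * (\<Sum>l<D. br N (\<xi> l) z * \<gamma> j k l)))) \<le> A * \<epsilon>"
    unfolding A_def by (elim exE)
  from real_trilinear_eq_gen_polynomial[OF \<open>0 < N\<close> D(1) \<sigma>0 \<sigma>12, of \<xi> \<gamma>]
  obtain g W where gW: "is_gen_polynomial N (5 * real D ^ 3) g \<and>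
    is_bilinear_bohr_variety ?G (3 * real D ^ 3) \<sigma> W \<and> W \<subseteq> ?X \<times> ?X \<and>
    (\<forall>(x, y)\<in>W. \<forall>z\<in>?X. circle_norm
      (mod1 (\<Sum>j<D. br N (\<xi> j) x * (\<Sum>k<D. br N (\<xi> k) y * (\<Sum>l<D. br N (\<xi> l) z * \<gamma> j k l))) - g x y z) \<le> real D * \<sigma>)"
    by (elim exE)
  then have g: "is_gen_polynomial N (5 * real D ^ 3) g"
    and W: "is_bilinear_bohr_variety ?G (3 * real D ^ 3) \<sigma> W" "W \<subseteq> ?X \<times> ?X" by blast+
  have bX: "is_bohr_set ?G (real D) \<sigma> ?X"
    unfolding is_bohr_set_def
  proof (intro conjI exI[of _ "chr N ` \<xi> ` {..<D}"])
    show "chr N ` \<xi> ` {..<D} \<subseteq> dual ?G" using chr_dual N by auto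
    have "card (chr N ` \<xi> ` {..<D}) \<le> D"
      unfolding image_image using card_image_le[of "{..<D}" "\<lambda>x. chr N (\<xi> x)"] by simp
    then show "real (card (chr N ` \<xi> ` {..<D})) \<le> real D" by simp
    show "?X = bohr ?G (chr N ` \<xi> ` {..<D}) \<sigma>" by (rule B1[symmetric])
  qed (use \<sigma>0 \<sigma>\<rho>(1) \<rho> in auto)
  \<comment> \<open>Expanding (D + 1)(1 + D + D^2) gives at most 6 D^3, and 1372 = 6 + 1365 + 1, the
    last unit being the bracket error.\<close>
  have A: "A + 1 \<le> 1372 * real D ^ 3"
  proof -
    have d: "real D ^ 2 \<le> real D ^ 3" "real D \<le> real D ^ 3" "1 \<le> real D ^ 3"
      using D power_increasing[of 2 3 "real D"] self_le_power[of "real D" 3] by auto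
    show ?thesis using d by (simp add: A_def algebra_simps power2_eq_square power3_eq_cube)
  qed
  have "circle_norm (\<phi> x y z - g x y z) \<le> 1372 * real D ^ 3 * \<epsilon>" if xy: "(x, y) \<in> W" and z: "z \<in> ?X" for x y z
  proof -
    let ?T = "mod1 (\<Sum>j<D. br N (\<xi> j) x * (\<Sum>k<D. br N (\<xi> k) y * (\<Sum>l<D. br N (\<xi> l) z * \<gamma> j k l)))"
    have "x \<in> ?X" "y \<in> ?X" using xy W(2) by blast+
    then have a: "circle_norm (\<phi> x y z - ?T) \<le> A * \<epsilon>" using \<gamma> z by blast
    from gW have "\<forall>(x, y)\<in>W. \<forall>z\<in>?X. circle_norm
      (mod1 (\<Sum>j<D. br N (\<xi> j) x * (\<Sum>k<D. br N (\<xi> k) y * (\<Sum>l<D. br N (\<xi> l) z * \<gamma> j k l))) - g x y z) \<le> real D * \<sigma>"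
      by (elim conjE)
    from bspec[OF this xy, unfolded prod.case] z have "circle_norm (?T - g x y z) \<le> real D * \<sigma>" by (rule bspec)
    with a have "circle_norm (\<phi> x y z - g x y z) \<le> A * \<epsilon> + real D * \<sigma>"
      using circle_norm_triangle[of "\<phi> x y z" "g x y z" ?T] by linarith
    also have "\<dots> \<le> (A + 1) * \<epsilon>" using \<sigma>\<rho>(2) by (simp add: algebra_simps)
    also have "\<dots> \<le> 1372 * real D ^ 3 * \<epsilon>" using A \<epsilon> by (intro mult_right_mono) auto
    finally show ?thesis .
  qed
  then have "\<forall>(x, y)\<in>W. \<forall>z\<in>?X. circle_norm (\<phi> x y z - g x y z) \<le> 1372 * real D ^ 3 * \<epsilon>" by blast
  have "W \<subseteq> bohr ?G \<Gamma> \<rho> \<times> bohr ?G \<Gamma> \<rho>" using W(2) XB by blast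
  show ?thesis
    by (rule exI[of _ g], rule exI[of _ W], rule exI[of _ ?X], intro conjI) fact+
qed

section \<open>Numerical bounds and the final choice of the constant\<close>

text \<open>The factor 2 is due to d = 2, where 8 = 2 * 4.\<close>

lemma cube_le_self_power: "1 \<le> d \<Longrightarrow> d ^ 3 \<le> 2 * d ^ d" for d :: nat
proof -
  assume "1 \<le> d"
  then consider "d = 1" | "d = 2" | "3 \<le> d" by linarith
  then show ?thesis
  proof cases
    case 3
    then have "d ^ 3 \<le> d ^ d" by (intro power_increasing) auto
    then show ?thesis by simp
  qed auto
qed

lemma self_le_exp: "x \<le> exp x" for x :: real
  using exp_ge_add_one_self[of x] by linarith

text \<open>Every factor of the inverse radius is bounded by an exponential. The exponents add up to
  24 + 7Y + Y^2, which for Y \<ge> 2 is at most 16 Y^2 \<le> Y^6.\<close>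

lemma radius_lower_bound:
  fixes Y :: real
  assumes Y: "2 \<le> Y" "real D \<le> Y" and D: "1 \<le> D" and \<rho>\<epsilon>: "0 < t" "ln (inverse t) \<le> Y"
  shows "exp (- (Y ^ 6)) \<le> t / (24 * real D ^ 2 * (4 ^ D * fact D))"
proof -
  have e24: "(24::real) \<le> exp 24" by (rule self_le_exp)
  have "real D ^ 2 \<le> exp (real D) ^ 2" by (intro power_mono self_le_exp) simp
  also have "\<dots> = exp (2 * real D)" by (simp flip: exp_of_nat_mult)
  also have "\<dots> \<le> exp (2 * Y)" using Y by simp
  finally have eD: "real D ^ 2 \<le> exp (2 * Y)" .
  have "(4::real) ^ D \<le> exp 4 ^ D" by (intro power_mono self_le_exp) simp
  also have "\<dots> = exp (real D * 4)" by (simp flip: exp_of_nat_mult)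
  also have "\<dots> \<le> exp (4 * Y)" using Y by simp
  finally have e4: "(4::real) ^ D \<le> exp (4 * Y)" .
  have "(fact D :: real) \<le> real D ^ D" using fact_le_power[of D, where 'a = real] by simp
  also have "\<dots> \<le> exp (real D) ^ D" by (intro power_mono self_le_exp) simp
  also have "\<dots> = exp (real D * real D)" by (simp flip: exp_of_nat_mult)
  also have "\<dots> \<le> exp (Y * Y)" using Y by (simp add: mult_mono)
  finally have ef: "(fact D :: real) \<le> exp (Y * Y)" .
  have "inverse t = exp (ln (inverse t))" using \<rho>\<epsilon> by simp
  also have "\<dots> \<le> exp Y" using \<rho>\<epsilon> by (simp only: exp_le_cancel_iff)
  finally have et: "inverse t \<le> exp Y" .
  have "24 * real D ^ 2 * (4 ^ D * fact D) * inverse t \<le> exp 24 * exp (2 * Y) * (exp (4 * Y) * exp (Y * Y)) * exp Y"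
    using \<rho>\<epsilon> by (intro mult_mono e24 eD e4 ef et) auto
  also have "\<dots> = exp (24 + 7 * Y + Y * Y)" by (simp flip: exp_add)
  also have "\<dots> \<le> exp (Y ^ 6)"
  proof -
    have Y2: "2 * 2 \<le> Y * Y" "2 * Y \<le> Y * Y" using Y mult_mono[of 2 Y 2 Y] by simp_all
    have "(2::real) ^ 4 \<le> Y ^ 4" using Y by (intro power_mono) auto
    then have "16 * (Y * Y) \<le> Y ^ 4 * (Y * Y)" by (intro mult_right_mono) auto
    also have "\<dots> = Y ^ 6" by (simp add: power_numeral_reduce)
    finally show ?thesis using Y2 by simp
  qed
  finally have "24 * real D ^ 2 * (4 ^ D * fact D) / t \<le> exp (Y ^ 6)" by (simp add: divide_inverse)
  then show ?thesis using \<rho>\<epsilon> D by (simp add: exp_minus field_simps)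
qed

lemma is_bilinear_bohr_variety_mono:
  "is_bilinear_bohr_variety G D \<sigma> W \<Longrightarrow> D \<le> D' \<Longrightarrow> is_bilinear_bohr_variety G D' \<sigma> W"
  unfolding is_bilinear_bohr_variety_def
  by (elim conj_forward ex_forward) (assumption | erule (1) order_trans)+

lemma is_bohr_set_mono: "is_bohr_set G D \<sigma> B \<Longrightarrow> D \<le> D' \<Longrightarrow> is_bohr_set G D' \<sigma> B"
  unfolding is_bohr_set_def
  by (elim conj_forward ex_forward) (assumption | erule (1) order_trans)+

lemma is_bilinear_bohr_variety_carrier: "is_bilinear_bohr_variety G 0 (1 / 2) (carrier G \<times> carrier G)"
  unfolding is_bilinear_bohr_variety_def
  by (rule conjI, simp, rule conjI, simp, rule exI[of _ "{}"], rule exI[of _ "{}"], rule exI[of _ 0])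
    (auto simp: bohr_def)

lemma is_bohr_set_carrier: "is_bohr_set G 0 (1 / 2) (carrier G)"
  unfolding is_bohr_set_def by (rule conjI, simp, rule conjI, simp, rule exI[of _ "{}"]) (auto simp: bohr_def)

theorem theoremC3:
  shows "\<exists>C::real. C > 0 \<and>
    (\<forall>(N::nat) (d::nat) (\<Gamma> :: (int \<Rightarrow> circle) set) (\<rho>::real) (\<epsilon>::real)
        (\<phi> :: int \<Rightarrow> int \<Rightarrow> int \<Rightarrow> circle) G B X.
      prime N \<longrightarrow>
      G = residue_ring (int N) \<longrightarrow>
      \<Gamma> \<subseteq> dual G \<longrightarrow> finite \<Gamma> \<longrightarrow> card \<Gamma> = d \<longrightarrow>
      0 < \<rho> \<longrightarrow> \<rho> < 1 \<longrightarrow>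
      B = bohr G \<Gamma> \<rho> \<longrightarrow>
      0 < \<epsilon> \<longrightarrow> \<epsilon> < 1 \<longrightarrow>
      approx_trilinear G B \<epsilon> \<phi> \<longrightarrow>
      X = 2 * real d * ln (inverse \<rho> * inverse \<epsilon>) \<longrightarrow>
      (\<exists>g W B' \<sigma> \<sigma>'.
        is_gen_polynomial N ((2 + X) powr C) g \<and>
        is_bilinear_bohr_variety G ((2 + X) powr C) \<sigma> W \<and> W \<subseteq> B \<times> B \<and>
        \<sigma> \<ge> exp (- ((2 + X) powr C)) \<and>
        is_bohr_set G ((2 + X) powr C) \<sigma>' B' \<and> B' \<subseteq> B \<and>
        \<sigma>' \<ge> exp (- ((2 + X) powr C)) \<and>
        (\<forall>(x, y)\<in>W. \<forall>z\<in>B'.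
          circle_norm (\<phi> x y z - g (\<iota> x) (\<iota> y) (\<iota> z)) \<le> C * (real d ^ d * sqrt \<epsilon>))))"
proof (rule exI[of _ 22000], intro conjI allI impI)
  fix N d :: nat and \<Gamma> :: "(int \<Rightarrow> circle) set" and \<rho> \<epsilon> :: real
    and \<phi> :: "int \<Rightarrow> int \<Rightarrow> int \<Rightarrow> circle" and G B X
  assume N: "prime N" and G: "G = residue_ring (int N)"
    and \<Gamma>: "\<Gamma> \<subseteq> dual G" "finite \<Gamma>" "card \<Gamma> = d" and \<rho>: "0 < \<rho>" "\<rho> < 1"
    and B: "B = bohr G \<Gamma> \<rho>" and \<epsilon>: "0 < \<epsilon>" "\<epsilon> < 1" and \<phi>: "approx_trilinear G B \<epsilon> \<phi>"
    and X: "X = 2 * real d * ln (inverse \<rho> * inverse \<epsilon>)"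
  let ?Y = "(2 + X) powr 22000"
  have N2: "2 \<le> N" using N by (rule prime_ge_2_nat)
  have inv: "1 \<le> inverse \<rho>" "1 \<le> inverse \<epsilon>" using \<rho> \<epsilon> by (auto simp: one_le_inverse_iff)
  then have "1 * 1 \<le> inverse \<rho> * inverse \<epsilon>" using \<rho> by (intro mult_mono) auto
  then have X0: "0 \<le> X" using X by simp
  have "\<epsilon> = sqrt \<epsilon> * sqrt \<epsilon>" using \<epsilon> by simp
  also have "\<dots> \<le> sqrt \<epsilon> * 1" using \<epsilon> by (intro mult_left_mono) auto
  finally have \<epsilon>s: "\<epsilon> \<le> sqrt \<epsilon>" by simp
  \<comment> \<open>All counts and exponents are bounded by the sixth power; the exponent is much
    larger because the same constant also multiplies the error.\<close>
  have Y6: "(2 + X) ^ 6 \<le> ?Y"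
  proof -
    have "(2 + X) ^ 6 = (2 + X) powr 6" using X0 by simp
    also have "\<dots> \<le> ?Y" using X0 by (intro powr_mono) auto
    finally show ?thesis .
  qed
  have Y1: "1 \<le> (2 + X) ^ 6" using X0 by (intro one_le_power) auto
  show "\<exists>g W B' \<sigma> \<sigma>'. is_gen_polynomial N ?Y g \<and>
        is_bilinear_bohr_variety G ?Y \<sigma> W \<and> W \<subseteq> B \<times> B \<and> \<sigma> \<ge> exp (- ?Y) \<and>
        is_bohr_set G ?Y \<sigma>' B' \<and> B' \<subseteq> B \<and> \<sigma>' \<ge> exp (- ?Y) \<and>
        (\<forall>(x, y)\<in>W. \<forall>z\<in>B'. circle_norm (\<phi> x y z - g (\<iota> x) (\<iota> y) (\<iota> z)) \<le> 22000 * (real d ^ d * sqrt \<epsilon>))"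
  proof (cases "d = 0 \<or> 1 / 2 \<le> \<rho>")
    case True
    have BG: "B = carrier G"
    proof -
      have "circle_norm t \<le> \<rho> \<or> \<Gamma> = {}" for t
        using True \<Gamma> circle_norm_le_half[of t] by auto
      then show ?thesis unfolding B bohr_def by blast
    qed
    then have cG: "B = {0..int N - 1}" by (simp add: G carrier_residue_ring)
    obtain g where g: "is_gen_polynomial N 1 g"
      and close: "\<And>x y z. x \<in> B \<Longrightarrow> y \<in> B \<Longrightarrow> z \<in> B \<Longrightarrow> circle_norm (\<phi> x y z - g x y z) \<le> 1365 * \<epsilon>"
      using approx_trilinear_full_group[of N \<epsilon> \<phi>] \<phi> N2 unfolding cG G by auto
    \<comment> \<open>For d = 0 this rests on the convention that 0 to the power 0 is 1.\<close>
    have "1 \<le> real d ^ d" by (cases "d = 0") auto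
    then have "1 * sqrt \<epsilon> \<le> real d ^ d * sqrt \<epsilon>" using \<epsilon> by (intro mult_right_mono) auto
    then have err: "1365 * \<epsilon> \<le> 22000 * (real d ^ d * sqrt \<epsilon>)" using \<epsilon>s \<epsilon> by linarith
    have Y: "1 \<le> ?Y" using Y1 Y6 by linarith
    have "exp (- ?Y) \<le> exp (- 1)" using Y by simp
    also have "\<dots> \<le> 1 / 2" using exp_ge_add_one_self[of 1] by (simp add: exp_minus field_simps)
    finally have half: "exp (- ?Y) \<le> 1 / 2" .
    have var: "is_bilinear_bohr_variety G ?Y (1 / 2) (B \<times> B)"
      unfolding BG by (rule is_bilinear_bohr_variety_mono[OF is_bilinear_bohr_variety_carrier]) simp
    have bohr: "is_bohr_set G ?Y (1 / 2) B"
      unfolding BG by (rule is_bohr_set_mono[OF is_bohr_set_carrier]) simp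
    have close': "\<forall>(x, y)\<in>B \<times> B. \<forall>z\<in>B. circle_norm (\<phi> x y z - g (\<iota> x) (\<iota> y) (\<iota> z)) \<le> 22000 * (real d ^ d * sqrt \<epsilon>)"
      unfolding residue_rep_def using order_trans[OF close err] by blast
    show ?thesis
      by (rule exI[of _ g], rule exI[of _ "B \<times> B"], rule exI[of _ B], rule exI[of _ "1 / 2"], rule exI[of _ "1 / 2"],
          intro conjI is_gen_polynomial_mono[OF g Y] var bohr half close' subset_refl)
  next
    case False
    define D where "D = d + 1"
    define \<sigma> where "\<sigma> = \<rho> * \<epsilon> / (24 * real D ^ 2 * (4 ^ D * fact D))"
    obtain g W B' where g: "is_gen_polynomial N (5 * real D ^ 3) g"
      and W: "is_bilinear_bohr_variety G (3 * real D ^ 3) \<sigma> W" "W \<subseteq> B \<times> B"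
      and B': "is_bohr_set G (real D) \<sigma> B'" "B' \<subseteq> B"
      and close: "\<forall>(x, y)\<in>W. \<forall>z\<in>B'. circle_norm (\<phi> x y z - g x y z) \<le> 1372 * real D ^ 3 * \<epsilon>"
      using approx_trilinear_bohr[OF N2 \<Gamma>[unfolded G] \<rho> \<epsilon> \<phi>[unfolded B G]]
      unfolding G B D_def \<sigma>_def by blast
    have d: "1 \<le> d" using False by simp
    \<comment> \<open>With \<rho> < 1/2 the logarithm is at least ln 2 \<ge> 1/2, so X \<ge> d; with
      d \<ge> 1, X also dominates the logarithm itself. Thus 2 + X bounds both D and the
      logarithm.\<close>
    have "2 * 1 \<le> inverse \<rho> * inverse \<epsilon>"
      using False inv \<rho> by (intro mult_mono) (auto simp: field_simps)
    then have "ln 2 \<le> ln (inverse \<rho> * inverse \<epsilon>)" by simp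
    moreover have "1 / 2 \<le> ln (2::real)" using ln_le_minus_one[of "1 / 2"] by (simp add: ln_div)
    ultimately have l: "1 / 2 \<le> ln (inverse \<rho> * inverse \<epsilon>)" by linarith
    have "2 * real d * (1 / 2) \<le> X" unfolding X using l by (intro mult_left_mono) auto
    then have DX: "real D \<le> 2 + X" by (simp add: D_def)
    have "1 * ln (inverse \<rho> * inverse \<epsilon>) \<le> 2 * real d * ln (inverse \<rho> * inverse \<epsilon>)"
      using l d by (intro mult_right_mono) auto
    then have lX: "ln (inverse (\<rho> * \<epsilon>)) \<le> 2 + X" using X by simp
    \<comment> \<open>The spare factor (2 + X)^3 \<ge> 8 absorbs the constants 5 and 3 in front of
      D^3.\<close>
    have "real D ^ 3 * 8 \<le> (2 + X) ^ 3 * (2 + X) ^ 3"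
      using DX X0 power_mono[of 2 "2 + X" 3] by (intro mult_mono power_mono) auto
    also have "\<dots> = (2 + X) ^ 6" by (simp flip: power_add)
    finally have D8: "real D ^ 3 * 8 \<le> ?Y" using Y6 by linarith
    have D1: "1 \<le> real D" by (simp add: D_def)
    then have D3: "real D \<le> real D ^ 3" by (intro self_le_power) auto
    have "exp (- ?Y) \<le> exp (- ((2 + X) ^ 6))" using Y6 by simp
    also have "\<dots> \<le> \<sigma>"
      unfolding \<sigma>_def using X0 DX lX \<rho> \<epsilon> by (intro radius_lower_bound) (auto simp: D_def)
    finally have rad: "exp (- ?Y) \<le> \<sigma>" .
    have "real D ^ 3 \<le> (2 * real d) ^ 3" using d by (intro power_mono) (auto simp: D_def)
    also have "\<dots> = 8 * real (d ^ 3)" by (simp add: power_mult_distrib)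
    also have "\<dots> \<le> 8 * real (2 * d ^ d)"
      using cube_le_self_power[OF d] by (intro mult_left_mono) (simp_all only: of_nat_le_iff)
    finally have Dd: "real D ^ 3 \<le> 16 * real d ^ d" by simp
    have "1372 * real D ^ 3 * \<epsilon> \<le> 1372 * (16 * real d ^ d) * sqrt \<epsilon>"
      using Dd \<epsilon>s \<epsilon> by (intro mult_mono) auto
    \<comment> \<open>22000 rounds up 1372 * 16 = 21952, where 16 comes from D \<le> 2d and d^3
      \<le> 2 d^d.\<close>
    also have "\<dots> \<le> 22000 * (real d ^ d * sqrt \<epsilon>)" using \<epsilon> by simp
    finally have err: "1372 * real D ^ 3 * \<epsilon> \<le> 22000 * (real d ^ d * sqrt \<epsilon>)" .
    have poly: "is_gen_polynomial N ?Y g" by (rule is_gen_polynomial_mono[OF g]) (use D8 D1 D3 in linarith)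
    have var: "is_bilinear_bohr_variety G ?Y \<sigma> W"
      by (rule is_bilinear_bohr_variety_mono[OF W(1)]) (use D8 D1 D3 in linarith)
    have bohr: "is_bohr_set G ?Y \<sigma> B'"
      by (rule is_bohr_set_mono[OF B'(1)]) (use D8 D1 D3 in linarith)
    have close': "\<forall>(x, y)\<in>W. \<forall>z\<in>B'. circle_norm (\<phi> x y z - g (\<iota> x) (\<iota> y) (\<iota> z)) \<le> 22000 * (real d ^ d * sqrt \<epsilon>)"
      unfolding residue_rep_def using close order_trans[OF _ err] by blast
    show ?thesis
      by (rule exI[of _ g], rule exI[of _ W], rule exI[of _ B'], rule exI[of _ \<sigma>], rule exI[of _ \<sigma>],
          intro conjI poly var W(2) rad bohr B'(2) close')
  qed
qed simp

end
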